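(* Let $d\ge1$ and $\lambda\in\mathbb{Q}_+^d$. Let $z$ be a non-trivial element of the center of $\overline{\mathrm{He}_d^\lambda}$ and let $\exp(\mathrm{i}\varphi)\in\mathbb{S}^1\subset\mathbb{C}$ with $\varphi\in\mathbb{R}$, $\frac{\varphi}{\pi}\notin\mathbb{Q}$. Denote by $\Gamma\subset\overline{\mathrm{He}_d^\lambda}\times\mathbb{S}^1$ the discrete central subgroup generated by $(z,\exp(\mathrm{i}\varphi))$. Let $G':=(\overline{\mathrm{He}_d^\lambda}\times\mathbb{S}^1)/\Gamma$. Then $G'$ is a non-compact Lie group with Lie algebra $\mathfrak{g}'=\mathfrak{he}_d^\lambda\oplus\mathbb{R}$ and there is a symmetric bilinear form $\kappa'$ on $\mathfrak{g}'$ such that $\kappa'$ is ad-invariant and fulfills the following condition: for every subspace $V\subseteq\mathfrak{g}'$ such that the set of $X\in V$ generating a non-precompact one-parameter group in $G'$ is dense in $V$, the restriction of $\kappa'$ to $V\times V$ is positive semidefinite and its kernel has dimension at most one. Furthermore, the subgroup generated by $\mathfrak{he}_d^\lambda$ is not closed in $G'$ and is not isomorphic to $\mathrm{He}_d^\lambda$.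
   Context: For $\lambda$ with positive entries, $\mathfrak{he}_d^\lambda$ has a basis $T,Z,X_1,Y_1,\dots,X_d,Y_d$ with only non-vanishing brackets $[X_k,Y_k]=\lambda_kZ$, $[T,X_k]=\lambda_kY_k$, $[T,Y_k]=-\lambda_kX_k$. The span of $Z,X_k,Y_k$ ($k=1,\dots,d$) is a Heisenberg algebra $\mathfrak{he}_d$. Let $\widetilde{\mathrm{He}_d^\lambda}=\exp(\mathbb{R}T)\ltimes\widetilde{\mathrm{He}_d}$ be the simply-connected Lie group with Lie algebra $\mathfrak{he}_d^\lambda$, where $\widetilde{\mathrm{He}_d}$ is the simply-connected Heisenberg group. For $\lambda\in\mathbb{Q}_+^d$ let $\Lambda'=\ker(\exp\circ\,\mathrm{ad}:\mathbb{R}T\to\mathrm{Aut}(\mathfrak{he}_d^\lambda))$, a lattice in $\mathbb{R}T$ (identified with its image in $\exp(\mathbb{R}T)$), and let $\Lambda\cong\mathbb{Z}$ be a lattice in the center ($\cong\mathbb{R}$) of $\widetilde{\mathrm{He}_d}$. Then $\mathrm{He}_d^\lambda:=\widetilde{\mathrm{He}_d^\lambda}/(\Lambda'\times\Lambda)$ and $\overline{\mathrm{He}_d^\lambda}:=\widetilde{\mathrm{He}_d^\lambda}/\Lambda'\cong\mathbb{S}^1\ltimes\widetilde{\mathrm{He}_d}$. A form $b$ is ad-invariant if $b([X,Y],Z)=b(X,[Y,Z])$. $X$ generates a non-precompact one-parameter group if $\{\exp(tX)\}_{t\in\mathbb{R}}$ does not have compact closure. The subgroup generated by a subalgebra is the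 connected Lie subgroup with that Lie algebra. *)

theory Defs
  imports
    "HOL-Analysis.Analysis"
    "HOL-Algebra.Coset"
    "HOL-Algebra.Generated_Groups"
begin

section \<open>Smooth maps and Lie groups\<close>

text \<open>The notions \<open>Ck_on\<close> and \<open>smooth_on\<close> are meant for open sets \<open>S\<close>: derivatives are taken
  with respect to full neighbourhoods of the points of \<open>S\<close>.\<close>

primrec Ck_on :: "nat \<Rightarrow> 'v::euclidean_space set \<Rightarrow> ('v \<Rightarrow> 'w::euclidean_space) \<Rightarrow> bool" where
  "Ck_on 0 S f \<longleftrightarrow> continuous_on S f"
| "Ck_on (Suc k) S f \<longleftrightarrow> (\<forall>x\<in>S. f differentiable (at x)) \<and>
     (\<forall>v. Ck_on k S (\<lambda>x. frechet_derivative f (at x) v))"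

definition smooth_on :: "'v::euclidean_space set \<Rightarrow> ('v \<Rightarrow> 'w::euclidean_space) \<Rightarrow> bool" where
  "smooth_on S f \<longleftrightarrow> (\<forall>k. Ck_on k S f)"

text \<open>A group together with a topology and an atlas. A chart is a pair \<open>(U, f)\<close> of an open set and
  a coordinate map \<open>f\<close>, of which only the values on \<open>U\<close> matter.\<close>

record ('a, 'v) lie = "'a monoid" +
  topo :: "'a topology"
  atlas :: "('a set \<times> ('a \<Rightarrow> 'v)) set"

definition smooth_manifold :: "'a topology \<Rightarrow> ('a set \<times> ('a \<Rightarrow> 'v::euclidean_space)) set \<Rightarrow> bool" where
  "smooth_manifold X A \<longleftrightarrow>
     Hausdorff_space X \<and> second_countable X \<and>
     (\<Union>(U, f)\<in>A. U) = topspace X \<and>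
     (\<forall>(U, f)\<in>A. openin X U \<and> open (f ` U) \<and>
        homeomorphic_map (subtopology X U) (top_of_set (f ` U)) f) \<and>
     (\<forall>(U, f)\<in>A. \<forall>(W, g)\<in>A. smooth_on (f ` (U \<inter> W)) (g \<circ> inv_into U f))"

definition smooth_map ::
    "('a, 'v::euclidean_space) lie \<Rightarrow> ('b, 'w::euclidean_space) lie \<Rightarrow> ('a \<Rightarrow> 'b) \<Rightarrow> bool" where
  "smooth_map G H F \<longleftrightarrow>
     continuous_map (topo G) (topo H) F \<and>
     (\<forall>(U, f)\<in>atlas G. \<forall>(W, g)\<in>atlas H. smooth_on (f ` (U \<inter> F -` W)) (g \<circ> F \<circ> inv_into U f))"

definition lie_prod :: "('a, 'v) lie \<Rightarrow> ('b, 'w) lie \<Rightarrow> ('a \<times> 'b, 'v \<times> 'w) lie" where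
  "lie_prod G H =
     \<lparr>carrier = carrier (G \<times>\<times> H), mult = mult (G \<times>\<times> H), one = one (G \<times>\<times> H),
      topo = prod_topology (topo G) (topo H),
      atlas = {(U \<times> W, map_prod f g) | U f W g. (U, f) \<in> atlas G \<and> (W, g) \<in> atlas H}\<rparr>"

definition lie_group :: "('a, 'v::euclidean_space) lie \<Rightarrow> bool" where
  "lie_group G \<longleftrightarrow>
     group G \<and> topspace (topo G) = carrier G \<and> smooth_manifold (topo G) (atlas G) \<and>
     smooth_map (lie_prod G G) G (\<lambda>(x, y). x \<otimes>\<^bsub>G\<^esub> y) \<and>
     smooth_map G G (\<lambda>x. inv\<^bsub>G\<^esub> x)"

definition lie_isomorphic ::
    "('a, 'v::euclidean_space) lie \<Rightarrow> ('b, 'w::euclidean_space) lie \<Rightarrow> bool" where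
  "lie_isomorphic G H \<longleftrightarrow>
     (\<exists>F\<in>iso G H. smooth_map G H F \<and> smooth_map H G (inv_into (carrier G) F))"

definition group_center :: "('a, 'm) monoid_scheme \<Rightarrow> 'a set" where
  "group_center G = {z \<in> carrier G. \<forall>x\<in>carrier G. z \<otimes>\<^bsub>G\<^esub> x = x \<otimes>\<^bsub>G\<^esub> z}"

text \<open>The quotient topology on the set of cosets \<open>Nx\<close>, where \<open>x\<close> ranges over the space \<open>X\<close>.\<close>

definition coset_topology :: "('a, 'm) monoid_scheme \<Rightarrow> 'a topology \<Rightarrow> 'a set \<Rightarrow> 'a set topology" where
  "coset_topology G X N =
     topology (\<lambda>V. V \<subseteq> (\<lambda>x. N #>\<^bsub>G\<^esub> x) ` topspace X \<and> openin X {x \<in> topspace X. N #>\<^bsub>G\<^esub> x \<in> V})"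

lemma openin_coset_topology:
  "openin (coset_topology G X N) V \<longleftrightarrow>
     V \<subseteq> (\<lambda>x. N #>\<^bsub>G\<^esub> x) ` topspace X \<and> openin X {x \<in> topspace X. N #>\<^bsub>G\<^esub> x \<in> V}"
proof -
  let ?q = "\<lambda>x. N #>\<^bsub>G\<^esub> x"
  have "istopology (\<lambda>V. V \<subseteq> ?q ` topspace X \<and> openin X {x \<in> topspace X. ?q x \<in> V})"
    unfolding istopology_def
  proof (intro conjI allI impI)
    fix S T
    assume S: "S \<subseteq> ?q ` topspace X \<and> openin X {x \<in> topspace X. ?q x \<in> S}"
      and T: "T \<subseteq> ?q ` topspace X \<and> openin X {x \<in> topspace X. ?q x \<in> T}"
    show "S \<inter> T \<subseteq> ?q ` topspace X" using S by blast
    have "{x \<in> topspace X. ?q x \<in> S \<inter> T} = {x \<in> topspace X. ?q x \<in> S} \<inter> {x \<in> topspace X. ?q x \<in> T}"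
      by blast
    then show "openin X {x \<in> topspace X. ?q x \<in> S \<inter> T}" using S T by (simp add: openin_Int)
  next
    fix \<K> assume K: "\<forall>K\<in>\<K>. K \<subseteq> ?q ` topspace X \<and> openin X {x \<in> topspace X. ?q x \<in> K}"
    show "\<Union>\<K> \<subseteq> ?q ` topspace X" using K by blast
    have "{x \<in> topspace X. ?q x \<in> \<Union>\<K>} = \<Union>((\<lambda>K. {x \<in> topspace X. ?q x \<in> K}) ` \<K>)"
      by blast
    then show "openin X {x \<in> topspace X. ?q x \<in> \<Union>\<K>}" using K by auto
  qed
  then show ?thesis by (simp add: coset_topology_def topology_inverse')
qed

text \<open>The quotient of a Lie group by a discrete normal subgroup \<open>N\<close>. Its charts are the charts of
  \<open>G\<close>, restricted to open sets \<open>W\<close> on which the projection is injective, composed with the local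
  inverse of the projection.\<close>

definition lie_quot :: "('a, 'v) lie \<Rightarrow> 'a set \<Rightarrow> ('a set, 'v) lie" where
  "lie_quot G N =
     \<lparr>carrier = carrier (G Mod N), mult = mult (G Mod N), one = one (G Mod N),
      topo = coset_topology G (topo G) N,
      atlas = {((\<lambda>x. N #>\<^bsub>G\<^esub> x) ` W, f \<circ> inv_into W (\<lambda>x. N #>\<^bsub>G\<^esub> x)) | W f.
                 inj_on (\<lambda>x. N #>\<^bsub>G\<^esub> x) W \<and>
                 (\<exists>U. (U, f) \<in> atlas G \<and> openin (topo G) W \<and> W \<subseteq> U)}\<rparr>"

text \<open>A discrete subgroup \<open>L\<close> of the closed subgroup \<open>K\<close> of \<open>G\<close> with compact quotient \<open>K/L\<close>.\<close>

definition is_lattice_in :: "('a, 'v) lie \<Rightarrow> 'a set \<Rightarrow> 'a set \<Rightarrow> bool" where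
  "is_lattice_in G K L \<longleftrightarrow>
     subgroup L G \<and> L \<subseteq> K \<and> subtopology (topo G) L = discrete_topology L \<and>
     compact_space (coset_topology G (subtopology (topo G) K) L)"

definition circle :: "(complex, real) lie" where
  "circle =
     \<lparr>carrier = sphere 0 1, mult = (*), one = 1, topo = top_of_set (sphere 0 1),
      atlas = {(cis ` {a<..<a + 2 * pi}, inv_into {a<..<a + 2 * pi} cis) | a. True}\<rparr>"

section \<open>The Lie algebra of a Lie group\<close>

text \<open>Let \<open>c = (U, f)\<close> be a chart at the unit. In its coordinates, \<open>left_inv_field G c v\<close> is the
  left-invariant vector field with value \<open>v\<close> at the unit, and \<open>chart_bracket\<close> is the value at the
  unit of the bracket \<open>[X, Y] = DY X - DX Y\<close> of the two left-invariant vector fields.\<close>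

definition chart_mult :: "('a, 'v) lie \<Rightarrow> 'a set \<times> ('a \<Rightarrow> 'v) \<Rightarrow> 'v \<Rightarrow> 'v \<Rightarrow> 'v" where
  "chart_mult G c x y =
     (case c of (U, f) \<Rightarrow> f (inv_into U f x \<otimes>\<^bsub>G\<^esub> inv_into U f y))"

definition left_inv_field ::
    "('a, 'v::euclidean_space) lie \<Rightarrow> 'a set \<times> ('a \<Rightarrow> 'v) \<Rightarrow> 'v \<Rightarrow> 'v \<Rightarrow> 'v" where
  "left_inv_field G c v x = frechet_derivative (chart_mult G c x) (at (snd c \<one>\<^bsub>G\<^esub>)) v"

definition chart_bracket ::
    "('a, 'v::euclidean_space) lie \<Rightarrow> 'a set \<times> ('a \<Rightarrow> 'v) \<Rightarrow> 'v \<Rightarrow> 'v \<Rightarrow> 'v" where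
  "chart_bracket G c u v =
     frechet_derivative (left_inv_field G c v) (at (snd c \<one>\<^bsub>G\<^esub>)) u -
     frechet_derivative (left_inv_field G c u) (at (snd c \<one>\<^bsub>G\<^esub>)) v"

text \<open>A vector space \<open>'g\<close> is identified with the tangent space of \<open>G\<close> at the unit by means of a map
  \<open>p :: 'g \<Rightarrow> 'a\<close> with \<open>p 0 = 1\<close> that is a local diffeomorphism at \<open>0\<close>: the vector \<open>X\<close> corresponds to
  the velocity of the curve \<open>p (t X)\<close> at \<open>t = 0\<close>. The map \<open>p\<close> need not be the exponential map.
  The predicate \<open>has_lie_algebra G br p\<close> says that this is an isomorphism from the Lie algebra with
  bracket \<open>br\<close> to the Lie algebra of \<open>G\<close>.\<close>

definition tangent_coords :: "('g::euclidean_space \<Rightarrow> 'a) \<Rightarrow> ('a \<Rightarrow> 'v::euclidean_space) \<Rightarrow> 'g \<Rightarrow> 'v" where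
  "tangent_coords p f = frechet_derivative (f \<circ> p) (at 0)"

definition has_lie_algebra ::
    "('a, 'v::euclidean_space) lie \<Rightarrow> ('g::euclidean_space \<Rightarrow> 'g \<Rightarrow> 'g) \<Rightarrow> ('g \<Rightarrow> 'a) \<Rightarrow> bool" where
  "has_lie_algebra G br p \<longleftrightarrow>
     p 0 = \<one>\<^bsub>G\<^esub> \<and>
     (\<forall>(U, f)\<in>atlas G. \<one>\<^bsub>G\<^esub> \<in> U \<longrightarrow>
        (f \<circ> p) differentiable (at 0) \<and> bij (tangent_coords p f) \<and>
        (\<forall>X Y. tangent_coords p f (br X Y) =
               chart_bracket G (U, f) (tangent_coords p f X) (tangent_coords p f Y)))"

definition one_param_group ::
    "('a, 'v::euclidean_space) lie \<Rightarrow> ('g::euclidean_space \<Rightarrow> 'a) \<Rightarrow> 'g \<Rightarrow> (real \<Rightarrow> 'a) \<Rightarrow> bool" where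
  "one_param_group G p X \<gamma> \<longleftrightarrow>
     continuous_map euclideanreal (topo G) \<gamma> \<and>
     (\<forall>s t. \<gamma> (s + t) = \<gamma> s \<otimes>\<^bsub>G\<^esub> \<gamma> t) \<and>
     (\<forall>(U, f)\<in>atlas G. \<one>\<^bsub>G\<^esub> \<in> U \<longrightarrow>
        ((f \<circ> \<gamma>) has_vector_derivative tangent_coords p f X) (at 0))"

definition lie_exp :: "('a, 'v::euclidean_space) lie \<Rightarrow> ('g::euclidean_space \<Rightarrow> 'a) \<Rightarrow> 'g \<Rightarrow> 'a" where
  "lie_exp G p X = (THE g. \<exists>\<gamma>. one_param_group G p X \<gamma> \<and> \<gamma> 1 = g)"

definition generates_non_precompact ::
    "('a, 'v::euclidean_space) lie \<Rightarrow> ('g::euclidean_space \<Rightarrow> 'a) \<Rightarrow> 'g \<Rightarrow> bool" where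
  "generates_non_precompact G p X \<longleftrightarrow>
     \<not> compactin (topo G) (topo G closure_of range (\<lambda>t. lie_exp G p (t *\<^sub>R X)))"

text \<open>\<open>H\<close> is the connected (immersed, not necessarily embedded) Lie subgroup of \<open>G\<close> with Lie algebra
  \<open>h\<close>: the differential of the inclusion at the unit is injective with image \<open>h\<close>. The underlying set
  is the subgroup generated by \<open>exp h\<close>; the topology and smooth structure are those of \<open>H\<close>, not the
  ones induced from \<open>G\<close>.\<close>

definition connected_lie_subgroup ::
    "('a, 'v::euclidean_space) lie \<Rightarrow> ('g::euclidean_space \<Rightarrow> 'a) \<Rightarrow> 'g set \<Rightarrow>
     ('a, 'w::euclidean_space) lie \<Rightarrow> bool" where
  "connected_lie_subgroup G p h H \<longleftrightarrow>
     lie_group H \<and> connected_space (topo H) \<and>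
     carrier H = generate G (lie_exp G p ` h) \<and>
     subgroup (carrier H) G \<and>
     (\<forall>x\<in>carrier H. \<forall>y\<in>carrier H. x \<otimes>\<^bsub>H\<^esub> y = x \<otimes>\<^bsub>G\<^esub> y) \<and>
     smooth_map H G (\<lambda>x. x) \<and>
     (\<forall>(U, f)\<in>atlas G. \<forall>(W, g)\<in>atlas H. \<one>\<^bsub>G\<^esub> \<in> U \<and> \<one>\<^bsub>H\<^esub> \<in> W \<longrightarrow>
        (let D = frechet_derivative (f \<circ> inv_into W g) (at (g \<one>\<^bsub>H\<^esub>))
         in inj D \<and> range D = tangent_coords p f ` h))"

section \<open>Forms\<close>

definition ad_invariant :: "('g \<Rightarrow> 'g \<Rightarrow> 'g) \<Rightarrow> ('g \<Rightarrow> 'g \<Rightarrow> real) \<Rightarrow> bool" where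
  "ad_invariant br b \<longleftrightarrow> (\<forall>X Y Z. b (br X Y) Z = b X (br Y Z))"

definition form_kernel :: "('g \<Rightarrow> 'g \<Rightarrow> real) \<Rightarrow> 'g set \<Rightarrow> 'g set" where
  "form_kernel b V = {X \<in> V. \<forall>Y\<in>V. b X Y = 0}"

section \<open>The oscillator algebra and its groups\<close>

text \<open>The vector \<open>(z, x, y)\<close> of \<open>'d heis\<close> stands for the sum of \<open>z Z\<close> and of all
  \<open>x\<^sub>k X\<^sub>k + y\<^sub>k Y\<^sub>k\<close>, and \<open>(t, v)\<close> in \<open>'d osc\<close> stands for \<open>t T + v\<close>.\<close>

type_synonym 'd heis = "real \<times> (real^'d) \<times> (real^'d)"
type_synonym 'd osc = "real \<times> 'd heis"

definition heis_form :: "real^'d \<Rightarrow> 'd heis \<Rightarrow> 'd heis \<Rightarrow> real" where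
  "heis_form lam = (\<lambda>(z, x, y) (z', x', y'). \<Sum>k\<in>UNIV. lam $ k * (x $ k * y' $ k - y $ k * x' $ k))"

definition ad_T :: "real^'d \<Rightarrow> 'd heis \<Rightarrow> 'd heis" where
  "ad_T lam = (\<lambda>(z, x, y). (0, (\<chi> k. - lam $ k * y $ k), (\<chi> k. lam $ k * x $ k)))"

definition osc_bracket :: "real^'d \<Rightarrow> 'd osc \<Rightarrow> 'd osc \<Rightarrow> 'd osc" where
  "osc_bracket lam = (\<lambda>(t, v) (t', v').
     (0, (heis_form lam v v', 0, 0) + t *\<^sub>R ad_T lam v' - t' *\<^sub>R ad_T lam v))"

text \<open>The simply-connected Heisenberg group, realised on its Lie algebra by the
  Baker--Campbell--Hausdorff product \<open>v + v' + [v, v'] / 2\<close>.\<close>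

definition heis_mult :: "real^'d \<Rightarrow> 'd heis \<Rightarrow> 'd heis \<Rightarrow> 'd heis" where
  "heis_mult lam v v' = v + v' + (heis_form lam v v' / 2, 0, 0)"

definition Heis_tilde :: "real^'d \<Rightarrow> ('d heis, 'd heis) lie" where
  "Heis_tilde lam =
     \<lparr>carrier = UNIV, mult = heis_mult lam, one = 0, topo = euclidean, atlas = {(UNIV, \<lambda>x. x)}\<rparr>"

text \<open>The action of \<open>exp (t T)\<close>, i.e. the exponential of \<open>t ad T\<close> on the Heisenberg algebra.\<close>

definition rot :: "real^'d \<Rightarrow> real \<Rightarrow> 'd heis \<Rightarrow> 'd heis" where
  "rot lam t = (\<lambda>(z, x, y).
     (z, (\<chi> k. cos (lam $ k * t) * x $ k - sin (lam $ k * t) * y $ k),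
         (\<chi> k. sin (lam $ k * t) * x $ k + cos (lam $ k * t) * y $ k)))"

text \<open>The semidirect product of \<open>exp (\<real> T)\<close> and the Heisenberg group. The element \<open>(t, v)\<close> is the
  product of \<open>v\<close> and \<open>exp (t T)\<close>, in this order.\<close>

definition Osc_tilde :: "real^'d \<Rightarrow> ('d osc, 'd osc) lie" where
  "Osc_tilde lam =
     \<lparr>carrier = UNIV,
      mult = (\<lambda>(t, v) (t', v'). (t + t', heis_mult lam v (rot lam t v'))),
      one = 0, topo = euclidean, atlas = {(UNIV, \<lambda>x. x)}\<rparr>"

definition op_exp :: "('v::real_normed_vector \<Rightarrow> 'v) \<Rightarrow> 'v \<Rightarrow> 'v" where
  "op_exp A x = (\<Sum>n. (1 / fact n) *\<^sub>R (A ^^ n) x)"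

text \<open>The kernel of \<open>exp \<circ> ad\<close> on \<open>\<real> T\<close>. The tuple \<open>(t, 0)\<close> is both the vector \<open>t T\<close> and the group
  element \<open>exp (t T)\<close>.\<close>

definition Lambda' :: "real^'d \<Rightarrow> 'd osc set" where
  "Lambda' lam = {(t, 0) | t. op_exp (osc_bracket lam (t, 0)) = id}"

definition Osc_bar :: "real^'d \<Rightarrow> ('d osc set, 'd osc) lie" where
  "Osc_bar lam = lie_quot (Osc_tilde lam) (Lambda' lam)"

definition Osc :: "real^'d \<Rightarrow> 'd heis set \<Rightarrow> ('d osc set, 'd osc) lie" where
  "Osc lam L = lie_quot (Osc_tilde lam) {(t, v). (t, 0) \<in> Lambda' lam \<and> v \<in> L}"

definition Gamma_sub :: "real^'d \<Rightarrow> 'd osc set \<Rightarrow> real \<Rightarrow> ('d osc set \<times> complex) set" where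
  "Gamma_sub lam z \<phi> = generate (lie_prod (Osc_bar lam) circle) {(z, cis \<phi>)}"

definition G' :: "real^'d \<Rightarrow> 'd osc set \<Rightarrow> real \<Rightarrow> (('d osc set \<times> complex) set, 'd osc \<times> real) lie" where
  "G' lam z \<phi> = lie_quot (lie_prod (Osc_bar lam) circle) (Gamma_sub lam z \<phi>)"

definition g'_bracket :: "real^'d \<Rightarrow> 'd osc \<times> real \<Rightarrow> 'd osc \<times> real \<Rightarrow> 'd osc \<times> real" where
  "g'_bracket lam = (\<lambda>(X, s) (Y, r). (osc_bracket lam X Y, 0))"

text \<open>The composition of the covering maps \<open>Osc_tilde \<times> \<real> \<rightarrow> Osc_bar \<times> circle \<rightarrow> G'\<close>; its differential
  at \<open>0\<close> is the canonical identification of the direct sum of \<open>'d osc\<close> and \<open>\<real>\<close> with the Lie algebra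
  of \<open>G'\<close>.\<close>

definition G'_proj :: "real^'d \<Rightarrow> 'd osc set \<Rightarrow> real \<Rightarrow> 'd osc \<times> real \<Rightarrow> ('d osc set \<times> complex) set" where
  "G'_proj lam z \<phi> = (\<lambda>(X, s).
     Gamma_sub lam z \<phi> #>\<^bsub>lie_prod (Osc_bar lam) circle\<^esub> (Lambda' lam #>\<^bsub>Osc_tilde lam\<^esub> X, cis s))"

end

theory Submission
  imports Defs
begin

text \<open>
  All groups of the theorem are quotients of a vector space \<open>E\<close> with a smooth group law, namely of the
  simply connected oscillator group (times a line) in its global coordinates, by a discrete subgroup
  \<open>N\<close>. The point that makes the calculations short is that the elements of \<open>N\<close> are central and that
  multiplication by them is a translation of the vector space: they consist of periods of the rotation
  along \<open>T\<close>, of multiples of \<open>Z\<close>, and of numbers in the additional line. The charts of the quotients are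
  local sections of the projection from \<open>E\<close>, so any two of them differ by a locally constant
  translation (\<open>chart_translation\<close>). Hence whatever is smooth on \<open>E\<close> and compatible with \<open>N\<close> is
  smooth on the quotient, and the class of groups obtained in this way is closed under products, quotients
  and immersed images (\<open>covered_lie_group_prod\<close>, \<open>covered_lie_group_quot\<close>,
  \<open>covered_lie_group_image\<close>). The Lie algebra and the exponential map can be computed on \<open>E\<close>
  (\<open>has_lie_algebra_proj\<close>, \<open>lie_exp_scaleR\<close>).

  The centre of \<open>Osc_bar lam\<close> is the line spanned by \<open>Z\<close> (\<open>center_covered_by_Lambda'\<close>), so \<open>z\<close> is the class
  of \<open>c Z\<close> with \<open>c \<noteq> 0\<close>, and \<open>G'\<close> is the quotient of the oscillator group times the line by the lattice
  generated by the periods along \<open>T\<close>, by \<open>(c Z, \<phi>)\<close> and by \<open>(0, 2 \<pi>)\<close>. The coordinates along \<open>X\<^sub>k\<close> and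
  \<open>Y\<^sub>k\<close> survive in the quotient, which is therefore not compact.

  The form \<open>\<kappa>'\<close> pairs \<open>T\<close> with \<open>Z\<close> and is the sum of squares of the other coordinates
  (\<open>osc_form\<close>). A vector with non-zero \<open>T\<close>-coordinate is conjugate to a vector in the span of \<open>T\<close>,
  \<open>Z\<close> and the additional line, where the lattice has full rank, so its one-parameter group is precompact
  (\<open>elliptic_precompact\<close>). Thus the subspaces \<open>V\<close> in question lie in the hyperplane without
  \<open>T\<close>-coordinate, where the form is positive semidefinite and its kernel is spanned by \<open>Z\<close>.

  Since \<open>\<phi> / \<pi>\<close> is irrational, the lattice meets the oscillator group only in the periods along \<open>T\<close>.
  So the subgroup generated by the oscillator algebra is an immersed copy of \<open>Osc_bar lam\<close>. Its preimage
  contains the numbers \<open>n \<phi> + 2 \<pi> k\<close> of the additional line and no others; they are dense, and so the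
  subgroup is not closed (\<open>H_not_closed\<close>). Its centre is a line without torsion, whereas the centre of
  \<open>Osc lam L\<close> contains a circle and thus an element of order two (\<open>H_not_isomorphic\<close>).
\<close>

section \<open>Calculus of smooth maps\<close>

lemma Ck_on_subset: "Ck_on k T f \<Longrightarrow> S \<subseteq> T \<Longrightarrow> Ck_on k S f"
  by (induction k arbitrary: f) (auto intro: continuous_on_subset)

text \<open>A smooth function need not be given by one formula on all of the domain: chart changes and group
  operations in charts are, near each point, a globally smooth function plus a constant that depends
  on the point, and this lemma glues these local descriptions. The set \<open>S\<close> may be arbitrary, because
  the neighbourhoods \<open>T\<close> are open in the whole space.\<close>

lemma Ck_on_locally:
  assumes "\<And>x. x \<in> S \<Longrightarrow> \<exists>T g. open T \<and> x \<in> T \<and> Ck_on k T g \<and> (\<forall>y\<in>T. f y = g y)"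
  shows "Ck_on k S f"
  using assms
proof (induction k arbitrary: f)
  case 0
  have "continuous (at x within S) f" if "x \<in> S" for x
  proof -
    obtain T g where T: "open T" "x \<in> T" "continuous_on T g" "\<forall>y\<in>T. f y = g y"
      using 0[OF \<open>x \<in> S\<close>] by auto
    have "continuous_on T f" by (rule continuous_on_eq[OF T(3)]) (simp add: T(4))
    then have "continuous (at x) f" using T(2) by (simp add: continuous_on_eq_continuous_at[OF T(1)])
    then show ?thesis by (rule continuous_at_imp_continuous_at_within)
  qed
  then show ?case by (simp add: continuous_on_eq_continuous_within)
next
  case (Suc k)
  have deriv: "(f has_derivative frechet_derivative g (at x)) (at x)"
    if "open T" "x \<in> T" "Ck_on (Suc k) T g" "\<forall>y\<in>T. f y = g y" for T x g
  proof -
    have "(g has_derivative frechet_derivative g (at x)) (at x)"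
      using that by (auto simp: frechet_derivative_works[symmetric])
    then show ?thesis using that by (auto intro: has_derivative_transform_within_open)
  qed
  have "\<exists>T h. open T \<and> x \<in> T \<and> Ck_on k T h \<and> (\<forall>y\<in>T. frechet_derivative f (at y) v = h y)"
    if "x \<in> S" for x v
  proof -
    obtain T g where T: "open T" "x \<in> T" "Ck_on (Suc k) T g" "\<forall>y\<in>T. f y = g y"
      using Suc.prems[OF \<open>x \<in> S\<close>] by auto
    then have "frechet_derivative f (at y) = frechet_derivative g (at y)" if "y \<in> T" for y
      using deriv[OF T(1) that T(3,4)] frechet_derivative_at by metis
    then show ?thesis using T by (intro exI[of _ T] exI[of _ "\<lambda>x. frechet_derivative g (at x) v"]) auto
  qed
  then have "\<forall>v. Ck_on k S (\<lambda>x. frechet_derivative f (at x) v)"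
    by (intro allI Suc.IH)
  moreover have "f differentiable (at x)" if "x \<in> S" for x
    using Suc.prems[OF that] deriv unfolding differentiable_def by blast
  ultimately show ?case by simp
qed

text \<open>The recursion for \<open>Ck_on\<close> is phrased with the chosen derivative \<open>frechet_derivative\<close>; the next
  two lemmas allow an arbitrary derivative in its place, so that the usual differentiation rules apply
  in the inductions below.\<close>

lemma Ck_SucI:
  assumes "\<And>x. (f has_derivative f' x) (at x)" and "\<And>v. Ck_on k UNIV (\<lambda>x. f' x v)"
  shows "Ck_on (Suc k) UNIV f"
proof -
  have "frechet_derivative f (at x) = f' x" for x
    using assms(1) by (metis frechet_derivative_at)
  then show ?thesis using assms by (auto simp: differentiable_def)
qed

lemma Ck_SucE:
  assumes "Ck_on (Suc k) UNIV f"
  obtains f' where "\<And>x. (f has_derivative f' x) (at x)" "\<And>v. Ck_on k UNIV (\<lambda>x. f' x v)"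
  using assms that[of "\<lambda>x. frechet_derivative f (at x)"]
  by (simp add: frechet_derivative_works[symmetric])

lemma Ck_on_SucD: "Ck_on (Suc k) S f \<Longrightarrow> Ck_on k S f"
proof (induction k arbitrary: f)
  case 0
  then show ?case
    by (auto simp: differentiable_imp_continuous_within intro!: continuous_at_imp_continuous_on)
qed auto

named_theorems Ck_intros

lemma Ck_const [Ck_intros]: "Ck_on k UNIV (\<lambda>x. c)"
  by (induction k arbitrary: c) (auto intro!: Ck_SucI has_derivative_const simp del: Ck_on.simps(2))

lemma Ck_linear:
  assumes "bounded_linear h" and "Ck_on k UNIV f"
  shows "Ck_on k UNIV (\<lambda>x. h (f x))"
  using assms(2)
proof (induction k arbitrary: f)
  case 0
  then show ?case
    using bounded_linear.continuous_on[OF assms(1)] by auto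
next
  case (Suc k)
  obtain f' where "\<And>x. (f has_derivative f' x) (at x)" "\<And>v. Ck_on k UNIV (\<lambda>x. f' x v)"
    using Suc.prems by (rule Ck_SucE) (rule that)
  then show ?case
    by (intro Ck_SucI[of _ "\<lambda>x v. h (f' x v)"] bounded_linear.has_derivative[OF assms(1)] Suc.IH)
qed

lemma Ck_id [Ck_intros]: "Ck_on k UNIV (\<lambda>x. x)"
  by (cases k) (auto intro!: Ck_SucI has_derivative_ident Ck_const simp del: Ck_on.simps(2))

lemma Ck_compose_linear:
  assumes "bounded_linear h" and "Ck_on k UNIV f"
  shows "Ck_on k UNIV (\<lambda>x. f (h x))"
  using assms(2)
proof (induction k arbitrary: f)
  case 0
  have "continuous_on UNIV h" using assms(1) by (simp add: linear_continuous_on)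
  then show ?case using 0 by (auto intro: continuous_on_compose2)
next
  case (Suc k)
  obtain f' where f': "\<And>x. (f has_derivative f' x) (at x)" "\<And>v. Ck_on k UNIV (\<lambda>x. f' x v)"
    using Suc.prems by (rule Ck_SucE) (rule that)
  have "((\<lambda>x. f (h x)) has_derivative (\<lambda>v. f' (h x) (h v))) (at x)" for x
    using has_derivative_compose[OF bounded_linear_imp_has_derivative[OF assms(1)] f'(1)] .
  then show ?case by (rule Ck_SucI) (rule Suc.IH[OF f'(2)])
qed

lemma Ck_add [Ck_intros]:
  "Ck_on k UNIV f \<Longrightarrow> Ck_on k UNIV g \<Longrightarrow> Ck_on k UNIV (\<lambda>x. f x + g x)"
proof (induction k arbitrary: f g)
  case (Suc k)
  obtain f' where "\<And>x. (f has_derivative f' x) (at x)" "\<And>v. Ck_on k UNIV (\<lambda>x. f' x v)"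
    using Suc.prems(1) by (rule Ck_SucE) (rule that)
  moreover obtain g' where "\<And>x. (g has_derivative g' x) (at x)" "\<And>v. Ck_on k UNIV (\<lambda>x. g' x v)"
    using Suc.prems(2) by (rule Ck_SucE) (rule that)
  ultimately show ?case
    by (intro Ck_SucI[of _ "\<lambda>x v. f' x v + g' x v"] has_derivative_add Suc.IH)
qed (auto intro: continuous_on_add)

lemma Ck_mult [Ck_intros]:
  fixes f g :: "'v::euclidean_space \<Rightarrow> real"
  shows "Ck_on k UNIV f \<Longrightarrow> Ck_on k UNIV g \<Longrightarrow> Ck_on k UNIV (\<lambda>x. f x * g x)"
proof (induction k arbitrary: f g)
  case (Suc k)
  obtain f' where f': "\<And>x. (f has_derivative f' x) (at x)" "\<And>v. Ck_on k UNIV (\<lambda>x. f' x v)"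
    using Suc.prems(1) by (rule Ck_SucE) (rule that)
  obtain g' where g': "\<And>x. (g has_derivative g' x) (at x)" "\<And>v. Ck_on k UNIV (\<lambda>x. g' x v)"
    using Suc.prems(2) by (rule Ck_SucE) (rule that)
  show ?case
    by (rule Ck_SucI[OF has_derivative_mult[OF f'(1) g'(1)]])
       (intro Ck_add Suc.IH f' g' Ck_on_SucD[OF Suc.prems(1)] Ck_on_SucD[OF Suc.prems(2)])
qed (auto intro: continuous_on_mult)

lemma Ck_sum [Ck_intros]:
  "finite A \<Longrightarrow> (\<And>i. i \<in> A \<Longrightarrow> Ck_on k UNIV (f i)) \<Longrightarrow> Ck_on k UNIV (\<lambda>x. \<Sum>i\<in>A. f i x)"
  by (induction A rule: finite_induct) (auto intro: Ck_intros)

lemma Ck_minus [Ck_intros]: "Ck_on k UNIV f \<Longrightarrow> Ck_on k UNIV (\<lambda>x. - f x)"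
  by (rule Ck_linear[OF bounded_linear_minus[OF bounded_linear_ident]])

lemma Ck_diff [Ck_intros]:
  "Ck_on k UNIV f \<Longrightarrow> Ck_on k UNIV g \<Longrightarrow> Ck_on k UNIV (\<lambda>x. f x - g x)"
  using Ck_add[of k f "\<lambda>x. - g x"] Ck_minus[of k g] by simp

lemma Ck_fst [Ck_intros]: "Ck_on k UNIV f \<Longrightarrow> Ck_on k UNIV (\<lambda>x. fst (f x))"
  by (rule Ck_linear[OF bounded_linear_fst])

lemma Ck_snd [Ck_intros]: "Ck_on k UNIV f \<Longrightarrow> Ck_on k UNIV (\<lambda>x. snd (f x))"
  by (rule Ck_linear[OF bounded_linear_snd])

lemma Ck_nth [Ck_intros]: "Ck_on k UNIV f \<Longrightarrow> Ck_on k UNIV (\<lambda>x. f x $ i)"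
  for f :: "'v::euclidean_space \<Rightarrow> real^'n"
  by (rule Ck_linear[OF bounded_linear_vec_nth])

lemma Ck_Pair [Ck_intros]:
  assumes "Ck_on k UNIV f" and "Ck_on k UNIV g"
  shows "Ck_on k UNIV (\<lambda>x. (f x, g x))"
proof -
  have "Ck_on k UNIV (\<lambda>x. (f x, 0) + (0, g x))"
    using assms
    by (intro Ck_add Ck_linear[of "\<lambda>a. (a, 0)"] Ck_linear[of "\<lambda>a. (0, a)"] bounded_linear_Pair
        bounded_linear_ident bounded_linear_zero)
  then show ?thesis by simp
qed

lemma Ck_vec [Ck_intros]:
  assumes "\<And>i. Ck_on k UNIV (\<lambda>x. f x i)"
  shows "Ck_on k UNIV (\<lambda>x. (\<chi> i. f x i) :: real^'n)"
proof -
  have "Ck_on k UNIV (\<lambda>x. \<Sum>i\<in>UNIV. f x i *\<^sub>R (axis i 1 :: real^'n))"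
    by (intro Ck_sum Ck_linear[OF bounded_linear_scaleR_left] assms) simp
  moreover have "(\<Sum>i\<in>UNIV. f x i *\<^sub>R (axis i 1 :: real^'n)) = (\<chi> i. f x i)" for x
    by (simp add: vec_eq_iff axis_def if_distrib cong: if_cong)
  ultimately show ?thesis by simp
qed

text \<open>Each of the two functions has the other one in its derivative, hence the simultaneous
  induction.\<close>

lemma Ck_sin_cos:
  fixes f :: "'v::euclidean_space \<Rightarrow> real"
  shows "Ck_on k UNIV f \<Longrightarrow> Ck_on k UNIV (\<lambda>x. sin (f x)) \<and> Ck_on k UNIV (\<lambda>x. cos (f x))"
proof (induction k arbitrary: f)
  case 0
  then show ?case by (auto intro: continuous_on_sin continuous_on_cos)
next
  case (Suc k)
  obtain f' where f': "\<And>x. (f has_derivative f' x) (at x)" "\<And>v. Ck_on k UNIV (\<lambda>x. f' x v)"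
    using Suc.prems by (rule Ck_SucE) (rule that)
  note IH = Suc.IH[OF Ck_on_SucD[OF Suc.prems]]
  have "Ck_on (Suc k) UNIV (\<lambda>x. sin (f x))"
    by (rule Ck_SucI[OF has_derivative_sin[OF f'(1)]])
       (use IH f'(2) in \<open>intro Ck_mult; simp add: mult.commute\<close>)
  moreover have "Ck_on (Suc k) UNIV (\<lambda>x. cos (f x))"
    by (rule Ck_SucI[OF has_derivative_cos[OF f'(1)]])
       (use IH f'(2) in \<open>intro Ck_mult Ck_minus; simp\<close>)
  ultimately show ?case ..
qed

lemmas Ck_sin [Ck_intros] = Ck_sin_cos[THEN conjunct1]
lemmas Ck_cos [Ck_intros] = Ck_sin_cos[THEN conjunct2]

section \<open>Quotients of a vector space by a discrete group of translations\<close>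

text \<open>The space \<open>G\<close> is the quotient of a vector space by the discrete group \<open>N\<close> of translations,
  and the coordinate map of each chart is a section of the projection \<open>\<pi>\<close>. That \<open>N\<close> is a group
  follows from the description of the fibres of \<open>\<pi>\<close>.\<close>

locale translation_cover =
  fixes G :: "('a, 'v::euclidean_space) lie" and \<pi> :: "'v \<Rightarrow> 'a" and N :: "'v set"
  assumes range_proj: "range \<pi> = carrier G"
    and proj_eq_iff: "\<pi> x = \<pi> y \<longleftrightarrow> y - x \<in> N"
    and discrete: "\<exists>e>0. \<forall>n\<in>N. norm n < e \<longrightarrow> n = 0"
    and quotient_map_proj: "quotient_map euclidean (topo G) \<pi>"
    and chart_open: "(U, f) \<in> atlas G \<Longrightarrow> open (f ` U)"
    and chart_section: "(U, f) \<in> atlas G \<Longrightarrow> u \<in> U \<Longrightarrow> \<pi> (f u) = u"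
    and charts_cover: "a \<in> carrier G \<Longrightarrow> \<exists>(U, f)\<in>atlas G. a \<in> U"
begin

lemma proj_add: "n \<in> N \<Longrightarrow> \<pi> (n + x) = \<pi> x"
  using proj_eq_iff[of x "n + x"] by simp

lemma uminus_in_N: "n \<in> N \<Longrightarrow> - n \<in> N"
  using proj_eq_iff[of n 0] proj_eq_iff[of 0 n] by simp

lemma add_in_N: "a \<in> N \<Longrightarrow> b \<in> N \<Longrightarrow> a + b \<in> N"
  using proj_eq_iff[of "- a" b] proj_eq_iff[of "- a" 0] proj_eq_iff[of 0 b] by (simp add: add.commute)

lemma proj_in_carrier: "\<pi> x \<in> carrier G"
  using range_proj by blast

lemma topspace_topo: "topspace (topo G) = carrier G"
  using quotient_imp_surjective_map[OF quotient_map_proj] range_proj by simp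

lemma openin_topo: "V \<subseteq> carrier G \<Longrightarrow> openin (topo G) V \<longleftrightarrow> open (\<pi> -` V)"
  using quotient_map_proj unfolding quotient_map_def topspace_topo by (auto simp: vimage_def)

lemma open_vimage_proj: "openin (topo G) V \<Longrightarrow> open (\<pi> -` V)"
  using openin_topo openin_subset topspace_topo by blast

lemma continuous_map_proj: "continuous_map euclidean (topo G) \<pi>"
  by (rule quotient_imp_continuous_map[OF quotient_map_proj])

text \<open>The preimage of the image of \<open>W\<close> is the union of the translates of \<open>W\<close> by \<open>N\<close>, so the projection
  is an open map.\<close>

lemma openin_image:
  assumes "open W" shows "openin (topo G) (\<pi> ` W)"
proof -
  have "\<pi> -` \<pi> ` W = (\<Union>n\<in>N. (+) n ` W)"
  proof (intro equalityI subsetI)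
    fix x assume "x \<in> \<pi> -` \<pi> ` W"
    then obtain w where "w \<in> W" "\<pi> w = \<pi> x" by auto
    then have "w \<in> W" "x - w \<in> N" using proj_eq_iff by blast+
    then show "x \<in> (\<Union>n\<in>N. (+) n ` W)" by (intro UN_I[of "x - w"]) (auto intro: image_eqI[of _ _ w])
  qed (auto simp: proj_add)
  then have "open (\<pi> -` \<pi> ` W)" using assms by (auto intro: open_translation)
  moreover have "\<pi> ` W \<subseteq> carrier G" using proj_in_carrier by blast
  ultimately show ?thesis using openin_topo by simp
qed

lemma open_map_proj: "open_map euclidean (topo G) \<pi>"
  using openin_image by (simp add: open_map_def)

lemma second_countable_topo: "second_countable (topo G)"
proof -
  obtain \<B> :: "'v set set" where "countable \<B>" "topological_basis \<B>"
    using ex_countable_basis by blast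
  then have "second_countable (euclidean :: 'v topology)"
    unfolding second_countable_def
    by (intro exI[of _ \<B>]) (metis topological_basisE topological_basis_open open_openin)
  then show ?thesis
    using second_countable_open_map_image[OF continuous_map_proj open_map_proj]
    by (simp add: range_proj topspace_topo)
qed

lemma closed_N: "closed N"
proof -
  obtain e where e: "0 < e" "\<And>n. n \<in> N \<Longrightarrow> norm n < e \<Longrightarrow> n = 0" using discrete by blast
  have "y = x" if "x \<in> N" "y \<in> N" "norm (y - x) < e" for x y
    using e(2)[of "y - x"] add_in_N[of y "- x"] uminus_in_N[of x] that by simp
  then show ?thesis using e(1) by (intro discrete_imp_closed[of e]) (auto simp: dist_norm)
qed

text \<open>Since \<open>N\<close> is closed, points in different fibres have neighbourhoods no two points of which differ
  by an element of \<open>N\<close>.\<close>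

lemma Hausdorff_topo: "Hausdorff_space (topo G)"
  unfolding Hausdorff_space_def
proof (intro allI impI)
  fix a b assume ab: "a \<in> topspace (topo G) \<and> b \<in> topspace (topo G) \<and> a \<noteq> b"
  then obtain x y where x: "a = \<pi> x" and y: "b = \<pi> y" using topspace_topo range_proj by blast
  then have "y - x \<in> - N" using ab proj_eq_iff by blast
  then obtain d where d: "0 < d" "ball (y - x) d \<subseteq> - N"
    using closed_N by (meson open_Compl open_contains_ball)
  have "disjnt (\<pi> ` ball x (d/2)) (\<pi> ` ball y (d/2))"
  proof -
    have False if "u \<in> ball x (d/2)" "v \<in> ball y (d/2)" "\<pi> u = \<pi> v" for u v
    proof -
      have "dist (y - x) (v - u) \<le> dist y v + dist x u"
        unfolding dist_norm using norm_triangle_ineq4[of "y - v" "x - u"] by (simp add: algebra_simps)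
      then have "v - u \<in> ball (y - x) d" using that(1,2) by simp
      then show False using that(3) d(2) proj_eq_iff by blast
    qed
    then show ?thesis by (auto simp: disjnt_def)
  qed
  then show "\<exists>U V. openin (topo G) U \<and> openin (topo G) V \<and> a \<in> U \<and> b \<in> V \<and> disjnt U V"
    using openin_image[OF open_ball] d(1) x y by (metis centre_in_ball half_gt_zero imageI)
qed

lemma chart_image: "(U, f) \<in> atlas G \<Longrightarrow> \<pi> ` f ` U = U"
  using chart_section by force

lemma chart_openin: "(U, f) \<in> atlas G \<Longrightarrow> openin (topo G) U"
  using openin_image[OF chart_open] chart_image by metis

lemma chart_proj:
  assumes "(U, f) \<in> atlas G" "w \<in> f ` U"
  shows "\<pi> w \<in> U" "f (\<pi> w) = w" "inv_into U f w = \<pi> w"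
proof -
  obtain u where u: "u \<in> U" "w = f u" using assms(2) by blast
  then show "\<pi> w \<in> U" "f (\<pi> w) = w" using chart_section[OF assms(1)] by auto
  have "inj_on f U" using chart_section[OF assms(1)] by (metis inj_onI)
  then show "inv_into U f w = \<pi> w" using u chart_section[OF assms(1)] by simp
qed

lemma homeomorphic_map_chart:
  assumes c: "(U, f) \<in> atlas G"
  shows "homeomorphic_map (subtopology (topo G) U) (top_of_set (f ` U)) f"
proof -
  have "continuous_map (subtopology (topo G) U) euclidean f"
    unfolding continuous_map_def
  proof (intro conjI allI impI)
    fix W :: "'v set" assume "openin euclidean W"
    then have "openin (topo G) (\<pi> ` (f ` U \<inter> W))"
      using chart_open[OF c] by (intro openin_image) auto
    moreover have "{x \<in> topspace (subtopology (topo G) U). f x \<in> W} = \<pi> ` (f ` U \<inter> W)"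
      using chart_proj[OF c] chart_section[OF c] openin_subset[OF chart_openin[OF c]] by force
    ultimately show "openin (subtopology (topo G) U) {x \<in> topspace (subtopology (topo G) U). f x \<in> W}"
      using chart_openin[OF c] by (auto simp: openin_open_subtopology)
  qed simp
  moreover have "continuous_map (top_of_set (f ` U)) (subtopology (topo G) U) \<pi>"
    using continuous_map_proj chart_proj(1)[OF c]
    by (auto simp: continuous_map_in_subtopology continuous_map_from_subtopology)
  ultimately have "homeomorphic_maps (subtopology (topo G) U) (top_of_set (f ` U)) f \<pi>"
    unfolding homeomorphic_maps_def using chart_section[OF c] chart_proj(2)[OF c]
    by (auto simp: continuous_map_in_subtopology)
  then show ?thesis by (auto simp: homeomorphic_map_maps)
qed

text \<open>The key to all smoothness statements. Both \<open>f (\<pi> (h x))\<close> and \<open>h x\<close> lie over the same point, so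
  they differ by an element of \<open>N\<close>; near \<open>x0\<close> this element is constant, because \<open>n + h x\<close> stays in
  the open image of the chart, on which \<open>f\<close> inverts \<open>\<pi>\<close>. In the coordinates of a chart, a map
  that lifts to \<open>h\<close> is therefore \<open>h\<close> itself up to a local constant.\<close>

lemma chart_translation:
  assumes c: "(U, f) \<in> atlas G" and h: "continuous_on UNIV h" and x: "\<pi> (h x0) \<in> U"
  obtains T where "open T" "x0 \<in> T"
    "\<And>x. x \<in> T \<Longrightarrow> \<pi> (h x) \<in> U \<and> f (\<pi> (h x)) = f (\<pi> (h x0)) - h x0 + h x"
proof -
  define n where "n = f (\<pi> (h x0)) - h x0"
  have n: "n \<in> N" unfolding n_def using chart_section[OF c x] proj_eq_iff by metis
  define T where "T = (\<lambda>x. n + h x) -` (f ` U)"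
  have "open T" unfolding T_def
    using chart_open[OF c] by (intro open_vimage continuous_on_add continuous_on_const h)
  moreover have "x0 \<in> T" unfolding T_def n_def using x by simp
  moreover have "\<pi> (h x) \<in> U \<and> f (\<pi> (h x)) = n + h x" if "x \<in> T" for x
    using chart_proj(1,2)[OF c, of "n + h x"] that proj_add[OF n, of "h x"] unfolding T_def by simp
  ultimately show ?thesis using that unfolding n_def by blast
qed

end

lemma smooth_map_if_lift:
  assumes "translation_cover G \<pi> N" and "translation_cover H \<rho> M"
    and h: "smooth_on UNIV h" and F: "\<And>x. F (\<pi> x) = \<rho> (h x)"
  shows "smooth_map G H F"
proof -
  interpret G: translation_cover G \<pi> N by fact
  interpret H: translation_cover H \<rho> M by fact
  have cont: "continuous_on UNIV h" using h[unfolded smooth_on_def, rule_format, of 0] by simp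
  have "continuous_map euclidean (topo H) (\<rho> \<circ> h)"
    by (rule continuous_map_compose[OF _ H.continuous_map_proj]) (simp add: cont)
  moreover have "\<rho> \<circ> h = F \<circ> \<pi>" using F by auto
  ultimately have "continuous_map (topo G) (topo H) F"
    using continuous_compose_quotient_map[OF G.quotient_map_proj] by simp
  moreover have "smooth_on (f ` (U \<inter> F -` W)) (g \<circ> F \<circ> inv_into U f)"
    if c: "(U, f) \<in> atlas G" "(W, g) \<in> atlas H" for U f W g
    unfolding smooth_on_def
  proof (intro allI Ck_on_locally)
    fix k x0 assume x0: "x0 \<in> f ` (U \<inter> F -` W)"
    then have *: "x0 \<in> f ` U" "\<rho> (h x0) \<in> W" using G.chart_section[OF c(1)] F by (auto, metis)
    then obtain T where T: "open T" "x0 \<in> T"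
      "\<And>x. x \<in> T \<Longrightarrow> \<rho> (h x) \<in> W \<and> g (\<rho> (h x)) = g (\<rho> (h x0)) - h x0 + h x"
      using H.chart_translation[OF c(2) cont] by metis
    let ?T = "T \<inter> f ` U" and ?g = "\<lambda>x. g (\<rho> (h x0)) - h x0 + h x"
    have "(g \<circ> F \<circ> inv_into U f) x = ?g x" if "x \<in> ?T" for x
      using that T(3)[of x] G.chart_proj(3)[OF c(1), of x] F by simp
    moreover have "Ck_on k UNIV ?g"
      using h unfolding smooth_on_def by (intro Ck_add Ck_const) simp
    ultimately show "\<exists>T g'. open T \<and> x0 \<in> T \<and> Ck_on k T g' \<and> (\<forall>y\<in>T. (g \<circ> F \<circ> inv_into U f) y = g' y)"
      using T(1,2) *(1) G.chart_open[OF c(1)]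
      by (intro exI[of _ ?T] exI[of _ ?g]) (auto intro: Ck_on_subset[OF _ subset_UNIV])
  qed
  ultimately show ?thesis unfolding smooth_map_def by auto
qed

context translation_cover
begin

text \<open>Chart changes are the identity map in two charts, and the identity lifts to the identity.\<close>

lemma smooth_manifold_topo: "smooth_manifold (topo G) (atlas G)"
proof -
  have "smooth_map G G (\<lambda>x. x)"
    by (rule smooth_map_if_lift[OF translation_cover_axioms translation_cover_axioms])
       (auto simp: smooth_on_def intro: Ck_id)
  then have "smooth_on (f ` (U \<inter> W)) (g \<circ> inv_into U f)"
    if "(U, f) \<in> atlas G" "(W, g) \<in> atlas G" for U f W g
    using that unfolding smooth_map_def by (force simp: comp_def vimage_def)
  moreover have "(\<Union>(U, f)\<in>atlas G. U) = topspace (topo G)"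
  proof (intro equalityI subsetI)
    fix a assume "a \<in> topspace (topo G)"
    then show "a \<in> (\<Union>(U, f)\<in>atlas G. U)" using charts_cover[of a] topspace_topo by auto
  next
    fix a assume "a \<in> (\<Union>(U, f)\<in>atlas G. U)"
    then show "a \<in> topspace (topo G)" using openin_subset[OF chart_openin] by blast
  qed
  ultimately show ?thesis
    unfolding smooth_manifold_def
    by (auto simp: Hausdorff_topo second_countable_topo chart_openin chart_open homeomorphic_map_chart)
qed

end

lemma open_map_map_prod:
  assumes "open_map X X' f" and "open_map Y Y' g"
  shows "open_map (prod_topology X Y) (prod_topology X' Y') (map_prod f g)"
  unfolding open_map_def
proof (intro allI impI)
  fix O' assume O': "openin (prod_topology X Y) O'"
  show "openin (prod_topology X' Y') (map_prod f g ` O')"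
    unfolding openin_prod_topology_alt
  proof (intro allI impI)
    fix x y assume "(x, y) \<in> map_prod f g ` O'"
    then obtain p where "p \<in> O'" "(x, y) = map_prod f g p" by (rule imageE)
    then have ab: "(fst p, snd p) \<in> O'" "x = f (fst p)" "y = g (snd p)"
      by (simp_all add: map_prod_def split_beta)
    obtain U V where UV: "openin X U" "openin Y V" "fst p \<in> U" "snd p \<in> V" "U \<times> V \<subseteq> O'"
      using iffD1[OF openin_prod_topology_alt O', rule_format, OF ab(1)] by blast
    have "f ` U \<times> g ` V = map_prod f g ` (U \<times> V)" by force
    then have "f ` U \<times> g ` V \<subseteq> map_prod f g ` O'" using UV(5) by (simp add: image_mono)
    moreover have "openin X' (f ` U)" "openin Y' (g ` V)"
      using assms UV(1,2) by (simp_all add: open_map_def)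
    ultimately show "\<exists>U V. openin X' U \<and> openin Y' V \<and> x \<in> U \<and> y \<in> V \<and> U \<times> V \<subseteq> map_prod f g ` O'"
      using ab UV(3,4) by (intro exI[of _ "f ` U"] exI[of _ "g ` V"]) simp
  qed
qed

text \<open>The product of two quotient maps need not be a quotient map in general; here both factors are
  open maps.\<close>

lemma translation_cover_prod:
  assumes "translation_cover G \<pi> N" and "translation_cover H \<rho> M"
  shows "translation_cover (lie_prod G H) (map_prod \<pi> \<rho>) (N \<times> M)"
proof -
  interpret G: translation_cover G \<pi> N by fact
  interpret H: translation_cover H \<rho> M by fact
  have carrier: "carrier (lie_prod G H) = carrier G \<times> carrier H"
    by (simp add: lie_prod_def)
  have top: "topo (lie_prod G H) = prod_topology (topo G) (topo H)"
    by (simp add: lie_prod_def)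
  have atlas: "c \<in> atlas (lie_prod G H) \<longleftrightarrow>
      (\<exists>U f W g. (U, f) \<in> atlas G \<and> (W, g) \<in> atlas H \<and> c = (U \<times> W, map_prod f g))" for c
    by (auto simp: lie_prod_def)
  show ?thesis
  proof
    show *: "range (map_prod \<pi> \<rho>) = carrier (lie_prod G H)"
      unfolding carrier G.range_proj[symmetric] H.range_proj[symmetric]
      by (auto simp: map_prod_def image_iff)
    show "map_prod \<pi> \<rho> x = map_prod \<pi> \<rho> y \<longleftrightarrow> y - x \<in> N \<times> M" for x y
      by (cases x; cases y) (simp add: G.proj_eq_iff H.proj_eq_iff)
    obtain d where d: "d > 0" "\<forall>n\<in>N. norm n < d \<longrightarrow> n = 0" using G.discrete by blast
    obtain e where e: "e > 0" "\<forall>n\<in>M. norm n < e \<longrightarrow> n = 0" using H.discrete by blast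
    show "\<exists>e>0. \<forall>n\<in>N \<times> M. norm n < e \<longrightarrow> n = 0"
    proof (intro exI[of _ "min d e"] conjI ballI impI)
      fix n assume n: "n \<in> N \<times> M" "norm n < min d e"
      then have "norm (fst n) < d" "norm (snd n) < e"
        using norm_fst_le[of "fst n" "snd n"] norm_snd_le[of "snd n" "fst n"] by auto
      then show "n = 0" using n(1) d(2) e(2) by (auto simp: zero_prod_def)
    qed (use d e in auto)
    have "open_map euclidean (topo (lie_prod G H)) (map_prod \<pi> \<rho>)"
      using open_map_map_prod[OF G.open_map_proj H.open_map_proj] by (simp add: top)
    moreover have "continuous_map euclidean (topo (lie_prod G H)) (map_prod \<pi> \<rho>)"
    proof -
      have "continuous_map (prod_topology euclidean euclidean) (prod_topology (topo G) (topo H)) (\<lambda>(x, y). (\<pi> x, \<rho> y))"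
        using G.continuous_map_proj H.continuous_map_proj by (simp only: continuous_map_prod_top) simp
      then show ?thesis by (simp add: top map_prod_def)
    qed
    ultimately show "quotient_map euclidean (topo (lie_prod G H)) (map_prod \<pi> \<rho>)"
      using * carrier G.topspace_topo H.topspace_topo
      by (intro continuous_open_imp_quotient_map) (simp_all add: top)
    show "open (f ` U)" if c: "(U, f) \<in> atlas (lie_prod G H)" for U f
    proof -
      obtain U1 f1 U2 f2 where *: "(U1, f1) \<in> atlas G" "(U2, f2) \<in> atlas H"
        "U = U1 \<times> U2" "f = map_prod f1 f2" using c atlas[of "(U, f)"] by auto
      have "f ` U = (f1 ` U1) \<times> (f2 ` U2)" unfolding *(3,4) by auto
      then show ?thesis using open_Times[OF G.chart_open[OF *(1)] H.chart_open[OF *(2)]] by simp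
    qed
    show "map_prod \<pi> \<rho> (f u) = u" if c: "(U, f) \<in> atlas (lie_prod G H)" "u \<in> U" for U f u
    proof -
      obtain U1 f1 U2 f2 where *: "(U1, f1) \<in> atlas G" "(U2, f2) \<in> atlas H"
        "U = U1 \<times> U2" "f = map_prod f1 f2" using c(1) atlas[of "(U, f)"] by auto
      show ?thesis
        using c(2) G.chart_section[OF *(1)] H.chart_section[OF *(2)] unfolding *(3,4) by auto
    qed
    show "\<exists>(U, f)\<in>atlas (lie_prod G H). x \<in> U" if x: "x \<in> carrier (lie_prod G H)" for x
    proof -
      obtain U f where U: "(U, f) \<in> atlas G" "fst x \<in> U" using G.charts_cover[of "fst x"] x by (auto simp: carrier)
      obtain W g where W: "(W, g) \<in> atlas H" "snd x \<in> W" using H.charts_cover[of "snd x"] x by (auto simp: carrier)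
      show ?thesis using U W by (intro bexI[of _ "(U \<times> W, map_prod f g)"]) (auto simp: atlas mem_Times_iff)
    qed
  qed
qed

section \<open>Lie groups covered by a group law on a vector space\<close>

text \<open>The group law \<open>m\<close> on the vector space is that of a covering group in global coordinates. Its
  kernel \<open>N\<close> is central, and moreover multiplication by an element of \<open>N\<close> is the translation by that
  element; this makes the chart calculations of the preceding section available.\<close>

locale covered_lie_group = translation_cover G \<pi> N
  for G :: "('a, 'v::euclidean_space) lie" and \<pi> :: "'v \<Rightarrow> 'a" and N :: "'v set" +
  fixes m :: "'v \<Rightarrow> 'v \<Rightarrow> 'v" and \<iota> :: "'v \<Rightarrow> 'v"
  assumes m_assoc: "m (m x y) z = m x (m y z)"
    and m_zero_left: "m 0 x = x"
    and m_inv_left: "m (\<iota> x) x = 0"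
    and smooth_m: "smooth_on UNIV (\<lambda>p. m (fst p) (snd p))"
    and smooth_inv: "smooth_on UNIV \<iota>"
    and mult_proj: "\<pi> x \<otimes>\<^bsub>G\<^esub> \<pi> y = \<pi> (m x y)"
    and one_proj: "\<one>\<^bsub>G\<^esub> = \<pi> 0"
    and translation_left: "n \<in> N \<Longrightarrow> m n x = n + x"
    and translation_right: "n \<in> N \<Longrightarrow> m x n = n + x"
begin

lemma m_inv_right: "m x (\<iota> x) = 0"
proof -
  have "m x (\<iota> x) = m (m (\<iota> (\<iota> x)) (\<iota> x)) (m x (\<iota> x))" by (simp add: m_inv_left m_zero_left)
  also have "\<dots> = m (\<iota> (\<iota> x)) (m (m (\<iota> x) x) (\<iota> x))" by (simp only: m_assoc)
  also have "\<dots> = 0" by (simp add: m_inv_left m_zero_left)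
  finally show ?thesis .
qed

lemma m_zero_right: "m x 0 = x"
  by (metis m_assoc m_inv_left m_inv_right m_zero_left)

lemma m_translation_left: "n \<in> N \<Longrightarrow> m (n + x) y = n + m x y"
  by (metis m_assoc translation_left)

lemma m_translation_right: "n \<in> N \<Longrightarrow> m x (n + y) = n + m x y"
  by (metis m_assoc translation_left translation_right m_translation_left)

lemma group_G: "group G"
proof (rule groupI)
  show "\<one>\<^bsub>G\<^esub> \<in> carrier G" by (simp add: one_proj proj_in_carrier)
  fix x y z assume "x \<in> carrier G" "y \<in> carrier G" "z \<in> carrier G"
  then obtain a b c where "x = \<pi> a" "y = \<pi> b" "z = \<pi> c" using range_proj by blast
  then show "x \<otimes>\<^bsub>G\<^esub> y \<in> carrier G" "x \<otimes>\<^bsub>G\<^esub> y \<otimes>\<^bsub>G\<^esub> z = x \<otimes>\<^bsub>G\<^esub> (y \<otimes>\<^bsub>G\<^esub> z)"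
    by (simp_all add: mult_proj proj_in_carrier m_assoc)
next
  fix x assume "x \<in> carrier G"
  then obtain a where a: "x = \<pi> a" using range_proj by blast
  then show "\<one>\<^bsub>G\<^esub> \<otimes>\<^bsub>G\<^esub> x = x" by (simp add: mult_proj one_proj m_zero_left)
  show "\<exists>y\<in>carrier G. y \<otimes>\<^bsub>G\<^esub> x = \<one>\<^bsub>G\<^esub>"
    using a by (intro bexI[of _ "\<pi> (\<iota> a)"]) (simp_all add: mult_proj one_proj m_inv_left proj_in_carrier)
qed

lemma inv_proj: "inv\<^bsub>G\<^esub> (\<pi> x) = \<pi> (\<iota> x)"
  using group.inv_equality[OF group_G] mult_proj m_inv_left one_proj proj_in_carrier by metis

text \<open>Multiplication and inversion lift to \<open>m\<close> and \<open>\<iota>\<close>, which are smooth on the covering space.\<close>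

lemma lie_group_G: "lie_group G"
  unfolding lie_group_def
proof (intro conjI group_G topspace_topo smooth_manifold_topo)
  show "smooth_map (lie_prod G G) G (\<lambda>(x, y). x \<otimes>\<^bsub>G\<^esub> y)"
    by (rule smooth_map_if_lift[OF translation_cover_prod[OF translation_cover_axioms
            translation_cover_axioms] translation_cover_axioms smooth_m])
       (simp add: map_prod_def split_beta mult_proj)
  show "smooth_map G G (\<lambda>x. inv\<^bsub>G\<^esub> x)"
    by (rule smooth_map_if_lift[OF translation_cover_axioms translation_cover_axioms smooth_inv])
       (rule inv_proj)
qed

lemma m_differentiable: "(\<lambda>p. m (fst p) (snd p)) differentiable (at p)"
  using smooth_m[unfolded smooth_on_def, rule_format, of 1] unfolding One_nat_def Ck_on.simps by blast

lemma inv_differentiable: "\<iota> differentiable (at p)"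
  using smooth_inv[unfolded smooth_on_def, rule_format, of 1] unfolding One_nat_def Ck_on.simps by blast

text \<open>The derivative is determined by its restrictions to the two axes, and there \<open>m\<close> is the identity.\<close>

lemma m_has_derivative_zero:
  "((\<lambda>p. m (fst p) (snd p)) has_derivative (\<lambda>p. fst p + snd p)) (at 0)"
proof -
  obtain D where D: "((\<lambda>p. m (fst p) (snd p)) has_derivative D) (at (0, 0))"
    using m_differentiable unfolding differentiable_def by blast
  have "((\<lambda>u. (u, 0) :: 'v \<times> 'v) has_derivative (\<lambda>u. (u, 0))) (at 0)"
    by (auto intro!: derivative_eq_intros)
  from has_derivative_compose[OF this D]
  have "((\<lambda>u. m (fst (u, 0)) (snd (u, 0))) has_derivative (\<lambda>u. D (u, 0))) (at 0)" by simp
  then have 1: "D (u, 0) = u" for u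
    using has_derivative_unique[OF _ has_derivative_ident, of "\<lambda>u. D (u, 0)" 0] by (simp add: m_zero_right fun_eq_iff)
  have "((\<lambda>u. (0, u) :: 'v \<times> 'v) has_derivative (\<lambda>u. (0, u))) (at 0)"
    by (auto intro!: derivative_eq_intros)
  from has_derivative_compose[OF this D]
  have "((\<lambda>u. m (fst (0, u)) (snd (0, u))) has_derivative (\<lambda>u. D (0, u))) (at 0)" by simp
  then have 2: "D (0, u) = u" for u
    using has_derivative_unique[OF _ has_derivative_ident, of "\<lambda>u. D (0, u)" 0] by (simp add: m_zero_left fun_eq_iff)
  have "D p = fst p + snd p" for p
    using linear_add[OF has_derivative_linear[OF D], of "(fst p, 0)" "(0, snd p)"] 1 2 by simp
  then have "D = (\<lambda>p. fst p + snd p)" by auto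
  then show ?thesis using D by (simp add: zero_prod_def)
qed

end

lemma covered_lie_group_prod:
  assumes "covered_lie_group G \<pi> N m \<iota>" and "covered_lie_group H \<rho> M m' \<iota>'"
  shows "covered_lie_group (lie_prod G H) (map_prod \<pi> \<rho>) (N \<times> M)
    (\<lambda>p q. (m (fst p) (fst q), m' (snd p) (snd q))) (map_prod \<iota> \<iota>')"
proof -
  interpret G: covered_lie_group G \<pi> N m \<iota> by fact
  interpret H: covered_lie_group H \<rho> M m' \<iota>' by fact
  interpret translation_cover "lie_prod G H" "map_prod \<pi> \<rho>" "N \<times> M"
    using translation_cover_prod G.translation_cover_axioms H.translation_cover_axioms .
  have 1: "bounded_linear (\<lambda>p. (fst (fst p), fst (snd p)))" "bounded_linear (\<lambda>p. (snd (fst p), snd (snd p)))"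
    by (intro bounded_linear_Pair bounded_linear_compose[OF bounded_linear_fst]
        bounded_linear_compose[OF bounded_linear_snd] bounded_linear_fst bounded_linear_snd)+
  show ?thesis
  proof
    show "smooth_on UNIV (\<lambda>p. (m (fst (fst p)) (fst (snd p)), m' (snd (fst p)) (snd (snd p))))"
      unfolding smooth_on_def
    proof
      fix k
      show "Ck_on k UNIV (\<lambda>p. (m (fst (fst p)) (fst (snd p)), m' (snd (fst p)) (snd (snd p))))"
        using Ck_compose_linear[OF 1(1), of k "\<lambda>p. m (fst p) (snd p)"]
          Ck_compose_linear[OF 1(2), of k "\<lambda>p. m' (fst p) (snd p)"] G.smooth_m H.smooth_m
        by (intro Ck_Pair) (simp_all add: smooth_on_def)
    qed
    show "smooth_on UNIV (map_prod \<iota> \<iota>')"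
      unfolding smooth_on_def
    proof
      fix k
      show "Ck_on k UNIV (map_prod \<iota> \<iota>')"
        using Ck_compose_linear[OF bounded_linear_fst, of k \<iota>]
          Ck_compose_linear[OF bounded_linear_snd, of k \<iota>'] G.smooth_inv H.smooth_inv
        unfolding map_prod_def split_beta by (intro Ck_Pair) (simp_all add: smooth_on_def)
    qed
  qed (auto simp: G.m_assoc H.m_assoc G.m_zero_left H.m_zero_left G.m_inv_left H.m_inv_left
      zero_prod_def lie_prod_def DirProd_def G.mult_proj H.mult_proj G.one_proj H.one_proj
      G.translation_left H.translation_left G.translation_right H.translation_right map_prod_def split_beta)
qed

text \<open>Half of the distance between lattice points is a radius of injectivity; this provides the charts
  of the quotients below.\<close>

lemma inj_on_ball_if_discrete:
  fixes q :: "'v::real_normed_vector \<Rightarrow> 'a"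
  assumes "\<And>x y. q x = q y \<Longrightarrow> y - x \<in> M" and "\<And>n. n \<in> M \<Longrightarrow> norm n < e \<Longrightarrow> n = 0"
  shows "inj_on q (ball x (e/2))"
proof (rule inj_onI)
  fix a b assume ab: "a \<in> ball x (e/2)" "b \<in> ball x (e/2)" "q a = q b"
  have "norm (b - a) \<le> dist x a + dist x b"
    using dist_triangle[of b a x] by (simp add: dist_norm norm_minus_commute)
  then have "norm (b - a) < e" using ab(1,2) by simp
  then show "a = b" using assms ab(3) by fastforce
qed

lemma topspace_coset_topology:
  "topspace (coset_topology G X N) = (\<lambda>x. N #>\<^bsub>G\<^esub> x) ` topspace X"
proof -
  have "openin (coset_topology G X N) ((\<lambda>x. N #>\<^bsub>G\<^esub> x) ` topspace X)"
  proof -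
    have "{x \<in> topspace X. N #>\<^bsub>G\<^esub> x \<in> (\<lambda>x. N #>\<^bsub>G\<^esub> x) ` topspace X} = topspace X" by blast
    then show ?thesis unfolding openin_coset_topology by simp
  qed
  moreover have "topspace (coset_topology G X N) \<subseteq> (\<lambda>x. N #>\<^bsub>G\<^esub> x) ` topspace X"
    using openin_topspace[of "coset_topology G X N"] unfolding openin_coset_topology by (rule conjunct1)
  ultimately show ?thesis using openin_subset by (intro equalityI)
qed

lemma quotient_map_coset_topology: "quotient_map X (coset_topology G X N) (\<lambda>x. N #>\<^bsub>G\<^esub> x)"
  unfolding quotient_map_def topspace_coset_topology openin_coset_topology by simp

text \<open>Passing to the quotient by a subgroup \<open>\<Gamma>\<close> replaces the kernel by the preimage \<open>M\<close> of \<open>\<Gamma>\<close>. As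
  \<open>M\<close> acts by translations on both sides, \<open>\<Gamma>\<close> is central, and the cosets of \<open>\<Gamma>\<close> correspond to the
  orbits of the translation group \<open>M\<close>. A chart of the quotient is a chart of \<open>G\<close> after a local
  section of the coset map, hence again a local section of the composed projection.\<close>

lemma covered_lie_group_quot:
  assumes "covered_lie_group G \<pi> N m \<iota>" and subgroup: "subgroup \<Gamma> G"
    and M: "\<And>x. x \<in> M \<longleftrightarrow> \<pi> x \<in> \<Gamma>"
    and discrete: "\<exists>e>0. \<forall>n\<in>M. norm n < e \<longrightarrow> n = 0"
    and left: "\<And>n x. n \<in> M \<Longrightarrow> m n x = n + x" and right: "\<And>n x. n \<in> M \<Longrightarrow> m x n = n + x"
  shows "covered_lie_group (lie_quot G \<Gamma>) (\<lambda>x. \<Gamma> #>\<^bsub>G\<^esub> \<pi> x) M m \<iota>"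
proof -
  interpret G: covered_lie_group G \<pi> N m \<iota> by fact
  have "\<Gamma> \<lhd> G"
  proof (rule group.normalI[OF G.group_G subgroup], intro ballI)
    fix a assume "a \<in> carrier G"
    moreover have "h \<otimes>\<^bsub>G\<^esub> a = a \<otimes>\<^bsub>G\<^esub> h" if h: "h \<in> \<Gamma>" for h
    proof -
      have "h \<in> carrier G" using subgroup.subset[OF subgroup] h by blast
      then obtain n x where nx: "h = \<pi> n" "a = \<pi> x" using \<open>a \<in> _\<close> G.range_proj by blast
      then have "n \<in> M" using M h by simp
      then show ?thesis unfolding nx G.mult_proj by (simp add: left right)
    qed
    ultimately show "\<Gamma> #>\<^bsub>G\<^esub> a = a <#\<^bsub>G\<^esub> \<Gamma>" by (simp add: r_coset_def l_coset_def)
  qed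
  then interpret normal \<Gamma> G .
  let ?q = "\<lambda>a. \<Gamma> #>\<^bsub>G\<^esub> a"
  have sub: "\<Gamma> \<subseteq> carrier G" by (rule subset)
  have eq: "?q (\<pi> x) = ?q (\<pi> y) \<longleftrightarrow> y - x \<in> M" for x y
  proof -
    have "?q (\<pi> x) = ?q (\<pi> y) \<longleftrightarrow> \<pi> y \<in> ?q (\<pi> x)"
      using repr_independence rcos_self G.proj_in_carrier subgroup_axioms by metis
    also have "\<dots> \<longleftrightarrow> \<pi> y \<otimes>\<^bsub>G\<^esub> inv\<^bsub>G\<^esub> \<pi> x \<in> \<Gamma>"
      using rcos_module[OF is_group G.proj_in_carrier G.proj_in_carrier] by simp
    also have "\<dots> \<longleftrightarrow> m y (\<iota> x) \<in> M" by (simp add: M G.inv_proj G.mult_proj)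
    also have "\<dots> \<longleftrightarrow> y - x \<in> M"
    proof
      assume n: "m y (\<iota> x) \<in> M"
      have "y = m (m y (\<iota> x)) x" by (simp add: G.m_assoc G.m_inv_left G.m_zero_right)
      also have "\<dots> = m y (\<iota> x) + x" by (rule left[OF n])
      finally show "y - x \<in> M" using n by (metis add_diff_cancel_right')
    next
      assume n: "y - x \<in> M"
      have "m y (\<iota> x) = m (m (y - x) x) (\<iota> x)" using left[OF n] by simp
      also have "\<dots> = y - x" by (simp add: G.m_assoc G.m_inv_right G.m_zero_right)
      finally show "m y (\<iota> x) \<in> M" using n by simp
    qed
    finally show ?thesis .
  qed
  obtain e where e: "e > 0" "\<And>n. n \<in> M \<Longrightarrow> norm n < e \<Longrightarrow> n = 0" using discrete by blast
  have atlas: "(U, f) \<in> atlas (lie_quot G \<Gamma>) \<longleftrightarrow> (\<exists>W U' f'. U = ?q ` W \<and> f = f' \<circ> inv_into W ?q \<and>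
      inj_on ?q W \<and> (U', f') \<in> atlas G \<and> openin (topo G) W \<and> W \<subseteq> U')" for U f
    by (auto simp: lie_quot_def)
  have carrier: "range (\<lambda>x. ?q (\<pi> x)) = carrier (lie_quot G \<Gamma>)"
    by (auto simp: lie_quot_def FactGroup_def RCOSETS_def G.range_proj[symmetric])
  show ?thesis
  proof
    show "range (\<lambda>x. ?q (\<pi> x)) = carrier (lie_quot G \<Gamma>)" by (rule carrier)
    show "?q (\<pi> x) = ?q (\<pi> y) \<longleftrightarrow> y - x \<in> M" for x y by (rule eq)
    show "\<exists>e>0. \<forall>n\<in>M. norm n < e \<longrightarrow> n = 0" by (rule discrete)
    have "quotient_map euclidean (coset_topology G (topo G) \<Gamma>) (?q \<circ> \<pi>)"
      by (rule quotient_map_compose[OF G.quotient_map_proj quotient_map_coset_topology])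
    then show "quotient_map euclidean (topo (lie_quot G \<Gamma>)) (\<lambda>x. ?q (\<pi> x))"
      by (simp add: lie_quot_def comp_def)
    show "open (f ` U)" if c: "(U, f) \<in> atlas (lie_quot G \<Gamma>)" for U f
    proof -
      obtain W U' f' where *: "U = ?q ` W" "f = f' \<circ> inv_into W ?q" "inj_on ?q W"
        "(U', f') \<in> atlas G" "openin (topo G) W" "W \<subseteq> U'" using iffD1[OF atlas c] by (elim exE conjE) (rule that)
      have "f ` U = f' ` W" using *(3) unfolding *(1,2) image_comp by (intro image_cong) simp_all
      also have "\<dots> = f' ` U' \<inter> \<pi> -` W"
      proof (intro equalityI subsetI)
        fix v assume "v \<in> f' ` W"
        then obtain w where "w \<in> W" "v = f' w" by (rule imageE)
        then show "v \<in> f' ` U' \<inter> \<pi> -` W" using *(6) G.chart_section[OF *(4), of w] by auto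
      next
        fix v assume v: "v \<in> f' ` U' \<inter> \<pi> -` W"
        then obtain u where "u \<in> U'" "v = f' u" by blast
        then show "v \<in> f' ` W" using v G.chart_section[OF *(4), of u] by auto
      qed
      finally show ?thesis
        using open_Int[OF G.chart_open[OF *(4)] G.open_vimage_proj[OF *(5)]] by (rule ssubst)
    qed
    show "?q (\<pi> (f u)) = u" if c: "(U, f) \<in> atlas (lie_quot G \<Gamma>)" and u: "u \<in> U" for U f u
    proof -
      obtain W U' f' where *: "U = ?q ` W" "f = f' \<circ> inv_into W ?q" "inj_on ?q W"
        "(U', f') \<in> atlas G" "openin (topo G) W" "W \<subseteq> U'" using iffD1[OF atlas c] by (elim exE conjE) (rule that)
      obtain w where w: "w \<in> W" "u = ?q w" using u unfolding *(1) by (rule imageE) (rule that)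
      then have "f u = f' w" using *(2,3) by simp
      moreover have "\<pi> (f' w) = w" using w(1) *(6) by (intro G.chart_section[OF *(4)]) blast
      ultimately show ?thesis using w(2) by simp
    qed
    show "\<exists>(U, f)\<in>atlas (lie_quot G \<Gamma>). a \<in> U" if a: "a \<in> carrier (lie_quot G \<Gamma>)" for a
    proof -
      obtain x where x: "a = ?q (\<pi> x)"
        using a unfolding carrier[symmetric] by (rule rangeE)
      obtain U f where U: "(U, f) \<in> atlas G" "\<pi> x \<in> U" using G.charts_cover[OF G.proj_in_carrier] by blast
      define W where "W = U \<inter> \<pi> ` ball x (e/2)"
      have "inj_on (\<lambda>x. ?q (\<pi> x)) (ball x (e/2))"
        by (rule inj_on_ball_if_discrete[of _ M]) (use eq e in auto)
      then have "inj_on ?q (\<pi> ` ball x (e/2))" by (auto simp: inj_on_def)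
      then have "inj_on ?q W" unfolding W_def by (rule inj_on_subset) blast
      moreover have "openin (topo G) W"
        unfolding W_def using G.chart_openin[OF U(1)] G.openin_image[OF open_ball] by (rule openin_Int)
      ultimately have chart: "(?q ` W, f \<circ> inv_into W ?q) \<in> atlas (lie_quot G \<Gamma>)"
        using U(1) unfolding W_def by (intro iffD2[OF atlas] exI conjI) (rule refl | assumption | rule Int_lower1)+
      have "a \<in> ?q ` W" unfolding W_def x using U(2) e(1) by auto
      then show ?thesis by (intro bexI[OF _ chart]) simp
    qed
    show "?q (\<pi> x) \<otimes>\<^bsub>lie_quot G \<Gamma>\<^esub> ?q (\<pi> y) = ?q (\<pi> (m x y))" for x y
      using rcos_sum[OF G.proj_in_carrier G.proj_in_carrier]
      by (simp add: lie_quot_def FactGroup_def G.mult_proj)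
    show "\<one>\<^bsub>lie_quot G \<Gamma>\<^esub> = ?q (\<pi> 0)"
      using coset_mult_one[OF sub] by (simp add: lie_quot_def FactGroup_def flip: G.one_proj)
  qed (use G.m_assoc G.m_zero_left G.m_inv_left G.smooth_m G.smooth_inv left right in auto)
qed

text \<open>The immersed subgroup \<open>range p\<close> with the topology and the smooth structure of the quotient of the
  parameter space by the kernel of \<open>p\<close>. The topology is in general finer than the one induced from
  \<open>G\<close>.\<close>

definition image_lie :: "('a, 'v) lie \<Rightarrow> ('w::euclidean_space \<Rightarrow> 'a) \<Rightarrow> ('a, 'w) lie" where
  "image_lie G p =
     \<lparr>carrier = range p, mult = mult G, one = one G,
      topo = topology (\<lambda>V. V \<subseteq> range p \<and> open (p -` V)),
      atlas = {(p ` W, inv_into W p) | W. open W \<and> inj_on p W}\<rparr>"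

lemma covered_lie_group_image:
  fixes p :: "'w::euclidean_space \<Rightarrow> 'a"
  assumes eq: "\<And>x y. p x = p y \<longleftrightarrow> y - x \<in> M"
    and discrete: "\<exists>e>0. \<forall>n\<in>M. norm n < e \<longrightarrow> n = 0"
    and mult: "\<And>x y. p x \<otimes>\<^bsub>G\<^esub> p y = p (m x y)" and one: "\<one>\<^bsub>G\<^esub> = p 0"
    and m: "\<And>x y z. m (m x y) z = m x (m y z)" "\<And>x. m 0 x = x" "\<And>x. m (\<iota> x) x = 0"
      "smooth_on UNIV (\<lambda>p. m (fst p) (snd p))" "smooth_on UNIV \<iota>"
    and transl: "\<And>n x. n \<in> M \<Longrightarrow> m n x = n + x" "\<And>n x. n \<in> M \<Longrightarrow> m x n = n + x"
  shows "covered_lie_group (image_lie G p) p M m \<iota>"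
proof -
  have "istopology (\<lambda>V. V \<subseteq> range p \<and> open (p -` V))"
    unfolding istopology_def by (auto simp: vimage_Union)
  then have top: "openin (topo (image_lie G p)) V \<longleftrightarrow> V \<subseteq> range p \<and> open (p -` V)" for V
    by (simp add: image_lie_def topology_inverse')
  have "openin (topo (image_lie G p)) (range p)" unfolding top by (simp add: vimage_def)
  then have topspace: "topspace (topo (image_lie G p)) = range p"
    using openin_subset[of "topo (image_lie G p)"] openin_topspace[of "topo (image_lie G p)", unfolded top]
    by (intro equalityI) simp_all
  have atlas: "(U, f) \<in> atlas (image_lie G p) \<longleftrightarrow> (\<exists>W. U = p ` W \<and> f = inv_into W p \<and> open W \<and> inj_on p W)" for U f
    by (auto simp: image_lie_def)
  obtain e where e: "e > 0" "\<And>n. n \<in> M \<Longrightarrow> norm n < e \<Longrightarrow> n = 0" using discrete by blast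
  show ?thesis
  proof
    show "range p = carrier (image_lie G p)" by (simp add: image_lie_def)
    show "quotient_map euclidean (topo (image_lie G p)) p"
      unfolding quotient_map_def topspace top by (simp add: vimage_def)
    show "open (f ` U)" if c: "(U, f) \<in> atlas (image_lie G p)" for U f
    proof -
      obtain W where "U = p ` W" "f = inv_into W p" "open W" "inj_on p W"
        using iffD1[OF atlas c] by (elim exE conjE) (rule that)
      then show ?thesis by (simp add: inv_into_image_cancel)
    qed
    show "p (f u) = u" if "(U, f) \<in> atlas (image_lie G p)" "u \<in> U" for U f u
      using that unfolding atlas by (auto simp: f_inv_into_f)
    show "\<exists>(U, f)\<in>atlas (image_lie G p). a \<in> U" if a: "a \<in> carrier (image_lie G p)" for a
    proof -
      obtain x where x: "a = p x" using a by (auto simp: image_lie_def)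
      have "inj_on p (ball x (e/2))" by (rule inj_on_ball_if_discrete[of _ M]) (use eq e in auto)
      then have "(p ` ball x (e/2), inv_into (ball x (e/2)) p) \<in> atlas (image_lie G p)"
        by (intro iffD2[OF atlas] exI conjI) (rule refl open_ball | assumption)+
      moreover have "a \<in> p ` ball x (e/2)" using x e(1) by simp
      ultimately show ?thesis by blast
    qed
    show "p x \<otimes>\<^bsub>image_lie G p\<^esub> p y = p (m x y)" for x y using mult by (simp add: image_lie_def)
    show "\<one>\<^bsub>image_lie G p\<^esub> = p 0" using one by (simp add: image_lie_def)
  qed (use eq discrete m transl in auto)
qed

section \<open>The Lie algebra and the one-parameter groups\<close>

context covered_lie_group
begin

lemma chart_one:
  assumes c: "(U, f) \<in> atlas G" "\<one>\<^bsub>G\<^esub> \<in> U"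
  shows "f \<one>\<^bsub>G\<^esub> \<in> N" "f \<one>\<^bsub>G\<^esub> \<in> f ` U" "\<pi> 0 \<in> U"
  using chart_section[OF c] c(2) proj_eq_iff[of 0 "f \<one>\<^bsub>G\<^esub>"] by (auto simp: one_proj)

text \<open>Near \<open>0\<close> the composition of the projection with a chart is a translation.\<close>

lemma has_derivative_chart_proj:
  assumes c: "(U, f) \<in> atlas G" "\<one>\<^bsub>G\<^esub> \<in> U"
  shows "((f \<circ> \<pi>) has_derivative (\<lambda>x. x)) (at 0)"
proof -
  obtain T where T: "open T" "0 \<in> T"
    "\<And>x. x \<in> T \<Longrightarrow> \<pi> x \<in> U \<and> f (\<pi> x) = f (\<pi> 0) - 0 + x"
    using chart_translation[OF c(1) continuous_on_id, of 0] chart_one(3)[OF c] by metis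
  have "((\<lambda>x. f (\<pi> 0) + x) has_derivative (\<lambda>x. x)) (at 0)"
    by (auto intro!: derivative_eq_intros)
  then show ?thesis
    by (rule has_derivative_transform_within_open[OF _ T(1,2)]) (simp add: T(3))
qed

lemma tangent_coords_proj:
  assumes "(U, f) \<in> atlas G" "\<one>\<^bsub>G\<^esub> \<in> U"
  shows "tangent_coords \<pi> f = (\<lambda>x. x)"
  unfolding tangent_coords_def
  using frechet_derivative_at[OF has_derivative_chart_proj[OF assms]] by simp

text \<open>The coordinate \<open>f \<one>\<close> of the unit is an element of \<open>N\<close>, not necessarily \<open>0\<close>. Since \<open>N\<close> acts by
  translations, the multiplication in the chart is the multiplication \<open>m\<close> with the origin moved to
  \<open>f \<one>\<close>. So the left-invariant fields of the chart are those of \<open>m\<close>, moved in the same way.\<close>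

lemma left_inv_field_chart:
  assumes L: "\<And>x. (m x has_derivative L x) (at 0)"
    and c: "(U, f) \<in> atlas G" "\<one>\<^bsub>G\<^esub> \<in> U" and x: "x \<in> f ` U"
  shows "left_inv_field G (U, f) v x = L (x - f \<one>\<^bsub>G\<^esub>) v"
proof -
  let ?n = "f \<one>\<^bsub>G\<^esub>"
  note n = chart_one(1)[OF c]
  have "continuous_on UNIV (\<lambda>p. m (fst p) (snd p))"
    using smooth_m[unfolded smooth_on_def, rule_format, of 0] by simp
  then have cont: "continuous_on UNIV (m x)"
    using continuous_on_compose2[where g = "\<lambda>p. m (fst p) (snd p)" and f = "\<lambda>y. (x, y)"
        and s = UNIV and t = UNIV] by (simp add: continuous_on_Pair)
  \<comment> \<open>The value at the base point \<open>f \<one>\<close> of the second variable fixes the local constant: it is \<open>- f \<one>\<close>.\<close>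
  have xn: "m x ?n = ?n + x" by (rule translation_right[OF n])
  obtain T where T: "open T" "?n \<in> T"
    "\<And>y. y \<in> T \<Longrightarrow> \<pi> (m x y) \<in> U \<and> f (\<pi> (m x y)) = f (\<pi> (m x ?n)) - m x ?n + m x y"
    using chart_translation[OF c(1) cont, of ?n] chart_proj(1)[OF c(1) x] xn proj_add[OF n] by metis
  have eq: "chart_mult G (U, f) x y = m (x - ?n) y" if "y \<in> T \<inter> f ` U" for y
  proof -
    have "chart_mult G (U, f) x y = f (\<pi> (m x y))"
      using that by (simp add: chart_mult_def chart_proj(3)[OF c(1)] x mult_proj)
    also have "\<dots> = - ?n + m x y"
      using T(3)[of y] that by (simp add: xn proj_add[OF n] chart_proj(2)[OF c(1) x])
    also have "\<dots> = m (x - ?n) y"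
      using m_translation_left[OF uminus_in_N[OF n], of x y] by simp
    finally show ?thesis .
  qed
  have "m (x - ?n) y = ?n + m (x - ?n) (y - ?n)" for y
    using m_translation_right[OF n, of "x - ?n" "y - ?n"] by simp
  then have shift: "m (x - ?n) = (\<lambda>y. ?n + m (x - ?n) (y - ?n))" by blast
  have "((\<lambda>y. m (x - ?n) (y - ?n)) has_derivative (\<lambda>v. L (x - ?n) v)) (at ?n)"
    by (rule has_derivative_compose[of "\<lambda>y. y - ?n" "\<lambda>v. v" ?n UNIV "m (x - ?n)"])
       (auto intro!: derivative_eq_intros simp: L)
  then have "(m (x - ?n) has_derivative L (x - ?n)) (at ?n)"
    by (subst shift) (auto intro!: derivative_eq_intros)
  then have "(chart_mult G (U, f) x has_derivative L (x - ?n)) (at ?n)"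
    by (rule has_derivative_transform_within_open[of _ _ _ _ "T \<inter> f ` U"])
       (use T(1,2) chart_open[OF c(1)] chart_one(2)[OF c] eq in auto)
  then show ?thesis
    unfolding left_inv_field_def snd_conv by (simp add: frechet_derivative_at[symmetric])
qed

text \<open>Here \<open>L x v\<close> is the left-invariant vector field of \<open>m\<close> with value \<open>v\<close> at \<open>0\<close>, and \<open>B v\<close> is its
  linearisation at \<open>0\<close>.\<close>

lemma has_lie_algebra_proj:
  assumes L: "\<And>x. (m x has_derivative L x) (at 0)"
    and B: "\<And>v. ((\<lambda>x. L x v) has_derivative B v) (at 0)"
    and br: "\<And>X Y. br X Y = B Y X - B X Y"
  shows "has_lie_algebra G br \<pi>"
proof -
  have "frechet_derivative (left_inv_field G (U, f) v) (at (f \<one>\<^bsub>G\<^esub>)) = B v"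
    if c: "(U, f) \<in> atlas G" "\<one>\<^bsub>G\<^esub> \<in> U" for U f v
  proof -
    have "((\<lambda>x. L (x - f \<one>\<^bsub>G\<^esub>) v) has_derivative (\<lambda>u. B v u)) (at (f \<one>\<^bsub>G\<^esub>))"
      by (rule has_derivative_compose[of "\<lambda>y. y - f \<one>\<^bsub>G\<^esub>" "\<lambda>v. v" _ UNIV "\<lambda>x. L x v"])
         (auto intro!: derivative_eq_intros simp: B)
    then have "(left_inv_field G (U, f) v has_derivative B v) (at (f \<one>\<^bsub>G\<^esub>))"
      by (rule has_derivative_transform_within_open[OF _ chart_open[OF c(1)] chart_one(2)[OF c]])
         (simp add: left_inv_field_chart[OF L c])
    then show ?thesis using frechet_derivative_at by metis
  qed
  moreover have "(f \<circ> \<pi>) differentiable (at 0)" if "(U, f) \<in> atlas G" "\<one>\<^bsub>G\<^esub> \<in> U" for U f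
    using has_derivative_chart_proj[OF that] differentiable_def by blast
  ultimately show ?thesis
    unfolding has_lie_algebra_def chart_bracket_def
    by (auto simp: one_proj[symmetric] tangent_coords_proj br bij_id[unfolded id_def])
qed

text \<open>Path lifting for the covering, in the simplest case: near time \<open>0\<close> the curve stays in one chart at
  the unit. The failure of the lift to be a homomorphism is a continuous function with values in the
  discrete set \<open>N\<close> that vanishes at \<open>(0, 0)\<close>, so it vanishes nearby.\<close>

lemma one_param_group_lift:
  assumes \<gamma>: "one_param_group G \<pi> X \<gamma>"
  obtains c e where "e > 0" "c 0 = 0" "(c has_vector_derivative X) (at 0)"
    "\<And>r. \<bar>r\<bar> < e \<Longrightarrow> \<pi> (c r) = \<gamma> r"
    "\<And>r s. \<bar>r\<bar> < e \<Longrightarrow> \<bar>s\<bar> < e \<Longrightarrow> \<bar>r + s\<bar> < e \<Longrightarrow> c (r + s) = m (c r) (c s)"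
proof -
  interpret group G by (rule group_G)
  have cont: "continuous_map euclideanreal (topo G) \<gamma>" and hom: "\<gamma> (s + t) = \<gamma> s \<otimes>\<^bsub>G\<^esub> \<gamma> t" for s t
    using \<gamma> unfolding one_param_group_def by auto
  have carrier: "\<gamma> r \<in> carrier G" for r
    using continuous_map_image_subset_topspace[OF cont] topspace_topo by auto
  have one: "\<gamma> 0 = \<one>\<^bsub>G\<^esub>" using hom[of 0 0] r_cancel_one[OF carrier carrier, of 0 0] by simp
  obtain U f where c: "(U, f) \<in> atlas G" "\<one>\<^bsub>G\<^esub> \<in> U" using charts_cover[OF one_closed] by blast
  note n = chart_one(1)[OF c]
  define c' where "c' r = f (\<gamma> r) - f \<one>\<^bsub>G\<^esub>" for r
  have "((f \<circ> \<gamma>) has_vector_derivative X) (at 0)"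
    using \<gamma> c tangent_coords_proj[OF c] unfolding one_param_group_def by auto
  then have c'_deriv: "(c' has_vector_derivative X) (at 0)"
    unfolding c'_def comp_def by (auto intro!: derivative_eq_intros)
  then have c'_cont: "isCont c' 0" by (rule has_vector_derivative_continuous)
  have c'_0: "c' 0 = 0" by (simp add: c'_def one)
  have "open {r. \<gamma> r \<in> U}"
    using openin_continuous_map_preimage[OF cont chart_openin[OF c(1)]] by simp
  moreover have "0 \<in> {r. \<gamma> r \<in> U}" using one c by simp
  ultimately obtain e1 where e1: "e1 > 0" "ball 0 e1 \<subseteq> {r. \<gamma> r \<in> U}"
    unfolding open_contains_ball by blast
  have proj: "\<pi> (c' r) = \<gamma> r" if "\<bar>r\<bar> < e1" for r
  proof -
    have "\<gamma> r \<in> U" using e1(2) that by (auto simp: dist_norm)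
    then have "\<pi> (f (\<gamma> r)) = \<gamma> r" by (rule chart_section[OF c(1)])
    then show ?thesis using proj_add[OF uminus_in_N[OF n], of "f (\<gamma> r)"] by (simp add: c'_def)
  qed
  obtain d where d: "d > 0" "\<And>n. n \<in> N \<Longrightarrow> norm n < d \<Longrightarrow> n = 0" using discrete by blast
  define g where "g p = m (c' (fst p)) (c' (snd p)) - c' (fst p + snd p)" for p
  have "isCont (\<lambda>p. m (fst p) (snd p)) (c' (fst (0::real\<times>real)), c' (snd (0::real\<times>real)))"
    using m_differentiable differentiable_imp_continuous_within by blast
  then have "isCont (\<lambda>p. m (fst (c' (fst p), c' (snd p))) (snd (c' (fst p), c' (snd p)))) (0::real\<times>real)"
  proof (rule isCont_o2[rotated])
    have "isCont (\<lambda>p. c' (fst p)) (0::real\<times>real)" "isCont (\<lambda>p. c' (snd p)) (0::real\<times>real)"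
      using c'_cont by (simp_all add: isCont_o2[where g = c'])
    then show "isCont (\<lambda>p. (c' (fst p), c' (snd p))) (0::real\<times>real)" by (rule isCont_Pair)
  qed
  moreover have "isCont (\<lambda>p. c' (fst p + snd p)) (0::real\<times>real)"
  proof (rule isCont_o2[where g = c'])
    show "isCont (\<lambda>p. fst p + snd p) (0::real\<times>real)" by (intro continuous_intros)
  qed (use c'_cont in simp)
  ultimately have "isCont g 0" unfolding g_def by (intro continuous_diff) simp_all
  moreover have "g 0 = 0" by (simp add: g_def c'_0 m_zero_left)
  ultimately obtain e2 where e2: "e2 > 0" "\<And>p. dist p 0 < e2 \<Longrightarrow> norm (g p) < d"
    using d(1) unfolding continuous_at_eps_delta by (metis dist_0_norm dist_commute)
  show ?thesis
  proof (rule that[of "min e1 (e2/2)" c'])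
    fix r s :: real assume rs: "\<bar>r\<bar> < min e1 (e2/2)" "\<bar>s\<bar> < min e1 (e2/2)" "\<bar>r + s\<bar> < min e1 (e2/2)"
    have "\<pi> (c' (r + s)) = \<pi> (m (c' r) (c' s))"
      using rs by (simp add: proj hom flip: mult_proj)
    then have "g (r, s) \<in> N" unfolding g_def using proj_eq_iff by simp
    moreover have "norm (r, s) < e2" using norm_Pair_le[of r s] rs by simp
    then have "norm (g (r, s)) < d" by (intro e2(2)) simp
    ultimately show "c' (r + s) = m (c' r) (c' s)" using d(2)[of "g (r, s)"] by (simp add: g_def)
  qed (use e1(1) e2(1) c'_0 c'_deriv proj in auto)
qed

text \<open>The curve \<open>d r = c1 r (c2 r)\<inverse>\<close> satisfies \<open>d (r + h) = c1 r (d h) (c2 r)\<inverse>\<close>, so its derivative at \<open>r\<close>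
  is a linear image of its derivative at \<open>0\<close>, which is \<open>X - X = 0\<close>. Hence \<open>d\<close> is constant.\<close>

lemma local_one_param_unique:
  assumes "e > 0"
    and c1: "c1 0 = 0" "(c1 has_vector_derivative X) (at 0)"
      "\<And>r s. \<bar>r\<bar> < e \<Longrightarrow> \<bar>s\<bar> < e \<Longrightarrow> \<bar>r + s\<bar> < e \<Longrightarrow> c1 (r + s) = m (c1 r) (c1 s)"
    and c2: "c2 0 = 0" "(c2 has_vector_derivative X) (at 0)"
      "\<And>r s. \<bar>r\<bar> < e \<Longrightarrow> \<bar>s\<bar> < e \<Longrightarrow> \<bar>r + s\<bar> < e \<Longrightarrow> c2 (r + s) = m (c2 r) (c2 s)"
    and r: "\<bar>r\<bar> < e"
  shows "c1 r = c2 r"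
proof -
  define d where "d r = m (c1 r) (\<iota> (c2 r))" for r
  have d0: "d 0 = 0" by (simp add: d_def c1 c2 m_inv_right)
  have "(\<lambda>r. \<iota> (c2 r)) differentiable (at 0)"
    using c2(2) inv_differentiable
    by (intro differentiable_compose[of \<iota> c2]) (auto simp: has_vector_derivative_def differentiable_def)
  moreover have "c1 differentiable (at 0)"
    using c1(2) by (auto simp: has_vector_derivative_def differentiable_def)
  ultimately have "(\<lambda>r. (c1 r, \<iota> (c2 r))) differentiable (at 0)"
    unfolding differentiable_def by (elim exE) (rule exI, rule has_derivative_Pair)
  then have "(\<lambda>r. m (fst (c1 r, \<iota> (c2 r))) (snd (c1 r, \<iota> (c2 r)))) differentiable (at 0)"
    by (rule differentiable_compose[OF m_differentiable])
  then have "d differentiable (at 0)" by (simp add: d_def[abs_def])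
  then obtain Y where Y: "(d has_vector_derivative Y) (at 0)"
    unfolding vector_derivative_works by blast
  \<comment> \<open>Differentiate \<open>d r (c2 r) = c1 r\<close> at \<open>0\<close>.\<close>
  have "Y + X = X"
  proof -
    have "((\<lambda>p. m (fst p) (snd p)) has_derivative (\<lambda>p. fst p + snd p)) (at (d 0, c2 0))"
      using m_has_derivative_zero by (simp add: d0 c2(1) zero_prod_def)
    from has_derivative_compose[OF has_derivative_Pair[OF Y[unfolded has_vector_derivative_def]
          c2(2)[unfolded has_vector_derivative_def]] this]
    have "((\<lambda>r. m (d r) (c2 r)) has_vector_derivative (Y + X)) (at 0)"
      by (simp add: has_vector_derivative_def scaleR_add_right)
    moreover have "(\<lambda>r. m (d r) (c2 r)) = c1"
      by (simp add: d_def m_assoc m_inv_left m_zero_right)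
    ultimately show ?thesis using c1(2) vector_derivative_at by metis
  qed
  then have d_deriv: "(d has_derivative (\<lambda>_. 0)) (at 0)" using Y by (simp add: has_vector_derivative_def)
  have deriv: "(d has_derivative (\<lambda>_. 0)) (at r)" if r: "r \<in> ball 0 e" for r
  proof -
    define \<Phi> where "\<Phi> y = m (c1 r) (m y (\<iota> (c2 r)))" for y
    have "(\<lambda>y. m (fst (y, \<iota> (c2 r))) (snd (y, \<iota> (c2 r)))) differentiable (at (d 0))"
      by (rule differentiable_compose[OF m_differentiable]) (auto simp: differentiable_def intro!: derivative_eq_intros)
    then have "(\<lambda>y. (c1 r, m y (\<iota> (c2 r)))) differentiable (at (d 0))"
      unfolding differentiable_def fst_conv snd_conv
      by (elim exE) (rule exI, rule has_derivative_Pair[OF has_derivative_const])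
    then have "(\<lambda>y. m (fst (c1 r, m y (\<iota> (c2 r)))) (snd (c1 r, m y (\<iota> (c2 r))))) differentiable (at (d 0))"
      by (rule differentiable_compose[OF m_differentiable])
    then obtain \<Phi>' where \<Phi>': "(\<Phi> has_derivative \<Phi>') (at (d 0))"
      unfolding \<Phi>_def differentiable_def by auto
    have "\<Phi>' 0 = 0" using has_derivative_linear[OF \<Phi>'] by (rule linear_0)
    then have *: "((\<lambda>h. \<Phi> (d h)) has_derivative (\<lambda>_. 0)) (at 0)"
      using has_derivative_compose[OF d_deriv \<Phi>'] by simp
    have "((\<lambda>s. \<Phi> (d (s - r))) has_derivative (\<lambda>_. 0)) (at r)"
      by (rule has_derivative_compose[of "\<lambda>s. s - r" "\<lambda>v. v" r UNIV "\<lambda>h. \<Phi> (d h)" "\<lambda>_. 0"])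
         (auto intro!: derivative_eq_intros simp: *)
    then show ?thesis
    proof (rule has_derivative_transform_within_open)
      show "open (ball 0 e \<inter> ball r e)" by auto
      show "r \<in> ball 0 e \<inter> ball r e" using r \<open>e > 0\<close> by simp
      fix s assume "s \<in> ball 0 e \<inter> ball r e"
      then have s: "\<bar>r\<bar> < e" "\<bar>s - r\<bar> < e" "\<bar>r + (s - r)\<bar> < e" using r by (auto simp: dist_norm)
      have "c1 s = m (c1 r) (c1 (s - r))" using c1(3)[OF s] by simp
      moreover have "\<iota> (c2 s) = m (\<iota> (c2 (s - r))) (\<iota> (c2 r))"
      proof -
        have "c2 s = m (c2 r) (c2 (s - r))" using c2(3)[OF s] by simp
        then have "m (c2 s) (m (\<iota> (c2 (s - r))) (\<iota> (c2 r))) = 0"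
          by (metis m_assoc m_inv_right m_zero_left)
        then show ?thesis by (metis m_assoc m_inv_left m_zero_left m_zero_right)
      qed
      ultimately show "\<Phi> (d (s - r)) = d s" by (simp add: \<Phi>_def d_def m_assoc)
    qed
  qed
  have "\<exists>c. \<forall>r\<in>ball 0 e. d r = c"
    using deriv by (intro has_derivative_zero_constant) (auto intro: has_derivative_at_withinI)
  then have "d r = d 0" using r \<open>e > 0\<close> by (auto simp: dist_norm)
  then have "m (m (c1 r) (\<iota> (c2 r))) (c2 r) = c2 r" by (simp add: d0 m_zero_left flip: d_def)
  then show ?thesis by (simp add: m_assoc m_inv_left m_zero_right)
qed

text \<open>Two homomorphisms that agree near \<open>0\<close> agree everywhere, by repeated doubling of the time.\<close>

lemma one_param_group_unique:
  assumes \<gamma>: "one_param_group G \<pi> X \<gamma>" and \<delta>: "one_param_group G \<pi> X \<delta>"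
  shows "\<gamma> = \<delta>"
proof
  obtain c1 e1 where c1: "e1 > 0" "c1 0 = 0" "(c1 has_vector_derivative X) (at 0)"
    "\<And>r. \<bar>r\<bar> < e1 \<Longrightarrow> \<pi> (c1 r) = \<gamma> r"
    "\<And>r s. \<bar>r\<bar> < e1 \<Longrightarrow> \<bar>s\<bar> < e1 \<Longrightarrow> \<bar>r + s\<bar> < e1 \<Longrightarrow> c1 (r + s) = m (c1 r) (c1 s)"
    using \<gamma> by (rule one_param_group_lift) (rule that)
  obtain c2 e2 where c2: "e2 > 0" "c2 0 = 0" "(c2 has_vector_derivative X) (at 0)"
    "\<And>r. \<bar>r\<bar> < e2 \<Longrightarrow> \<pi> (c2 r) = \<delta> r"
    "\<And>r s. \<bar>r\<bar> < e2 \<Longrightarrow> \<bar>s\<bar> < e2 \<Longrightarrow> \<bar>r + s\<bar> < e2 \<Longrightarrow> c2 (r + s) = m (c2 r) (c2 s)"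
    using \<delta> by (rule one_param_group_lift) (rule that)
  define e where "e = min e1 e2"
  have e: "e > 0" using c1 c2 by (simp add: e_def)
  have near: "\<gamma> r = \<delta> r" if "\<bar>r\<bar> < e" for r
    using local_one_param_unique[OF e c1(2,3) c1(5) c2(2,3) c2(5) that] c1(4) c2(4) that
    by (fastforce simp: e_def)
  have "\<forall>r. \<bar>r\<bar> < 2 ^ n * e \<longrightarrow> \<gamma> r = \<delta> r" for n
  proof (induction n)
    case (Suc n)
    show ?case
    proof (intro allI impI)
      fix r :: real assume "\<bar>r\<bar> < 2 ^ Suc n * e"
      then have "\<gamma> (r/2) = \<delta> (r/2)" using Suc by simp
      moreover have "\<gamma> (r/2 + r/2) = \<gamma> (r/2) \<otimes>\<^bsub>G\<^esub> \<gamma> (r/2)" "\<delta> (r/2 + r/2) = \<delta> (r/2) \<otimes>\<^bsub>G\<^esub> \<delta> (r/2)"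
        using \<gamma> \<delta> unfolding one_param_group_def by blast+
      ultimately show "\<gamma> r = \<delta> r" by simp
    qed
  qed (simp add: near)
  moreover fix r
  obtain n :: nat where "\<bar>r\<bar> / e < 2 ^ n" using real_arch_pow[of 2] by auto
  then have "\<bar>r\<bar> < 2 ^ n * e" using e by (simp add: field_simps)
  ultimately show "\<gamma> r = \<delta> r" by blast
qed

text \<open>The exponential map can be computed on the covering space: a homomorphism into the covering group
  projects to a one-parameter group, and uniqueness makes the definite description in \<open>lie_exp\<close>
  denote its value.\<close>

lemma lie_exp_scaleR:
  assumes hom: "\<And>r s. c (r + s) = m (c r) (c s)" and deriv: "(c has_vector_derivative X) (at 0)"
    and cont: "continuous_on UNIV c"
  shows "lie_exp G \<pi> (r *\<^sub>R X) = \<pi> (c r)"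
proof -
  have "c 0 = m (m (\<iota> (c 0)) (c 0)) (c 0)" by (simp add: m_inv_left m_zero_left)
  also have "\<dots> = m (\<iota> (c 0)) (c 0)" using hom[of 0 0] by (simp only: m_assoc) simp
  finally have c0: "c 0 = 0" by (simp add: m_inv_left)
  have cont_r: "continuous_on UNIV (\<lambda>u. c (u * r))"
    by (rule continuous_on_compose2[OF cont]) (simp_all add: continuous_on_mult_right)
  have one: "one_param_group G \<pi> (r *\<^sub>R X) (\<lambda>u. \<pi> (c (u * r)))"
    unfolding one_param_group_def
  proof (intro conjI allI)
    have "continuous_map euclideanreal (topo G) (\<pi> \<circ> (\<lambda>u. c (u * r)))"
      by (rule continuous_map_compose[OF _ continuous_map_proj]) (simp add: cont_r)
    then show "continuous_map euclideanreal (topo G) (\<lambda>u. \<pi> (c (u * r)))" by (simp add: comp_def)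
    show "\<pi> (c ((s + t) * r)) = \<pi> (c (s * r)) \<otimes>\<^bsub>G\<^esub> \<pi> (c (t * r))" for s t
      by (simp add: mult_proj hom distrib_right)
    have "((f \<circ> (\<lambda>u. \<pi> (c (u * r)))) has_vector_derivative tangent_coords \<pi> f (r *\<^sub>R X)) (at 0)"
      if ch: "(U, f) \<in> atlas G" "\<one>\<^bsub>G\<^esub> \<in> U" for U f
    proof -
      obtain T where T: "open T" "0 \<in> T"
        "\<And>u. u \<in> T \<Longrightarrow> \<pi> (c (u * r)) \<in> U \<and> f (\<pi> (c (u * r))) = f (\<pi> (c (0 * r))) - c (0 * r) + c (u * r)"
        by (rule chart_translation[OF ch(1) cont_r, of 0]) (simp_all add: chart_one(3)[OF ch] c0)
      have "((c \<circ> (\<lambda>u. u * r)) has_vector_derivative (r *\<^sub>R X)) (at 0)"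
        by (rule vector_diff_chain_at) (auto intro!: derivative_eq_intros deriv)
      then have "((\<lambda>u. f (\<pi> 0) + c (u * r)) has_vector_derivative (r *\<^sub>R X)) (at 0)"
        unfolding comp_def by (auto intro!: derivative_eq_intros)
      then have "((f \<circ> (\<lambda>u. \<pi> (c (u * r)))) has_vector_derivative (r *\<^sub>R X)) (at 0)"
        by (rule has_vector_derivative_transform_within_open[OF _ T(1,2)]) (simp add: T(3) c0)
      then show ?thesis by (simp add: tangent_coords_proj[OF ch])
    qed
    then show "\<forall>(U, f)\<in>atlas G. \<one>\<^bsub>G\<^esub> \<in> U \<longrightarrow>
        ((f \<circ> (\<lambda>u. \<pi> (c (u * r)))) has_vector_derivative tangent_coords \<pi> f (r *\<^sub>R X)) (at 0)"
      by blast
  qed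
  show ?thesis
    unfolding lie_exp_def
  proof (rule the_equality)
    show "\<exists>\<gamma>. one_param_group G \<pi> (r *\<^sub>R X) \<gamma> \<and> \<gamma> 1 = \<pi> (c r)"
      using one by (intro exI[of _ "\<lambda>u. \<pi> (c (u * r))"]) simp
    fix g assume "\<exists>\<gamma>. one_param_group G \<pi> (r *\<^sub>R X) \<gamma> \<and> \<gamma> 1 = g"
    then obtain \<gamma> where "one_param_group G \<pi> (r *\<^sub>R X) \<gamma>" "\<gamma> 1 = g" by blast
    then show "g = \<pi> (c r)" using one_param_group_unique[OF one, of \<gamma>] by auto
  qed
qed

end

section \<open>The oscillator group in coordinates\<close>

lemma heis_form_inner: "heis_form lam v w = ad_T lam v \<bullet> w"
  by (simp add: heis_form_def ad_T_def split_beta inner_prod_def inner_vec_def sum.distrib[symmetric]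
      algebra_simps)

lemma linear_ad_T: "linear (ad_T lam)"
  by (rule linearI) (simp_all add: ad_T_def split_beta vec_eq_iff algebra_simps)

lemma linear_rot: "linear (rot lam t)"
  by (rule linearI) (simp_all add: rot_def split_beta vec_eq_iff algebra_simps)

lemma rot_rot: "rot lam s (rot lam t v) = rot lam (s + t) v"
  by (simp add: rot_def split_beta vec_eq_iff algebra_simps cos_add sin_add)

lemma rot_zero: "rot lam 0 v = v"
  by (simp add: rot_def split_beta)

lemma rot_center: "rot lam t (c, 0, 0) = (c, 0, 0)"
  by (simp add: rot_def zero_vec_def)

lemma ad_T_center: "ad_T lam (c, 0, 0) = 0"
  by (simp add: ad_T_def zero_prod_def zero_vec_def)

lemma heis_form_antisym: "heis_form lam v w = - heis_form lam w v"
  by (simp add: heis_form_def split_beta sum_negf[symmetric] algebra_simps)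

lemma heis_form_self: "heis_form lam v v = 0"
  using heis_form_antisym[of lam v v] by simp

lemma heis_form_center_left: "heis_form lam (c, 0, 0) w = 0"
  by (simp add: heis_form_inner ad_T_center)

lemma heis_form_center_right: "heis_form lam w (c, 0, 0) = 0"
  using heis_form_antisym[of lam w] by (simp add: heis_form_center_left)

lemma heis_form_add_left: "heis_form lam (u + v) w = heis_form lam u w + heis_form lam v w"
  by (simp add: heis_form_inner linear_add[OF linear_ad_T] inner_add_left)

lemma heis_form_add_right: "heis_form lam u (v + w) = heis_form lam u v + heis_form lam u w"
  by (simp add: heis_form_inner inner_add_right)

lemma heis_form_scaleR_left: "heis_form lam (r *\<^sub>R u) w = r * heis_form lam u w"
  by (simp add: heis_form_inner linear_cmul[OF linear_ad_T])

lemma heis_form_scaleR_right: "heis_form lam u (r *\<^sub>R w) = r * heis_form lam u w"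
  by (simp add: heis_form_inner)

lemma heis_form_zero_left: "heis_form lam 0 w = 0"
  using heis_form_scaleR_left[of lam 0 0 w] by simp

lemma heis_form_zero_right: "heis_form lam w 0 = 0"
  using heis_form_scaleR_right[of lam w 0 0] by simp

lemma heis_form_minus_left: "heis_form lam (- u) w = - heis_form lam u w"
  using heis_form_scaleR_left[of lam "-1" u w] by simp

lemma heis_form_minus_right: "heis_form lam u (- w) = - heis_form lam u w"
  using heis_form_scaleR_right[of lam u "-1" w] by simp

lemma center_simps:
  "heis_form lam (c, 0) w = 0" "heis_form lam w (c, 0) = 0" "rot lam t (c, 0) = (c, 0)"
  by (simp_all add: zero_prod_def heis_form_center_left heis_form_center_right rot_center)

lemmas heis_form_simps = center_simps heis_form_self heis_form_center_left heis_form_center_right heis_form_add_left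
  heis_form_add_right heis_form_scaleR_left heis_form_scaleR_right heis_form_zero_left
  heis_form_zero_right heis_form_minus_left heis_form_minus_right

text \<open>The rotations act on the Heisenberg group by automorphisms because they are symplectic, and in
  each plane this is the identity \<open>sin\<^sup>2 + cos\<^sup>2 = 1\<close>.\<close>

lemma heis_form_rot: "heis_form lam (rot lam t v) (rot lam t w) = heis_form lam v w"
proof -
  have *: "(c * x - s * y) * (s * x' + c * y') - (s * x + c * y) * (c * x' - s * y') = x * y' - y * x'"
    if "s\<^sup>2 + c\<^sup>2 = 1" for c s x y x' y' :: real
  proof -
    have "(c * x - s * y) * (s * x' + c * y') - (s * x + c * y) * (c * x' - s * y')
        = (s\<^sup>2 + c\<^sup>2) * (x * y' - y * x')" by (simp add: algebra_simps power2_eq_square)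
    then show ?thesis using that by simp
  qed
  show ?thesis
    unfolding heis_form_def rot_def split_beta by (simp add: *)
qed

lemma heis_mult_assoc: "heis_mult lam (heis_mult lam u v) w = heis_mult lam u (heis_mult lam v w)"
proof -
  have "(a, 0, 0) + (b, 0, 0) = (a + b, 0::real^'a, 0::real^'a)" for a b :: real by simp
  then show ?thesis
    unfolding heis_mult_def
    by (simp add: heis_form_simps add.assoc) (simp add: algebra_simps add_divide_distrib)
qed

lemma rot_heis_mult: "rot lam t (heis_mult lam v w) = heis_mult lam (rot lam t v) (rot lam t w)"
  by (simp add: heis_mult_def linear_add[OF linear_rot] heis_form_rot rot_center)

text \<open>The group laws of \<open>Osc_tilde lam\<close> as functions, in a form that the simplifier and the smoothness
  rules can unfold.\<close>

definition osc_mult :: "real^'d \<Rightarrow> 'd osc \<Rightarrow> 'd osc \<Rightarrow> 'd osc" where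
  "osc_mult lam p q = (fst p + fst q, heis_mult lam (snd p) (rot lam (fst p) (snd q)))"

definition osc_inv :: "real^'d \<Rightarrow> 'd osc \<Rightarrow> 'd osc" where
  "osc_inv lam p = (- fst p, rot lam (- fst p) (- snd p))"

lemma osc_mult_assoc: "osc_mult lam (osc_mult lam p q) r = osc_mult lam p (osc_mult lam q r)"
  by (simp add: osc_mult_def heis_mult_assoc rot_heis_mult rot_rot add.assoc)

lemma osc_mult_zero_left: "osc_mult lam 0 p = p"
  by (simp add: osc_mult_def heis_mult_def rot_zero heis_form_simps flip: zero_prod_def)

lemma osc_inv_left: "osc_mult lam (osc_inv lam p) p = 0"
  by (simp add: osc_mult_def osc_inv_def heis_mult_def linear_neg[OF linear_rot] heis_form_simps
      flip: zero_prod_def)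

lemma smooth_osc_mult: "smooth_on UNIV (\<lambda>p. osc_mult lam (fst p) (snd p))"
  unfolding smooth_on_def osc_mult_def heis_mult_def heis_form_def rot_def split_beta divide_inverse
    plus_prod_def fst_conv snd_conv vec_lambda_beta
  by (intro allI Ck_intros finite_class.finite_UNIV)

lemma smooth_osc_inv: "smooth_on UNIV (osc_inv lam)"
  unfolding smooth_on_def osc_inv_def[abs_def] rot_def split_beta
    uminus_prod_def fst_conv snd_conv
  by (intro allI Ck_intros)

definition rot_periods :: "real^'d \<Rightarrow> real set" where
  "rot_periods lam = {t. rot lam t = id}"

text \<open>On each plane spanned by \<open>X\<^sub>k\<close> and \<open>Y\<^sub>k\<close>, read as the complex plane, \<open>t ad T\<close> is multiplication by
  \<open>\<i> lam\<^sub>k t\<close>, so the exponential series is that of \<open>exp (\<i> lam\<^sub>k t)\<close>. On the coordinates of \<open>T\<close> and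
  \<open>Z\<close> only the constant term of the series contributes.\<close>

lemma op_exp_osc_bracket_T: "op_exp (osc_bracket lam (t, 0)) (s, v) = (s, rot lam t v)"
proof -
  obtain z x y where v: "v = (z, x, y)" by (metis prod.exhaust)
  let ?A = "osc_bracket lam (t, 0)"
  let ?u = "\<lambda>n k. (\<i> * complex_of_real (lam $ k * t)) ^ n * Complex (x $ k) (y $ k)"
  \<comment> \<open>The operator annihilates the coordinates of \<open>T\<close> and \<open>Z\<close>.\<close>
  have A: "?A (s', z', x', y') = (0, 0, (\<chi> k. - (lam $ k * t * y' $ k)), (\<chi> k. lam $ k * t * x' $ k))"
    for s' z' x' y'
    by (simp add: osc_bracket_def heis_form_center_left[of lam 0] linear_0[OF linear_ad_T, unfolded zero_prod_def] ad_T_def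
        vec_eq_iff zero_prod_def algebra_simps)
  have pow: "(?A ^^ n) (s, v) =
      (if n = 0 then s else 0, if n = 0 then z else 0, (\<chi> k. Re (?u n k)), (\<chi> k. Im (?u n k)))" for n
  proof (induction n)
    case (Suc n)
    then show ?case by (simp add: A vec_eq_iff algebra_simps)
  qed (simp add: v)
  have u: "(\<lambda>n. ?u n k /\<^sub>R fact n) sums (cis (lam $ k * t) * Complex (x $ k) (y $ k))" for k
    using sums_mult2[OF exp_converges[of "\<i> * complex_of_real (lam $ k * t)"], of "Complex (x $ k) (y $ k)"]
    by (simp add: cis_conv_exp)
  have Re: "(\<lambda>n. Re (?u n k) / fact n) sums (cos (lam $ k * t) * x $ k - sin (lam $ k * t) * y $ k)" for k
    using sums_Re[OF u[of k]] by (simp add: divide_inverse mult.commute)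
  have Im: "(\<lambda>n. Im (?u n k) / fact n) sums (sin (lam $ k * t) * x $ k + cos (lam $ k * t) * y $ k)" for k
    using sums_Im[OF u[of k]] by (simp add: divide_inverse mult.commute add.commute)
  have const: "(\<lambda>n. (if n = 0 then c else 0) / fact n) sums c" for c :: real
    using sums_single[of 0 "\<lambda>_. c"] by (rule sums_cong[THEN iffD1, rotated]) simp
  have "(\<lambda>n. (1 / fact n) *\<^sub>R (?A ^^ n) (s, v)) =
      (\<lambda>n. ((if n = 0 then s else 0) / fact n, (if n = 0 then z else 0) / fact n,
        (\<chi> k. Re (?u n k) / fact n), (\<chi> k. Im (?u n k) / fact n)))"
    unfolding pow by (simp add: fun_eq_iff vec_eq_iff)
  moreover have "\<dots> sums (s, z, (\<chi> k. cos (lam $ k * t) * x $ k - sin (lam $ k * t) * y $ k),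
      (\<chi> k. sin (lam $ k * t) * x $ k + cos (lam $ k * t) * y $ k))"
  proof -
    have Pair: "(\<lambda>n. (f n, g n)) sums (a, b)" if "f sums a" "g sums b"
      for f :: "nat \<Rightarrow> 'x::real_normed_vector" and g :: "nat \<Rightarrow> 'y::real_normed_vector" and a b
      using tendsto_Pair[OF that[unfolded sums_def]] unfolding sums_def
      by (simp add: sum_prod[symmetric]) 
    have vec: "(\<lambda>n. (\<chi> k. f n k)) sums (\<chi> k. a k)" if "\<And>k. (\<lambda>n. f n k) sums a k"
      for f :: "nat \<Rightarrow> 'a \<Rightarrow> real" and a
    proof -
      have "(\<Sum>n<j. (\<chi> k. f n k)) = (\<chi> k. \<Sum>n<j. f n k)" for j by (simp add: vec_eq_iff)
      then show ?thesis using that unfolding sums_def by (simp add: tendsto_vec_lambda)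
    qed
    show ?thesis by (intro Pair vec const Re Im)
  qed
  ultimately have "(\<lambda>n. (1 / fact n) *\<^sub>R (?A ^^ n) (s, v)) sums (s, rot lam t v)"
    by (simp only: v rot_def prod.case)
  then show ?thesis
    unfolding op_exp_def by (rule sums_unique[symmetric])
qed

lemma Lambda'_eq: "Lambda' lam = {(t, 0) | t. t \<in> rot_periods lam}"
proof -
  have "op_exp (osc_bracket lam (t, 0)) = id \<longleftrightarrow> t \<in> rot_periods lam" for t
    unfolding rot_periods_def fun_eq_iff by (auto simp: op_exp_osc_bracket_T)
  then show ?thesis unfolding Lambda'_def by simp
qed

lemma rot_periods_iff: "t \<in> rot_periods lam \<longleftrightarrow> (\<forall>k. \<exists>j::int. lam $ k * t = 2 * pi * j)"
proof
  assume t: "t \<in> rot_periods lam"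
  show "\<forall>k. \<exists>j::int. lam $ k * t = 2 * pi * j"
  proof
    fix k
    have "rot lam t (0, axis k 1, 0) = (0, axis k 1, 0)" using t by (simp add: rot_periods_def)
    then have "fst (snd (rot lam t (0, axis k 1, 0))) $ k = axis k 1 $ k" by simp
    then have "cos (lam $ k * t) = 1" by (simp add: rot_def axis_def)
    then show "\<exists>j::int. lam $ k * t = 2 * pi * j" by (auto simp: cos_one_2pi_int mult.commute)
  qed
next
  assume *: "\<forall>k. \<exists>j::int. lam $ k * t = 2 * pi * j"
  have "cos (lam $ k * t) = 1 \<and> sin (lam $ k * t) = 0" for k
  proof -
    obtain j :: int where "lam $ k * t = 2 * pi * j" using * by blast
    then have "lam $ k * t = of_int j * 2 * pi" by simp
    then have "cos (lam $ k * t) = 1" unfolding cos_one_2pi_int by blast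
    then show ?thesis using cos_one_sin_zero by blast
  qed
  then show "t \<in> rot_periods lam" by (simp add: rot_periods_def rot_def fun_eq_iff split_beta)
qed

lemma rot_periods_group:
  "0 \<in> rot_periods lam"
  "s \<in> rot_periods lam \<Longrightarrow> t \<in> rot_periods lam \<Longrightarrow> s + t \<in> rot_periods lam"
  "t \<in> rot_periods lam \<Longrightarrow> - t \<in> rot_periods lam"
  "t \<in> rot_periods lam \<Longrightarrow> of_int j * t \<in> rot_periods lam"
proof -
  show "0 \<in> rot_periods lam" by (auto simp: rot_periods_iff intro: exI[of _ 0])
  show *: "of_int j * t \<in> rot_periods lam" if t: "t \<in> rot_periods lam" for t j
    unfolding rot_periods_iff
  proof
    fix k
    obtain i :: int where "lam $ k * t = 2 * pi * i" using t[unfolded rot_periods_iff] by blast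
    then show "\<exists>i::int. lam $ k * (of_int j * t) = 2 * pi * i"
      by (intro exI[of _ "j * i"]) (simp add: algebra_simps)
  qed
  show "- t \<in> rot_periods lam" if "t \<in> rot_periods lam" using *[OF that, of "-1"] by simp
  show "s + t \<in> rot_periods lam" if st: "s \<in> rot_periods lam" "t \<in> rot_periods lam"
    unfolding rot_periods_iff
  proof
    fix k
    obtain i j :: int where "lam $ k * s = 2 * pi * i" "lam $ k * t = 2 * pi * j"
      using st[unfolded rot_periods_iff] by blast
    then show "\<exists>i::int. lam $ k * (s + t) = 2 * pi * i"
      by (intro exI[of _ "i + j"]) (simp add: algebra_simps)
  qed
qed

lemma rot_periods_discrete:
  assumes "\<And>k. 0 < lam $ k"
  obtains e where "e > 0" "\<And>t. t \<in> rot_periods lam \<Longrightarrow> \<bar>t\<bar> < e \<Longrightarrow> t = 0"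
proof
  let ?l = "lam $ undefined"
  show "2 * pi / ?l > 0" using assms by simp
  fix t assume "t \<in> rot_periods lam" and less: "\<bar>t\<bar> < 2 * pi / ?l"
  then obtain j :: int where j: "?l * t = 2 * pi * j" using rot_periods_iff by blast
  have "\<bar>?l * t\<bar> < 2 * pi" using less assms[of undefined] by (simp add: abs_mult field_simps)
  then have "\<bar>real_of_int j\<bar> < 1" unfolding j by (simp add: abs_mult)
  then have "j = 0" by linarith
  then show "t = 0" using j assms[of undefined] by simp
qed

text \<open>Here rationality enters: a common denominator of the frequencies, times \<open>2 \<pi>\<close>, is a period.\<close>

lemma rot_periods_nontrivial:
  assumes "\<And>k. lam $ k \<in> \<rat>"
  obtains t where "t > 0" "t \<in> rot_periods lam"
proof -
  have "\<exists>q::int. 0 < q \<and> (\<exists>p::int. lam $ k * of_int q = of_int p)" for k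
  proof -
    obtain p q :: int where "q > 0" "lam $ k = of_int p / of_int q"
      using assms[of k] by (rule Rats_cases') 
    then show ?thesis by (intro exI[of _ q]) auto
  qed
  then obtain q :: "'a \<Rightarrow> int"
    where q: "\<And>k. 0 < q k" "\<And>k. \<exists>p::int. lam $ k * of_int (q k) = of_int p"
    by metis
  let ?Q = "\<Prod>k\<in>UNIV. q k"
  show ?thesis
  proof (rule that[of "2 * pi * ?Q"])
    show "2 * pi * ?Q > 0" using q(1) by (simp add: prod_pos del: of_int_prod)
    show "2 * pi * ?Q \<in> rot_periods lam"
      unfolding rot_periods_iff
    proof
      fix k
      obtain p :: int where p: "lam $ k * of_int (q k) = of_int p" using q(2) by blast
      have "?Q = q k * (\<Prod>i\<in>UNIV - {k}. q i)" by (rule prod.remove) simp_all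
      then have "lam $ k * (2 * pi * ?Q) = 2 * pi * (lam $ k * q k) * (\<Prod>i\<in>UNIV - {k}. q i)"
        by (simp del: of_int_prod add: algebra_simps)
      then show "\<exists>j::int. lam $ k * (2 * pi * ?Q) = 2 * pi * j"
        unfolding p by (intro exI[of _ "p * (\<Prod>i\<in>UNIV - {k}. q i)"]) simp
    qed
  qed
qed

lemma osc_mult_period_left:
  "t \<in> rot_periods lam \<Longrightarrow> osc_mult lam (t, c, 0, 0) p = (t, c, 0, 0) + p"
  by (cases p) (simp add: osc_mult_def heis_mult_def rot_periods_def heis_form_simps flip: zero_prod_def)

lemma osc_mult_center_right:
  "osc_mult lam p (t, c, 0, 0) = (t, c, 0, 0) + p"
  by (cases p) (simp add: osc_mult_def heis_mult_def rot_center heis_form_simps add.commute flip: zero_prod_def)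

text \<open>Commuting with \<open>exp (s T)\<close> for \<open>s = \<pi> / lam\<^sub>k\<close>, which acts as \<open>-1\<close> on the plane of \<open>X\<^sub>k\<close> and
  \<open>Y\<^sub>k\<close>, removes the coordinates in that plane; commuting with the Heisenberg group then forces the
  rotation to be trivial. The hypothesis compares only the components in the Heisenberg group,
  because this is all that is known when the commutator lies in \<open>Lambda' lam\<close>.\<close>

lemma snd_osc_commute_imp_central:
  assumes pos: "\<And>k. 0 < lam $ k"
    and comm: "\<And>p. snd (osc_mult lam g p) = snd (osc_mult lam p g)"
  obtains t c where "g = (t, c, 0, 0)" "t \<in> rot_periods lam"
proof -
  obtain t c x y where g: "g = (t, c, x, y)" by (metis prod.exhaust)
  have rot: "rot lam s (c, x, y) = (c, x, y)" for s
    using comm[of "(s, 0)"]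
    by (simp add: g osc_mult_def heis_mult_def linear_0[OF linear_rot] heis_form_simps flip: zero_prod_def)
  have "x $ k = 0 \<and> y $ k = 0" for k
    using rot[of "pi / lam $ k"] pos[of k] by (auto simp: rot_def vec_eq_iff dest!: spec[of _ k])
  then have xy: "x = 0" "y = 0" by (simp_all add: vec_eq_iff)
  have "rot lam t w = w" for w
    using comm[of "(0, w)"]
    by (simp add: g xy osc_mult_def heis_mult_def rot_zero rot_center heis_form_simps add.commute flip: zero_prod_def)
  then have "t \<in> rot_periods lam" by (auto simp: rot_periods_def)
  then show ?thesis using that g xy by blast
qed

lemma mult_Osc_tilde: "x \<otimes>\<^bsub>Osc_tilde lam\<^esub> y = osc_mult lam x y"
  by (simp add: Osc_tilde_def osc_mult_def split_beta)

lemma covered_Osc_tilde: "covered_lie_group (Osc_tilde lam) (\<lambda>x. x) {0} (osc_mult lam) (osc_inv lam)"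
proof
  show "quotient_map euclidean (topo (Osc_tilde lam)) (\<lambda>x. x)"
    by (simp add: Osc_tilde_def quotient_map_def)
  show "\<exists>e>0. \<forall>n\<in>{0}. norm n < e \<longrightarrow> n = (0 :: 'a osc)" by (intro exI[of _ 1]) simp
  show "x \<otimes>\<^bsub>Osc_tilde lam\<^esub> y = osc_mult lam x y" for x y by (rule mult_Osc_tilde)
qed (auto simp: osc_mult_assoc osc_mult_zero_left osc_inv_left smooth_osc_mult
    smooth_osc_inv osc_mult_center_right[of lam _ 0 0, folded zero_prod_def], auto simp: Osc_tilde_def)

text \<open>One statement for the quotient by \<open>Lambda' lam\<close> (with \<open>C = {0}\<close>) and for the quotient by the product
  of \<open>Lambda' lam\<close> with a lattice in the centre of the Heisenberg group.\<close>

lemma covered_Osc_quot: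
  assumes pos: "\<And>k. 0 < lam $ k"
    and C: "0 \<in> C" "\<And>a b. a \<in> C \<Longrightarrow> b \<in> C \<Longrightarrow> a + b \<in> C" "\<And>a. a \<in> C \<Longrightarrow> - a \<in> C"
    and C_discrete: "\<exists>e>0. \<forall>c\<in>C. \<bar>c\<bar> < e \<longrightarrow> c = 0"
    and M: "M = {(t, c, 0, 0) | t c. t \<in> rot_periods lam \<and> c \<in> C}"
  shows "covered_lie_group (lie_quot (Osc_tilde lam) M) (\<lambda>x. M #>\<^bsub>Osc_tilde lam\<^esub> x) M
    (osc_mult lam) (osc_inv lam)"
proof (rule covered_lie_group_quot[OF covered_Osc_tilde])
  interpret covered_lie_group "Osc_tilde lam" "\<lambda>x. x" "{0}" "osc_mult lam" "osc_inv lam"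
    by (rule covered_Osc_tilde)
  have left: "osc_mult lam n x = n + x" if "n \<in> M" for n x
    using that osc_mult_period_left unfolding M by blast
  show "subgroup M (Osc_tilde lam)"
  proof (rule group.subgroupI[OF group_G])
    show "M \<subseteq> carrier (Osc_tilde lam)" by (simp add: Osc_tilde_def)
    show "M \<noteq> {}" unfolding M using C(1) rot_periods_group(1) by blast
    show "inv\<^bsub>Osc_tilde lam\<^esub> a \<in> M" if a: "a \<in> M" for a
    proof -
      have "osc_mult lam a (- a) = 0" using left[OF a] by simp
      then have "osc_inv lam a = - a"
        by (metis m_assoc m_inv_left m_zero_left m_zero_right)
      moreover have "- a \<in> M" using a rot_periods_group(3) C(3) unfolding M by fastforce
      ultimately show ?thesis using inv_proj by simp
    qed
    show "a \<otimes>\<^bsub>Osc_tilde lam\<^esub> b \<in> M" if "a \<in> M" "b \<in> M" for a b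
    proof -
      have "a + b \<in> M" using that rot_periods_group(2) C(2) unfolding M by fastforce
      then show ?thesis using mult_proj[of a b] left[OF that(1)] by simp
    qed
  qed
  obtain e1 where e1: "e1 > 0" "\<And>t. t \<in> rot_periods lam \<Longrightarrow> \<bar>t\<bar> < e1 \<Longrightarrow> t = 0"
    by (rule rot_periods_discrete[OF pos]) (rule that)
  obtain e2 where e2: "e2 > 0" "\<forall>c\<in>C. \<bar>c\<bar> < e2 \<longrightarrow> c = 0"
    using C_discrete by (elim exE conjE) (rule that)
  show "\<exists>e>0. \<forall>n\<in>M. norm n < e \<longrightarrow> n = 0"
  proof (intro exI[of _ "min e1 e2"] conjI ballI impI)
    fix n assume "n \<in> M" and less: "norm n < min e1 e2"
    then obtain t c where n: "n = (t, c, 0, 0)" "t \<in> rot_periods lam" "c \<in> C"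
      unfolding M by (elim CollectE exE conjE) (rule that)
    have "\<bar>t\<bar> \<le> norm n" "\<bar>c\<bar> \<le> norm n"
      using norm_fst_le[of t "(c, 0::real^'a, 0::real^'a)"] norm_snd_le[of "(c, 0::real^'a, 0::real^'a)" t]
        norm_fst_le[of c "(0::real^'a, 0::real^'a)"]
      unfolding n(1) real_norm_def by linarith+
    then have "t = 0" "c = 0" using less by (intro e1(2) n(2) e2(2)[rule_format] n(3); linarith)+
    then show "n = 0" by (simp add: n(1) zero_prod_def)
  qed (use e1 e2 in simp)
  show "osc_mult lam n x = n + x" "osc_mult lam x n = n + x" if n: "n \<in> M" for n x
  proof -
    show "osc_mult lam n x = n + x" by (rule left[OF n])
    obtain t c where "n = (t, c, 0, 0)" using n unfolding M by (elim CollectE exE conjE) (rule that)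
    then show "osc_mult lam x n = n + x" by (simp add: osc_mult_center_right)
  qed
qed simp

lemma covered_Osc_bar:
  assumes "\<And>k. 0 < lam $ k"
  shows "covered_lie_group (Osc_bar lam) (\<lambda>x. Lambda' lam #>\<^bsub>Osc_tilde lam\<^esub> x) (Lambda' lam)
    (osc_mult lam) (osc_inv lam)"
  unfolding Osc_bar_def
  by (rule covered_Osc_quot[OF assms, of "{0}"])
     (auto simp: Lambda'_eq zero_prod_def intro: exI[of _ 1])

text \<open>A commutator has no component along \<open>T\<close>, whereas the elements of \<open>Lambda' lam\<close> have no other
  component; so an element that is central modulo \<open>Lambda' lam\<close> is central in the covering group. Its
  component along \<open>T\<close> is then a period and can be removed.\<close>

lemma center_covered_by_Lambda':
  assumes pos: "\<And>k. 0 < lam $ k"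
    and "covered_lie_group G \<pi> (Lambda' lam) (osc_mult lam) (osc_inv lam)"
    and z: "z \<in> group_center G"
  obtains c where "z = \<pi> (0, c, 0, 0)"
proof -
  interpret covered_lie_group G \<pi> "Lambda' lam" "osc_mult lam" "osc_inv lam" by fact
  obtain g where g: "z = \<pi> g" using z range_proj unfolding group_center_def by blast
  have "snd (osc_mult lam g p) = snd (osc_mult lam p g)" for p
  proof -
    have "\<pi> g \<otimes>\<^bsub>G\<^esub> \<pi> p = \<pi> p \<otimes>\<^bsub>G\<^esub> \<pi> g"
      using z proj_in_carrier[of p] unfolding group_center_def g by blast
    then have "\<pi> (osc_mult lam g p) = \<pi> (osc_mult lam p g)" by (simp only: mult_proj)
    then have "osc_mult lam p g - osc_mult lam g p \<in> Lambda' lam" using proj_eq_iff by blast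
    moreover have "snd d = 0" if "d \<in> Lambda' lam" for d using that by (auto simp: Lambda'_eq)
    ultimately have "snd (osc_mult lam p g - osc_mult lam g p) = 0" by blast
    then show ?thesis by simp
  qed
  then obtain t c where tc: "g = (t, c, 0, 0)" "t \<in> rot_periods lam"
    by (rule snd_osc_commute_imp_central[OF pos]) (rule that)
  have "(t, 0) \<in> Lambda' lam" using tc(2) by (auto simp: Lambda'_eq)
  then have "\<pi> ((t, 0) + (0, c, 0, 0)) = \<pi> (0, c, 0, 0)" by (rule proj_add)
  then show ?thesis using that tc g by (simp add: zero_prod_def)
qed

text \<open>That \<open>cis\<close> is a quotient map follows from compactness: the complement of a set with open preimage is
  the image of a closed subset of \<open>[0, 2 \<pi>]\<close>.\<close>

lemma covered_circle: "covered_lie_group circle cis (range (\<lambda>k::int. 2 * pi * k)) (+) uminus"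
proof -
  have eq: "cis x = cis y \<longleftrightarrow> y - x \<in> range (\<lambda>k::int. 2 * pi * k)" for x y
  proof -
    have "cis x = cis y \<longleftrightarrow> sin y = sin x \<and> cos y = cos x" by (auto simp: complex_eq_iff)
    also have "\<dots> \<longleftrightarrow> (\<exists>k::int. y = x + 2 * pi * k)" by (rule sin_cos_eq_iff)
    finally show ?thesis by (auto simp: algebra_simps)
  qed
  have small: "k = 0" if "\<bar>2 * pi * real_of_int k\<bar> < 2 * pi" for k
  proof -
    have "\<bar>real_of_int k\<bar> < 1" using that by (simp add: abs_mult)
    then show ?thesis by linarith
  qed
  have inj: "inj_on cis {a<..<a + 2 * pi}" for a
  proof (rule inj_onI)
    fix x y assume xy: "x \<in> {a<..<a + 2 * pi}" "y \<in> {a<..<a + 2 * pi}" "cis x = cis y"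
    obtain k :: int where k: "y - x = 2 * pi * k" using xy(3) eq by blast
    then have "k = 0" using xy(1,2) by (intro small) auto
    then show "x = y" using k by simp
  qed
  have range: "range cis = sphere 0 1"
  proof
    show "sphere 0 1 \<subseteq> range cis"
    proof
      fix u :: complex assume "u \<in> sphere 0 1"
      then have "cis (Arg u) = u" by (subst cis_Arg) (auto simp: sgn_div_norm)
      then show "u \<in> range cis" by (metis rangeI)
    qed
  qed auto
  have surj: "cis ` {0..2 * pi} = sphere 0 1"
  proof -
    have "\<exists>y\<in>{0..2*pi}. cis x = cis y" for x
    proof (intro bexI)
      define k where "k = \<lfloor>x / (2 * pi)\<rfloor>"
      show "cis x = cis (x - 2 * pi * k)" unfolding eq by (auto intro: image_eqI[of _ _ "- k"])
      have "real_of_int k \<le> x / (2*pi)" "x / (2*pi) < real_of_int k + 1" unfolding k_def by linarith+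
      then show "x - 2 * pi * k \<in> {0..2*pi}" by (simp add: field_simps)
    qed
    then show ?thesis unfolding range[symmetric] by blast
  qed
  have quot: "quotient_map euclidean (top_of_set (sphere 0 1)) cis"
    unfolding quotient_map_def
  proof (intro conjI allI impI)
    fix V assume V: "V \<subseteq> topspace (top_of_set (sphere (0::complex) 1))"
    have cont: "continuous_on UNIV cis" by (intro continuous_intros)
    have vim: "{x \<in> topspace euclidean. cis x \<in> V} = cis -` V" by auto
    show "openin euclidean {x \<in> topspace euclidean. cis x \<in> V} \<longleftrightarrow> openin (top_of_set (sphere 0 1)) V"
    proof
      assume "openin euclidean {x \<in> topspace euclidean. cis x \<in> V}"
      then have "open (cis -` V)" unfolding vim by simp
      then have "compact ({0..2*pi} - cis -` V)" by (intro compact_diff) auto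
      then have "compact (cis ` ({0..2*pi} - cis -` V))"
        by (intro compact_continuous_image continuous_on_subset[OF cont]) auto
      moreover have "cis ` ({0..2*pi} - cis -` V) = sphere 0 1 - V"
        using surj by auto
      ultimately have "closed (sphere 0 1 - V)" by (simp add: compact_imp_closed)
      then have "openin (top_of_set (sphere 0 1)) (sphere 0 1 - (sphere 0 1 - V))"
        by (metis Diff_Compl Int_commute closed_def inf.idem openin_open Diff_eq double_complement)
      moreover have "sphere 0 1 - (sphere 0 1 - V) = V" using V by auto
      ultimately show "openin (top_of_set (sphere 0 1)) V" by simp
    next
      assume "openin (top_of_set (sphere 0 1)) V"
      then obtain T where T: "open T" "V = sphere 0 1 \<inter> T" by (auto simp: openin_open)
      then have "cis -` V = cis -` T" by auto
      then show "openin euclidean {x \<in> topspace euclidean. cis x \<in> V}"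
        unfolding vim using open_vimage[OF T(1) cont] by simp
    qed
  qed (simp add: range)
  show ?thesis
  proof
    show "range cis = carrier circle" by (simp add: circle_def range)
    show "cis x = cis y \<longleftrightarrow> y - x \<in> range (\<lambda>k::int. 2 * pi * k)" for x y by (rule eq)
    show "\<exists>e>0. \<forall>n\<in>range (\<lambda>k::int. 2 * pi * k). norm n < e \<longrightarrow> n = 0"
      using small by (intro exI[of _ "2 * pi"]) (auto simp: real_norm_def)
    show "quotient_map euclidean (topo circle) cis" using quot by (simp add: circle_def)
    show "open (f ` U)" if ch: "(U, f) \<in> atlas circle" for U f
    proof -
      obtain a where "U = cis ` {a<..<a + 2 * pi}" "f = inv_into {a<..<a + 2 * pi} cis"
        using ch by (auto simp: circle_def)
      then show ?thesis using inj by (simp add: inv_into_image_cancel)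
    qed
    show "cis (f u) = u" if "(U, f) \<in> atlas circle" "u \<in> U" for U f u
      using that by (auto simp: circle_def f_inv_into_f)
    show "\<exists>(U, f)\<in>atlas circle. u \<in> U" if u: "u \<in> carrier circle" for u
    proof -
      have "u \<in> range cis" using u range by (simp add: circle_def)
      then obtain t where t: "u = cis t" by (rule rangeE)
      have "t - pi < t \<and> t < t - pi + 2 * pi" using pi_gt_zero by linarith
      then have "u \<in> cis ` {t - pi<..<t - pi + 2 * pi}" using t by simp
      moreover have "(cis ` {t - pi<..<t - pi + 2 * pi}, inv_into {t - pi<..<t - pi + 2 * pi} cis) \<in> atlas circle"
        unfolding circle_def lie.simps by blast
      ultimately show ?thesis by blast
    qed
    show "smooth_on UNIV (\<lambda>p::real \<times> real. fst p + snd p)" "smooth_on UNIV (uminus :: real \<Rightarrow> real)"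
      unfolding smooth_on_def by (intro allI Ck_intros)+
  qed (auto simp: circle_def cis_mult)
qed

section \<open>The quotient by an irrational subgroup\<close>

text \<open>The subgroup generated by one element, given a formula for its powers.\<close>

lemma generate_int_hom:
  fixes h :: "int \<Rightarrow> 'a"
  assumes "group G" and carrier: "\<And>k. h k \<in> carrier G"
    and hom: "\<And>i j. h (i + j) = h i \<otimes>\<^bsub>G\<^esub> h j"
  shows "generate G {h 1} = range h"
proof
  interpret group G by fact
  have zero: "h 0 = \<one>\<^bsub>G\<^esub>" using hom[of 0 0] r_cancel_one[OF carrier carrier, of 0 0] by simp
  have minus: "inv\<^bsub>G\<^esub> (h k) = h (- k)" for k
    using hom[of "- k" k] zero by (intro inv_equality carrier) simp
  have "subgroup (range h) G"
  proof (rule subgroupI)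
    show "inv\<^bsub>G\<^esub> a \<in> range h" if "a \<in> range h" for a using that minus by auto
    show "a \<otimes>\<^bsub>G\<^esub> b \<in> range h" if "a \<in> range h" "b \<in> range h" for a b
      using that by (auto simp: hom[symmetric])
  qed (use carrier in auto)
  then show "generate G {h 1} \<subseteq> range h" by (intro generate_subgroup_incl) auto
  have sub: "subgroup (generate G {h 1}) G" using carrier by (intro generate_is_subgroup) auto
  have nat: "h (int n) \<in> generate G {h 1}" for n
  proof (induction n)
    case 0
    then show ?case using zero subgroup.one_closed[OF sub] by simp
  next
    case (Suc n)
    have "h (int (Suc n)) = h 1 \<otimes>\<^bsub>G\<^esub> h (int n)" using hom[of 1 "int n"] by simp
    then show ?case using Suc subgroup.m_closed[OF sub] generate.incl[of "h 1" "{h 1}" G] by simp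
  qed
  show "range h \<subseteq> generate G {h 1}"
  proof (rule image_subsetI)
    fix k
    show "h k \<in> generate G {h 1}"
    proof (cases k)
      case (nonneg n)
      then show ?thesis using nat by simp
    next
      case (neg n)
      then show ?thesis using minus[of "int (Suc n)"] nat[of "Suc n"] subgroup.m_inv_closed[OF sub] by metis
    qed
  qed
qed

text \<open>The direct product of the simply connected oscillator group with the real line, which covers
  \<open>G'\<close>.\<close>

definition oscR_mult :: "real^'d \<Rightarrow> 'd osc \<times> real \<Rightarrow> 'd osc \<times> real \<Rightarrow> 'd osc \<times> real" where
  "oscR_mult lam p q = (osc_mult lam (fst p) (fst q), snd p + snd q)"

definition oscR_inv :: "real^'d \<Rightarrow> 'd osc \<times> real \<Rightarrow> 'd osc \<times> real" where
  "oscR_inv lam = map_prod (osc_inv lam) uminus"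

text \<open>The kernel of the covering of \<open>G'\<close>: it is generated by the periods along \<open>T\<close>, by the vector
  \<open>(c Z, \<phi>)\<close> that covers the generator of \<open>Gamma_sub\<close>, and by \<open>2 \<pi>\<close> in the last coordinate.\<close>

definition irr_lattice :: "real^'d \<Rightarrow> real \<Rightarrow> real \<Rightarrow> ('d osc \<times> real) set" where
  "irr_lattice lam c \<phi> =
     {((t, of_int n * c, 0, 0), of_int n * \<phi> + 2 * pi * of_int k) | t n k. t \<in> rot_periods lam}"

text \<open>By the description of the centre, every non-trivial central element of \<open>Osc_bar lam\<close> has the form
  required of \<open>z\<close>.\<close>

locale irrational_quotient =
  fixes lam :: "real^'d" and c \<phi> :: real and z :: "'d osc set"
  assumes rational: "\<And>k. lam $ k \<in> \<rat>" and pos: "\<And>k. 0 < lam $ k"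
    and c_nonzero: "c \<noteq> 0" and irrational: "\<phi> / pi \<notin> \<rat>"
    and z_eq: "z = Lambda' lam #>\<^bsub>Osc_tilde lam\<^esub> (0, c, 0, 0)"
begin

abbreviation "proj_P \<equiv> map_prod (\<lambda>x. Lambda' lam #>\<^bsub>Osc_tilde lam\<^esub> x) cis"

abbreviation "P \<equiv> lie_prod (Osc_bar lam) circle"

sublocale P: covered_lie_group P proj_P "Lambda' lam \<times> range (\<lambda>k::int. 2 * pi * k)"
  "oscR_mult lam" "oscR_inv lam"
  unfolding oscR_mult_def[abs_def] oscR_inv_def
  by (rule covered_lie_group_prod[OF covered_Osc_bar[OF pos] covered_circle])

lemma oscR_mult_center_right: "oscR_mult lam x ((t, a, 0, 0), s) = ((t, a, 0, 0), s) + x"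
  by (simp add: oscR_mult_def osc_mult_center_right prod_eq_iff)

lemma oscR_mult_period_left:
  "t \<in> rot_periods lam \<Longrightarrow> oscR_mult lam ((t, a, 0, 0), s) x = ((t, a, 0, 0), s) + x"
  by (simp add: oscR_mult_def osc_mult_period_left prod_eq_iff)

lemma Gamma_sub_eq: "Gamma_sub lam z \<phi> = range (\<lambda>n::int. proj_P ((0, n * c, 0, 0), n * \<phi>))"
proof -
  let ?h = "\<lambda>n::int. proj_P ((0, n * c, 0, 0), n * \<phi>)"
  have "generate P {?h 1} = range ?h"
  proof (rule generate_int_hom[OF P.group_G])
    show "?h k \<in> carrier P" for k by (rule P.proj_in_carrier)
    show "?h (i + j) = ?h i \<otimes>\<^bsub>P\<^esub> ?h j" for i j
      unfolding P.mult_proj oscR_mult_center_right by (simp add: algebra_simps)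
  qed
  then show ?thesis by (simp add: Gamma_sub_def z_eq)
qed

lemma proj_P_in_Gamma_iff: "x \<in> irr_lattice lam c \<phi> \<longleftrightarrow> proj_P x \<in> Gamma_sub lam z \<phi>"
proof -
  have "proj_P x \<in> Gamma_sub lam z \<phi> \<longleftrightarrow>
      (\<exists>n::int. x - ((0, n * c, 0, 0), n * \<phi>) \<in> Lambda' lam \<times> range (\<lambda>k::int. 2 * pi * k))"
    unfolding Gamma_sub_eq image_iff P.proj_eq_iff[symmetric] by (simp only: bex_UNIV eq_commute[of "proj_P x"])
  also have "\<dots> \<longleftrightarrow> x \<in> irr_lattice lam c \<phi>"
  proof
    assume "\<exists>n::int. x - ((0, n * c, 0, 0), n * \<phi>) \<in> Lambda' lam \<times> range (\<lambda>k::int. 2 * pi * k)"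
    then obtain n :: int where
      "x - ((0, n * c, 0, 0), n * \<phi>) \<in> Lambda' lam \<times> range (\<lambda>k::int. 2 * pi * k)" by (rule exE)
    then obtain d e where d: "d \<in> Lambda' lam" "e \<in> range (\<lambda>k::int. 2 * pi * k)"
      "x - ((0, n * c, 0, 0), n * \<phi>) = (d, e)" by (rule SigmaE)
    obtain k :: int where "e = 2 * pi * k" using d(2) by (rule rangeE)
    moreover obtain t where "d = (t, 0)" "t \<in> rot_periods lam" using d(1) by (auto simp: Lambda'_eq)
    ultimately have *: "x - ((0, n * c, 0, 0), n * \<phi>) = ((t, 0), 2 * pi * k)" "t \<in> rot_periods lam"
      using d(3) by simp_all
    have "x = ((t, 0), 2 * pi * k) + ((0, n * c, 0, 0), n * \<phi>)" using *(1) by (metis diff_add_cancel)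
    then have "x = ((t, n * c, 0, 0), n * \<phi> + 2 * pi * k)" by (simp add: zero_prod_def)
    then show "x \<in> irr_lattice lam c \<phi>" using *(2) unfolding irr_lattice_def by blast
  next
    assume "x \<in> irr_lattice lam c \<phi>"
    then obtain n :: int and t and k :: int where
      *: "x = ((t, n * c, 0, 0), n * \<phi> + 2 * pi * k)" "t \<in> rot_periods lam"
      unfolding irr_lattice_def by blast
    have "x - ((0, n * c, 0, 0), n * \<phi>) = ((t, 0), 2 * pi * k)" by (simp add: *(1) zero_prod_def)
    then show "\<exists>n::int. x - ((0, n * c, 0, 0), n * \<phi>) \<in> Lambda' lam \<times> range (\<lambda>k::int. 2 * pi * k)"
      using *(2) by (intro exI[of _ n]) (simp add: Lambda'_eq)
  qed
  finally show ?thesis by simp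
qed

lemma irr_lattice_discrete: "\<exists>e>0. \<forall>n\<in>irr_lattice lam c \<phi>. norm n < e \<longrightarrow> n = 0"
proof -
  obtain e where e: "e > 0" "\<And>t. t \<in> rot_periods lam \<Longrightarrow> \<bar>t\<bar> < e \<Longrightarrow> t = 0"
    by (rule rot_periods_discrete[OF pos]) (rule that)
  show ?thesis
  proof (intro exI[of _ "min e (min \<bar>c\<bar> (2 * pi))"] conjI ballI impI)
    fix x assume "x \<in> irr_lattice lam c \<phi>" and less: "norm x < min e (min \<bar>c\<bar> (2 * pi))"
    then obtain n :: int and t and k :: int where
      x: "x = ((t, n * c, 0, 0), n * \<phi> + 2 * pi * k)" "t \<in> rot_periods lam"
      unfolding irr_lattice_def by blast
    have 1: "norm (fst x) \<le> norm x" "\<bar>snd x\<bar> \<le> norm x"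
      using norm_fst_le[of "fst x" "snd x"] norm_snd_le[of "snd x" "fst x"] by (simp_all add: real_norm_def)
    have 2: "\<bar>t\<bar> \<le> norm (fst x)" "norm (snd (fst x)) \<le> norm (fst x)"
      using norm_fst_le[of t "(of_int n * c, 0, 0)"] norm_snd_le[of "(of_int n * c, 0, 0)" t]
      by (simp_all add: x(1))
    have 3: "\<bar>n * c\<bar> \<le> norm (snd (fst x))"
      using norm_fst_le[of "of_int n * c" "(0, 0)"] by (simp add: x(1))
    have "t = 0" using 1 2 less by (intro e(2) x(2)) simp
    moreover have "n = 0"
    proof -
      have "\<bar>n * c\<bar> < 1 * \<bar>c\<bar>" using 1 2 3 less by simp
      then have "\<bar>real_of_int n\<bar> < 1" using c_nonzero by (simp add: abs_mult)
      then show ?thesis by linarith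
    qed
    moreover have "k = 0"
    proof -
      have "\<bar>2 * pi * k\<bar> < 2 * pi" using 1(2) less \<open>n = 0\<close> by (simp add: x(1))
      then have "\<bar>real_of_int k\<bar> < 1" by (simp add: abs_mult)
      then show ?thesis by linarith
    qed
    ultimately show "x = 0" by (simp add: x(1) zero_prod_def)
  qed (use e c_nonzero in simp)
qed

lemma irr_lattice_translation:
  assumes "n \<in> irr_lattice lam c \<phi>"
  shows "oscR_mult lam n x = n + x" "oscR_mult lam x n = n + x"
  using assms oscR_mult_center_right oscR_mult_period_left unfolding irr_lattice_def by blast+

lemma G'_proj_eq: "G'_proj lam z \<phi> = (\<lambda>x. Gamma_sub lam z \<phi> #>\<^bsub>P\<^esub> proj_P x)"
  by (simp add: G'_proj_def fun_eq_iff split_beta)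

sublocale Q: covered_lie_group "G' lam z \<phi>" "G'_proj lam z \<phi>" "irr_lattice lam c \<phi>"
  "oscR_mult lam" "oscR_inv lam"
  unfolding G'_def G'_proj_eq
proof (rule covered_lie_group_quot[OF P.covered_lie_group_axioms])
  show "subgroup (Gamma_sub lam z \<phi>) P"
    unfolding Gamma_sub_def z_eq using P.proj_in_carrier[of "((0, c, 0, 0), \<phi>)"]
    by (intro group.generate_is_subgroup[OF P.group_G]) simp
qed (auto simp: proj_P_in_Gamma_iff irr_lattice_discrete irr_lattice_translation)

lemma Gamma_central: "Gamma_sub lam z \<phi> \<subseteq> group_center P"
proof
  fix a assume a: "a \<in> Gamma_sub lam z \<phi>"
  then obtain n :: "'d osc \<times> real" where n: "a = proj_P n" unfolding Gamma_sub_eq by (rule rangeE)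
  then have n': "n \<in> irr_lattice lam c \<phi>" using a proj_P_in_Gamma_iff by simp
  show "a \<in> group_center P"
    unfolding group_center_def
  proof (intro CollectI conjI ballI)
    show "a \<in> carrier P" unfolding n by (rule P.proj_in_carrier)
    fix b assume "b \<in> carrier P"
    then have "b \<in> range proj_P" by (simp only: P.range_proj)
    then obtain x where "b = proj_P x" by (rule rangeE)
    then show "a \<otimes>\<^bsub>P\<^esub> b = b \<otimes>\<^bsub>P\<^esub> a"
      unfolding n by (simp only: P.mult_proj irr_lattice_translation[OF n'])
  qed
qed

lemma Gamma_discrete:
  "subtopology (topo P) (Gamma_sub lam z \<phi>) = discrete_topology (Gamma_sub lam z \<phi>)"
proof -
  let ?\<Gamma> = "Gamma_sub lam z \<phi>"
  obtain e where e: "e > 0" "\<And>n. n \<in> irr_lattice lam c \<phi> \<Longrightarrow> norm n < e \<Longrightarrow> n = 0"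
    using irr_lattice_discrete by auto
  have sub: "?\<Gamma> \<subseteq> topspace (topo P)"
    using Gamma_central P.topspace_topo unfolding group_center_def by blast
  have "openin (subtopology (topo P) ?\<Gamma>) {a}" if a: "a \<in> ?\<Gamma>" for a
  proof -
    obtain n :: "'d osc \<times> real" where n: "a = proj_P n" using a unfolding Gamma_sub_eq by (rule rangeE)
    then have n': "n \<in> irr_lattice lam c \<phi>" using a proj_P_in_Gamma_iff by simp
    have only: "b = a" if b: "b \<in> ?\<Gamma>" "b \<in> proj_P ` ball n e" for b
    proof -
      obtain x where x: "b = proj_P x" "x \<in> ball n e" using b(2) by (rule imageE)
      then have "x \<in> irr_lattice lam c \<phi>" using b(1) proj_P_in_Gamma_iff by simp
      then have "x - n \<in> irr_lattice lam c \<phi>"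
        using Q.add_in_N[OF _ Q.uminus_in_N[OF n'], of x] by simp
      moreover have "norm (x - n) < e" using x(2) by (simp add: dist_norm norm_minus_commute)
      ultimately have "x = n" using e(2) by fastforce
      then show ?thesis using x n by simp
    qed
    have "a \<in> proj_P ` ball n e" unfolding n using e(1) by (intro imageI) simp
    then have "{a} \<subseteq> proj_P ` ball n e \<inter> ?\<Gamma>" using a by simp
    moreover have "proj_P ` ball n e \<inter> ?\<Gamma> \<subseteq> {a}"
    proof
      fix b assume "b \<in> proj_P ` ball n e \<inter> ?\<Gamma>"
      then show "b \<in> {a}" using only[of b] by simp
    qed
    ultimately have "{a} = proj_P ` ball n e \<inter> ?\<Gamma>" by (rule equalityI)
    then show ?thesis
      unfolding openin_subtopology
      by (intro exI[of _ "proj_P ` ball n e"] conjI P.openin_image[OF open_ball])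
  qed
  then have "discrete_topology ?\<Gamma> = subtopology (topo P) ?\<Gamma>"
    unfolding discrete_topology_unique using sub by (simp add: inf_absorb2)
  then show ?thesis by simp
qed

text \<open>The coordinates along the planes of \<open>X\<^sub>k\<close> and \<open>Y\<^sub>k\<close> do not change under the lattice, so they are
  continuous functions on \<open>G'\<close>, and they are unbounded.\<close>

lemma G'_not_compact: "\<not> compact_space (topo (G' lam z \<phi>))"
proof
  assume compact: "compact_space (topo (G' lam z \<phi>))"
  define h :: "'d osc \<times> real \<Rightarrow> (real^'d) \<times> (real^'d)" where "h = (\<lambda>x. snd (snd (fst x)))"
  have h_cont: "continuous_map euclidean euclidean h" unfolding h_def by (simp add: continuous_intros)
  have h_eq: "h x = h y" if "G'_proj lam z \<phi> x = G'_proj lam z \<phi> y" for x y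
  proof -
    have "y - x \<in> irr_lattice lam c \<phi>" using that Q.proj_eq_iff by blast
    moreover have "h d = 0" if "d \<in> irr_lattice lam c \<phi>" for d
      using that by (auto simp: irr_lattice_def h_def zero_prod_def)
    ultimately have "h (y - x) = 0" by simp
    then show ?thesis by (simp add: h_def)
  qed
  obtain g where g: "continuous_map (topo (G' lam z \<phi>)) euclidean g"
    "g ` topspace (topo (G' lam z \<phi>)) = h ` topspace euclidean"
    by (rule quotient_map_lift_exists[OF Q.quotient_map_proj h_cont h_eq]) (assumption, rule that)
  have "compactin euclidean (g ` topspace (topo (G' lam z \<phi>)))"
    using compact g(1) by (intro image_compactin[OF _ g(1)]) (simp add: compact_space_def)
  moreover have "range h = UNIV"
    by (rule surjI[of _ "\<lambda>w. ((0, 0, w), 0)"]) (simp add: h_def)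
  ultimately have "compact (UNIV :: ((real^'d) \<times> (real^'d)) set)" using g(2) by simp
  then show False using compact_imp_bounded not_bounded_UNIV by blast
qed

end

lemma has_vector_derivative_vec:
  assumes "\<And>k. ((\<lambda>t. f t k) has_real_derivative f' k) (at t)"
  shows "((\<lambda>t. (\<chi> k. f t k) :: real^'n) has_vector_derivative (\<chi> k. f' k)) (at t)"
proof -
  have *: "(\<chi> k. a k) = (\<Sum>k\<in>UNIV. a k *\<^sub>R (axis k 1 :: real^'n))" for a :: "'n \<Rightarrow> real"
    by (simp add: vec_eq_iff axis_def if_distrib cong: if_cong)
  show ?thesis unfolding *
    by (intro has_vector_derivative_sum) (auto intro!: derivative_eq_intros assms)
qed

lemma rot_has_vector_derivative:
  "((\<lambda>t. rot lam t v) has_vector_derivative ad_T lam v) (at 0)"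
  unfolding rot_def ad_T_def split_beta
  by (intro has_vector_derivative_Pair has_vector_derivative_const has_vector_derivative_vec)
     (auto intro!: derivative_eq_intros)

context irrational_quotient
begin

lemma has_lie_algebra_G': "has_lie_algebra (G' lam z \<phi>) (g'_bracket lam) (G'_proj lam z \<phi>)"
proof -
  define L :: "'d osc \<times> real \<Rightarrow> 'd osc \<times> real \<Rightarrow> 'd osc \<times> real" where
    "L x v = ((fst (fst v), rot lam (fst (fst x)) (snd (fst v)) +
      (heis_form lam (snd (fst x)) (rot lam (fst (fst x)) (snd (fst v))) / 2, 0, 0)), snd v)" for x v
  define B :: "'d osc \<times> real \<Rightarrow> 'd osc \<times> real \<Rightarrow> 'd osc \<times> real" where
    "B v u = ((0, fst (fst u) *\<^sub>R ad_T lam (snd (fst v)) +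
      (heis_form lam (snd (fst u)) (snd (fst v)) / 2, 0, 0)), 0)" for v u
  show ?thesis
  proof (rule Q.has_lie_algebra_proj)
    show "(oscR_mult lam x has_derivative L x) (at 0)" for x
    proof -
      have "linear (L x)"
        by (rule linearI) (simp_all add: L_def linear_add[OF linear_rot] linear_cmul[OF linear_rot]
            heis_form_simps add_divide_distrib scaleR_add_right)
      then have "(L x has_derivative L x) (at 0)" by (rule linear_imp_has_derivative)
      then have "((\<lambda>y. x + L x y) has_derivative L x) (at 0)" by (auto intro!: derivative_eq_intros)
      moreover have "oscR_mult lam x = (\<lambda>y. x + L x y)"
        by (simp add: fun_eq_iff oscR_mult_def osc_mult_def heis_mult_def L_def prod_eq_iff)
      ultimately show ?thesis by simp
    qed
    show "((\<lambda>x. L x v) has_derivative B v) (at 0)" for v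
    proof -
      let ?w = "snd (fst v)"
      have rot: "((\<lambda>t. rot lam t ?w) has_derivative (\<lambda>t. t *\<^sub>R ad_T lam ?w)) (at 0)"
        using rot_has_vector_derivative by (simp add: has_vector_derivative_def)
      have rot': "((\<lambda>x::'d osc \<times> real. rot lam (fst (fst x)) ?w) has_derivative
          (\<lambda>u. fst (fst u) *\<^sub>R ad_T lam ?w)) (at 0)"
        by (rule has_derivative_compose[of "\<lambda>x. fst (fst x)" "\<lambda>u. fst (fst u)" 0 UNIV "\<lambda>t. rot lam t ?w"])
           (auto intro!: derivative_eq_intros simp: rot)
      have "bounded_linear (\<lambda>x::'d osc \<times> real. ad_T lam (snd (fst x)))"
        by (rule bounded_linear_compose[OF linear_ad_T[of lam, unfolded linear_conv_bounded_linear]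
              bounded_linear_snd_comp[OF bounded_linear_fst]])
      then have ad: "((\<lambda>x::'d osc \<times> real. ad_T lam (snd (fst x))) has_derivative
          (\<lambda>u. ad_T lam (snd (fst u)))) (at 0)" by (rule bounded_linear_imp_has_derivative)
      have "((\<lambda>x. heis_form lam (snd (fst x)) (rot lam (fst (fst x)) ?w)) has_derivative
          (\<lambda>u. heis_form lam (snd (fst u)) ?w)) (at (0::'d osc \<times> real))"
        unfolding heis_form_inner
        using has_derivative_inner[OF ad rot'] by (simp add: linear_0[OF linear_ad_T] rot_zero)
      then have "((\<lambda>x. heis_form lam (snd (fst x)) (rot lam (fst (fst x)) ?w) / 2) has_derivative
          (\<lambda>u. heis_form lam (snd (fst u)) ?w / 2)) (at (0::'d osc \<times> real))"
        by (auto intro!: derivative_eq_intros)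
      then show ?thesis
        unfolding L_def B_def
        by (intro has_derivative_Pair has_derivative_add has_derivative_const rot')
    qed
    show "g'_bracket lam X Y = B Y X - B X Y" for X Y
    proof -
      have "heis_form lam (snd (fst Y)) (snd (fst X)) = - heis_form lam (snd (fst X)) (snd (fst Y))"
        by (rule heis_form_antisym)
      then show ?thesis
        by (simp add: g'_bracket_def osc_bracket_def split_beta B_def prod_eq_iff field_simps)
    qed
  qed
qed

lemma continuous_on_oscR_mult:
  assumes "continuous_on UNIV f" and "continuous_on UNIV h"
  shows "continuous_on UNIV (\<lambda>x. oscR_mult lam (f x) (h x))"
proof -
  have "continuous_on UNIV (\<lambda>p. oscR_mult lam (fst p) (snd p))"
    using Q.smooth_m[unfolded smooth_on_def, rule_format, of 0] by simp
  from continuous_on_compose2[OF this continuous_on_Pair[OF assms]] show ?thesis by simp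
qed

lemma one_param_nilpotent: "lie_exp (G' lam z \<phi>) (G'_proj lam z \<phi>) ((0, v), s) = G'_proj lam z \<phi> ((0, v), s)"
proof -
  have "lie_exp (G' lam z \<phi>) (G'_proj lam z \<phi>) (1 *\<^sub>R ((0, v), s)) = G'_proj lam z \<phi> (1 *\<^sub>R ((0, v), s))"
  proof (rule Q.lie_exp_scaleR)
    show "(r + u) *\<^sub>R ((0, v), s) = oscR_mult lam (r *\<^sub>R ((0, v), s)) (u *\<^sub>R ((0, v), s))" for r u
      by (simp add: oscR_mult_def osc_mult_def heis_mult_def rot_zero heis_form_simps
          scaleR_add_left distrib_right flip: zero_prod_def)
    show "((\<lambda>r. r *\<^sub>R ((0, v), s)) has_vector_derivative ((0, v), s)) (at 0)"
      by (auto intro!: derivative_eq_intros)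
  qed (intro continuous_intros)
  then show ?thesis by simp
qed

text \<open>A vector with non-zero component \<open>t T\<close> is conjugate, by an element \<open>g\<close> of the Heisenberg group, to
  a vector in the span of \<open>T\<close>, \<open>Z\<close> and the last coordinate: conjugation changes \<open>t T\<close> by
  \<open>- t ad T g\<close> to first order, and \<open>ad T\<close> is invertible on the planes of \<open>X\<^sub>k\<close> and \<open>Y\<^sub>k\<close>. The number
  \<open>a\<close> corrects the \<open>Z\<close>-coordinate by the second-order term of the conjugation.\<close>

lemma one_param_elliptic:
  assumes t: "t \<noteq> 0"
  obtains g a where
    "\<And>r. lie_exp (G' lam z \<phi>) (G'_proj lam z \<phi>) (r *\<^sub>R ((t, v), s)) =
      G'_proj lam z \<phi> (oscR_mult lam (oscR_mult lam ((0, g), 0) ((r * t, r * a, 0, 0), r * s)) ((0, - g), 0))"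
proof -
  define g :: "'d heis" where
    "g = (0, (\<chi> k. - snd (snd v) $ k / (lam $ k * t)), (\<chi> k. fst (snd v) $ k / (lam $ k * t)))"
  define a where "a = fst v + heis_form lam g (t *\<^sub>R ad_T lam g) / 2"
  define cu where "cu r = oscR_mult lam (oscR_mult lam ((0, g), 0) ((r * t, r * a, 0, 0), r * s)) ((0, - g), 0)" for r
  \<comment> \<open>The choice of \<open>g\<close> solves this equation for the coordinates in the planes.\<close>
  have ad: "- (t *\<^sub>R ad_T lam g) = (0, snd v)"
    using t pos by (simp add: g_def ad_T_def vec_eq_iff prod_eq_iff less_imp_neq[symmetric])
  have cu: "cu r = ((r * t, g + (r * a, 0, 0) - rot lam (r * t) g - (heis_form lam g (rot lam (r * t) g) / 2, 0, 0)), r * s)" for r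
    by (simp add: cu_def oscR_mult_def osc_mult_def heis_mult_def rot_zero rot_center
        linear_neg[OF linear_rot] heis_form_simps)
  have rot: "((\<lambda>r. rot lam (r * t) g) has_vector_derivative t *\<^sub>R ad_T lam g) (at 0)"
  proof -
    have "((\<lambda>r. r * t) has_vector_derivative t) (at 0)" by (auto intro!: derivative_eq_intros)
    then have "((\<lambda>r. rot lam r g) \<circ> (\<lambda>r. r * t) has_vector_derivative t *\<^sub>R ad_T lam g) (at 0)"
      by (rule vector_diff_chain_at) (simp only: mult_zero_left rot_has_vector_derivative)
    then show ?thesis by (simp only: comp_def)
  qed
  have "((\<lambda>r. heis_form lam g (rot lam (r * t) g)) has_vector_derivative heis_form lam g (t *\<^sub>R ad_T lam g)) (at 0)"
    unfolding heis_form_inner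
    by (rule bounded_linear.has_vector_derivative[OF bounded_linear_inner_right rot])
  then have form: "((\<lambda>r. heis_form lam g (rot lam (r * t) g) / 2) has_vector_derivative
      heis_form lam g (t *\<^sub>R ad_T lam g) / 2) (at 0)"
    by (auto intro!: derivative_eq_intros)
  have deriv: "(cu has_vector_derivative ((t, v), s)) (at 0)"
  proof -
    have "(cu has_vector_derivative
        ((t, 0 + (a, 0, 0) - t *\<^sub>R ad_T lam g - (heis_form lam g (t *\<^sub>R ad_T lam g) / 2, 0, 0)), s)) (at 0)"
      unfolding cu[abs_def]
      by (intro has_vector_derivative_Pair has_vector_derivative_diff has_vector_derivative_add
          has_vector_derivative_const rot form) (auto intro!: derivative_eq_intros)
    moreover have "0 + (a, 0, 0) - t *\<^sub>R ad_T lam g - (heis_form lam g (t *\<^sub>R ad_T lam g) / 2, 0, 0) = v"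
    proof -
      have "(a, 0, 0) + - (t *\<^sub>R ad_T lam g) - (heis_form lam g (t *\<^sub>R ad_T lam g) / 2, 0, 0) = v"
        unfolding ad by (simp add: a_def prod_eq_iff)
      then show ?thesis by simp
    qed
    ultimately show ?thesis by simp
  qed
  have inv: "oscR_mult lam ((0, - g), 0) ((0, g), 0) = 0"
    by (simp add: oscR_mult_def osc_mult_def heis_mult_def rot_zero heis_form_simps flip: zero_prod_def)
  have hom: "cu (r + u) = oscR_mult lam (cu r) (cu u)" for r u
  proof -
    have "oscR_mult lam ((r * t, r * a, 0, 0), r * s) ((u * t, u * a, 0, 0), u * s) =
        (((r + u) * t, (r + u) * a, 0, 0), (r + u) * s)"
      unfolding oscR_mult_center_right by (simp add: algebra_simps)
    then show ?thesis
      unfolding cu_def Q.m_assoc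
      by (metis Q.m_assoc inv Q.m_zero_left)
  qed
  have cont: "continuous_on UNIV cu"
    unfolding cu_def by (intro continuous_on_oscR_mult continuous_intros)
  show ?thesis
    by (rule that[of g a]) (rule Q.lie_exp_scaleR[OF hom deriv cont, unfolded cu_def])
qed

end

section \<open>Precompact one-parameter groups and the invariant form\<close>

context irrational_quotient
begin

text \<open>On the span of \<open>T\<close>, \<open>Z\<close> and the last coordinate the lattice has full rank. So the one-parameter
  group stays, modulo the lattice, in the image of a conjugate of a compact box \<open>K\<close>, and translations
  by the lattice commute with the conjugation.\<close>

lemma elliptic_precompact:
  assumes "fst (fst X) \<noteq> 0"
  shows "\<not> generates_non_precompact (G' lam z \<phi>) (G'_proj lam z \<phi>) X"
proof -
  obtain t v s where X: "X = ((t, v), s)" by (metis prod.exhaust)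
  have t: "t \<noteq> 0" using assms X by simp
  obtain g a where exp: "\<And>r. lie_exp (G' lam z \<phi>) (G'_proj lam z \<phi>) (r *\<^sub>R ((t, v), s)) =
      G'_proj lam z \<phi> (oscR_mult lam (oscR_mult lam ((0, g), 0) ((r * t, r * a, 0, 0), r * s)) ((0, - g), 0))"
    by (rule one_param_elliptic[OF t, of v s]) (rule that)
  obtain T where T: "T > 0" "T \<in> rot_periods lam" by (rule rot_periods_nontrivial[OF rational]) (rule that)
  define conj where "conj x = oscR_mult lam (oscR_mult lam ((0, g), 0) x) ((0, - g), 0)" for x
  define K :: "('d osc \<times> real) set" where
    "K = ({0..T} \<times> ({- \<bar>c\<bar>..\<bar>c\<bar>} \<times> {0} \<times> {0})) \<times> {0..2 * pi}"
  define C where "C = G'_proj lam z \<phi> ` conj ` K"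
  have K: "compact K" unfolding K_def by (intro compact_Times compact_Icc) simp_all
  have conj_cont: "continuous_on UNIV conj"
    unfolding conj_def by (intro continuous_on_oscR_mult continuous_on_const continuous_on_id)
  have "compact (conj ` K)"
    by (rule compact_continuous_image[OF continuous_on_subset[OF conj_cont subset_UNIV] K])
  then have C: "compactin (topo (G' lam z \<phi>)) C"
    unfolding C_def by (intro image_compactin[OF _ Q.continuous_map_proj]) simp
  have "lie_exp (G' lam z \<phi>) (G'_proj lam z \<phi>) (r *\<^sub>R X) \<in> C" for r
  proof -
    let ?t = "r * t" and ?a = "r * a" and ?s = "r * s"
    \<comment> \<open>Subtract the lattice vector \<open>n\<close> that brings the three coordinates into the box. The sign of \<open>c\<close> is unknown, hence the symmetric interval in \<open>K\<close>.\<close>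
    define j i where "j = \<lfloor>?t / T\<rfloor>" and "i = \<lfloor>?a / c\<rfloor>"
    define k where "k = \<lfloor>(?s - i * \<phi>) / (2 * pi)\<rfloor>"
    define n :: "'d osc \<times> real" where "n = ((j * T, i * c, 0, 0), i * \<phi> + 2 * pi * k)"
    define y :: "'d osc \<times> real" where "y = ((?t - j * T, ?a - i * c, 0, 0), ?s - (i * \<phi> + 2 * pi * k))"
    have n: "n \<in> irr_lattice lam c \<phi>"
      unfolding n_def irr_lattice_def using rot_periods_group(4)[OF T(2), of j] by blast
    have "y \<in> K"
    proof -
      have "real_of_int j \<le> ?t / T" "?t / T < j + 1" unfolding j_def by linarith+
      then have 1: "?t - j * T \<in> {0..T}" using T(1) by (simp add: field_simps)
      have "\<bar>?a / c - i\<bar> \<le> 1" unfolding i_def by linarith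
      then have "\<bar>c\<bar> * \<bar>?a / c - i\<bar> \<le> \<bar>c\<bar> * 1" by (intro mult_left_mono) auto
      moreover have "?a - i * c = c * (?a / c - i)" using c_nonzero by (simp add: field_simps)
      ultimately have "\<bar>?a - i * c\<bar> \<le> \<bar>c\<bar>" by (simp add: abs_mult)
      then have 2: "?a - i * c \<in> {- \<bar>c\<bar>..\<bar>c\<bar>}" by auto
      have "real_of_int k \<le> (?s - i * \<phi>) / (2 * pi)" "(?s - i * \<phi>) / (2 * pi) < k + 1"
        unfolding k_def by linarith+
      then have 3: "?s - (i * \<phi> + 2 * pi * k) \<in> {0..2 * pi}" by (simp add: field_simps)
      show ?thesis unfolding K_def y_def using 1 2 3 by simp
    qed
    have "((?t, ?a, 0, 0), ?s) = n + y" by (simp add: n_def y_def)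
    then have "lie_exp (G' lam z \<phi>) (G'_proj lam z \<phi>) (r *\<^sub>R X) = G'_proj lam z \<phi> (conj (n + y))"
      using exp[of r] unfolding X conj_def by simp
    also have "conj (n + y) = n + conj y"
      unfolding conj_def by (simp only: Q.m_translation_left[OF n] Q.m_translation_right[OF n])
    also have "G'_proj lam z \<phi> (n + conj y) = G'_proj lam z \<phi> (conj y)" by (rule Q.proj_add[OF n])
    finally show ?thesis unfolding C_def using \<open>y \<in> K\<close> by simp
  qed
  then have "range (\<lambda>r. lie_exp (G' lam z \<phi>) (G'_proj lam z \<phi>) (r *\<^sub>R X)) \<subseteq> C" by blast
  then have "topo (G' lam z \<phi>) closure_of range (\<lambda>r. lie_exp (G' lam z \<phi>) (G'_proj lam z \<phi>) (r *\<^sub>R X)) \<subseteq> C"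
    by (rule closure_of_minimal) (rule compactin_imp_closedin[OF Q.Hausdorff_topo C])
  then show ?thesis
    unfolding generates_non_precompact_def using closed_compactin[OF C] by simp
qed

end

text \<open>The standard Lorentzian form of the oscillator algebra, in which \<open>T\<close> and \<open>Z\<close> are dual isotropic
  vectors and \<open>X\<^sub>k\<close>, \<open>Y\<^sub>k\<close> are orthonormal, extended by a positive definite form on the last summand.\<close>

definition osc_form :: "('d::finite) osc \<times> real \<Rightarrow> 'd osc \<times> real \<Rightarrow> real" where
  "osc_form X Y = fst (fst X) * fst (snd (fst Y)) + fst (snd (fst X)) * fst (fst Y)
     + snd (snd (fst X)) \<bullet> snd (snd (fst Y)) + snd X * snd Y"

lemma bilinear_osc_form: "bilinear osc_form"
  unfolding bilinear_def
  by (intro conjI allI linearI) (simp_all add: osc_form_def inner_add_left inner_add_right algebra_simps)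

lemma osc_form_sym: "osc_form X Y = osc_form Y X"
  by (simp add: osc_form_def inner_commute)

lemma heis_form_snd: "heis_form lam v w = snd (ad_T lam v) \<bullet> snd w"
  by (simp add: heis_form_inner inner_prod_def ad_T_def split_beta)

text \<open>Both sides are the alternating trilinear form that is the cyclic sum of the products of one
  \<open>T\<close>-coordinate with the symplectic form of the other two vectors.\<close>

lemma ad_invariant_osc_form: "ad_invariant (g'_bracket lam) osc_form"
proof -
  have fst: "fst (ad_T lam v) = 0" for v by (simp add: ad_T_def split_beta)
  have "osc_form (g'_bracket lam X Y) W = osc_form X (g'_bracket lam Y W)" for X Y W
  proof -
    let ?t = "\<lambda>X :: 'a osc \<times> real. fst (fst X)" and ?v = "\<lambda>X :: 'a osc \<times> real. snd (fst X)"
    have "osc_form (g'_bracket lam X Y) W = ?t W * heis_form lam (?v X) (?v Y)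
        + ?t X * heis_form lam (?v Y) (?v W) - ?t Y * heis_form lam (?v X) (?v W)"
      by (simp add: osc_form_def g'_bracket_def osc_bracket_def split_beta fst heis_form_snd
          inner_diff_left algebra_simps flip: zero_prod_def)
    moreover have "osc_form X (g'_bracket lam Y W) = ?t X * heis_form lam (?v Y) (?v W)
        + ?t Y * heis_form lam (?v W) (?v X) - ?t W * heis_form lam (?v Y) (?v X)"
      by (simp add: osc_form_def g'_bracket_def osc_bracket_def split_beta fst heis_form_snd
          inner_diff_right inner_commute algebra_simps flip: zero_prod_def)
    ultimately show ?thesis
      using heis_form_antisym[of lam "?v W" "?v X"] heis_form_antisym[of lam "?v Y" "?v X"] by simp
  qed
  then show ?thesis by (simp add: ad_invariant_def)
qed

context irrational_quotient
begin

text \<open>By the precompactness lemma a vector with a non-precompact one-parameter group has no \<open>T\<close>-component, and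
  this passes to the closure. Without \<open>T\<close>-component the form is the sum of squares of all coordinates but
  that of \<open>Z\<close>.\<close>

lemma osc_form_condition:
  assumes V: "V \<subseteq> closure {X \<in> V. generates_non_precompact (G' lam z \<phi>) (G'_proj lam z \<phi>) X}"
  shows "\<forall>X\<in>V. 0 \<le> osc_form X X" "dim (form_kernel osc_form V) \<le> 1"
proof -
  let ?T = "{X :: 'd osc \<times> real. fst (fst X) = 0}"
  have "{X \<in> V. generates_non_precompact (G' lam z \<phi>) (G'_proj lam z \<phi>) X} \<subseteq> ?T"
    using elliptic_precompact by blast
  moreover have "closed ?T" by (intro closed_Collect_eq continuous_intros)
  ultimately have "V \<subseteq> ?T" using V closure_minimal by blast
  have form: "osc_form X X = (norm (snd (snd (fst X))))\<^sup>2 + (snd X)\<^sup>2" if "X \<in> V" for X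
  proof -
    have "fst (fst X) = 0" using that \<open>V \<subseteq> ?T\<close> by blast
    then show ?thesis by (simp add: osc_form_def power2_norm_eq_inner power2_eq_square[of "snd X"])
  qed
  then show "\<forall>X\<in>V. 0 \<le> osc_form X X" by simp
  have "form_kernel osc_form V \<subseteq> span {((0, 1, 0, 0), 0)}"
  proof
    fix X assume "X \<in> form_kernel osc_form V"
    then have X: "X \<in> V" "osc_form X X = 0" unfolding form_kernel_def by auto
    then have "norm (snd (snd (fst X))) = 0 \<and> snd X = 0"
      using form[OF X(1)] by (simp add: add_nonneg_eq_0_iff)
    then have "X = fst (snd (fst X)) *\<^sub>R ((0, 1, 0, 0), 0)"
      using \<open>V \<subseteq> ?T\<close> X(1) by (auto simp: prod_eq_iff)
    then show "X \<in> span {((0, 1, 0, 0), 0)}" by (metis span_base span_scale singletonI)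
  qed
  then have "dim (form_kernel osc_form V) \<le> dim (span {((0, 1, 0, 0), 0) :: 'd osc \<times> real})"
    by (rule dim_subset)
  also have "\<dots> \<le> card {((0, 1, 0, 0), 0) :: 'd osc \<times> real}" by (subst dim_span) (rule dim_le_card', simp)
  finally show "dim (form_kernel osc_form V) \<le> 1" by simp
qed

end

section \<open>The subgroup generated by the oscillator algebra\<close>

context irrational_quotient
begin

text \<open>The subgroup generated by the oscillator algebra is the image of the oscillator group under the
  covering; the kernel of this restriction is \<open>Lambda' lam\<close>, by irrationality of \<open>\<phi> / \<pi>\<close>.\<close>

definition proj_H :: "'d osc \<Rightarrow> ('d osc set \<times> complex) set" where
  "proj_H x = G'_proj lam z \<phi> (x, 0)"

definition H :: "(('d osc set \<times> complex) set, 'd osc) lie" where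
  "H = image_lie (G' lam z \<phi>) proj_H"

lemma no_integer_relation:
  fixes n k :: int
  assumes "n * \<phi> + 2 * pi * k = 0"
  shows "n = 0"
proof (rule ccontr)
  assume "n \<noteq> 0"
  then have "\<phi> / pi = - 2 * of_int k / of_int n" using assms by (simp add: field_simps)
  also have "\<dots> \<in> \<rat>" by simp
  finally show False using irrational by simp
qed

lemma irr_lattice_real_zero: "(w, 0) \<in> irr_lattice lam c \<phi> \<longleftrightarrow> w \<in> Lambda' lam"
proof
  assume "(w, 0) \<in> irr_lattice lam c \<phi>"
  then obtain t and n k :: int where
    *: "w = (t, n * c, 0, 0)" "0 = n * \<phi> + 2 * pi * k" "t \<in> rot_periods lam"
    unfolding irr_lattice_def by blast
  have "n = 0" using *(2) by (intro no_integer_relation[of n k]) simp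
  then show "w \<in> Lambda' lam" using * by (simp add: Lambda'_eq zero_prod_def)
next
  assume "w \<in> Lambda' lam"
  then show "(w, 0) \<in> irr_lattice lam c \<phi>"
    by (auto simp: Lambda'_eq irr_lattice_def zero_prod_def intro!: exI[of _ "0::int"])
qed

lemma oscR_mult_H: "oscR_mult lam (x, 0) (y, 0) = (osc_mult lam x y, 0)"
  by (simp add: oscR_mult_def)

sublocale H: covered_lie_group H proj_H "Lambda' lam" "osc_mult lam" "osc_inv lam"
  unfolding H_def
proof (rule covered_lie_group_image)
  interpret O: covered_lie_group "Osc_bar lam" "\<lambda>x. Lambda' lam #>\<^bsub>Osc_tilde lam\<^esub> x" "Lambda' lam"
    "osc_mult lam" "osc_inv lam" by (rule covered_Osc_bar[OF pos])
  show "proj_H x = proj_H y \<longleftrightarrow> y - x \<in> Lambda' lam" for x y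
    unfolding proj_H_def Q.proj_eq_iff by (simp add: irr_lattice_real_zero)
  show "\<exists>e>0. \<forall>n\<in>Lambda' lam. norm n < e \<longrightarrow> n = 0" by (rule O.discrete)
  show "proj_H x \<otimes>\<^bsub>G' lam z \<phi>\<^esub> proj_H y = proj_H (osc_mult lam x y)" for x y
    by (simp add: proj_H_def Q.mult_proj oscR_mult_H)
  show "\<one>\<^bsub>G' lam z \<phi>\<^esub> = proj_H 0" by (simp add: proj_H_def Q.one_proj zero_prod_def)
  show "osc_mult lam n x = n + x" "osc_mult lam x n = n + x" if "n \<in> Lambda' lam" for n x
    by (rule O.translation_left[OF that], rule O.translation_right[OF that])
qed (auto simp: osc_mult_assoc osc_mult_zero_left osc_inv_left smooth_osc_mult smooth_osc_inv)

lemma carrier_H: "carrier H = range proj_H"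
  by (simp add: H_def image_lie_def)

lemma subgroup_H: "subgroup (carrier H) (G' lam z \<phi>)"
proof (rule group.subgroupI[OF Q.group_G])
  show "carrier H \<subseteq> carrier (G' lam z \<phi>)"
    unfolding carrier_H proj_H_def using Q.proj_in_carrier by blast
  show "carrier H \<noteq> {}" by (simp add: carrier_H)
  show "inv\<^bsub>G' lam z \<phi>\<^esub> a \<in> carrier H" if a: "a \<in> carrier H" for a
  proof -
    obtain x where "a = proj_H x" using a unfolding carrier_H by blast
    then have "inv\<^bsub>G' lam z \<phi>\<^esub> a = proj_H (osc_inv lam x)"
      unfolding proj_H_def by (simp add: Q.inv_proj oscR_inv_def)
    then show ?thesis by (simp add: carrier_H)
  qed
  show "a \<otimes>\<^bsub>G' lam z \<phi>\<^esub> b \<in> carrier H" if ab: "a \<in> carrier H" "b \<in> carrier H" for a b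
  proof -
    obtain x y where "a = proj_H x" "b = proj_H y" using ab unfolding carrier_H by blast
    then have "a \<otimes>\<^bsub>G' lam z \<phi>\<^esub> b = proj_H (osc_mult lam x y)"
      by (simp add: proj_H_def Q.mult_proj oscR_mult_H)
    then show ?thesis by (simp add: carrier_H)
  qed
qed

lemma lie_exp_in_H: "lie_exp (G' lam z \<phi>) (G'_proj lam z \<phi>) ((t, v), 0) \<in> carrier H"
proof (cases "t = 0")
  case True
  then show ?thesis using one_param_nilpotent[of v 0] by (simp add: carrier_H proj_H_def)
next
  case False
  obtain g a where exp: "\<And>r. lie_exp (G' lam z \<phi>) (G'_proj lam z \<phi>) (r *\<^sub>R ((t, v), 0)) =
      G'_proj lam z \<phi> (oscR_mult lam (oscR_mult lam ((0, g), 0) ((r * t, r * a, 0, 0), r * 0)) ((0, - g), 0))"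
    by (rule one_param_elliptic[OF False, of v 0]) (rule that)
  show ?thesis using exp[of 1] by (simp add: oscR_mult_H carrier_H flip: proj_H_def)
qed

text \<open>Every element of the oscillator group is a product \<open>v exp (t T)\<close> of two exponentials.\<close>

lemma generate_H: "carrier H = generate (G' lam z \<phi>) (lie_exp (G' lam z \<phi>) (G'_proj lam z \<phi>) ` (UNIV \<times> {0}))"
proof
  let ?E = "lie_exp (G' lam z \<phi>) (G'_proj lam z \<phi>) ` (UNIV \<times> {0})"
  show "generate (G' lam z \<phi>) ?E \<subseteq> carrier H"
    using lie_exp_in_H by (intro group.generate_subgroup_incl[OF Q.group_G _ subgroup_H]) auto
  show "carrier H \<subseteq> generate (G' lam z \<phi>) ?E"
  proof
    fix a assume "a \<in> carrier H"
    then obtain t v where a: "a = proj_H (t, v)" unfolding carrier_H by (metis prod.exhaust rangeE)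
    have "lie_exp (G' lam z \<phi>) (G'_proj lam z \<phi>) (t *\<^sub>R ((1, 0), 0)) = G'_proj lam z \<phi> ((t, 0), 0)"
    proof (rule Q.lie_exp_scaleR)
      show "((r + u, 0), 0) = oscR_mult lam ((r, 0), 0) ((u, 0), 0)" for r u :: real
        by (simp add: oscR_mult_def osc_mult_def heis_mult_def linear_0[OF linear_rot] heis_form_simps
            flip: zero_prod_def)
      show "((\<lambda>r. ((r, 0), 0)) has_vector_derivative ((1, 0), 0)) (at (0::real))"
        by (auto intro!: has_vector_derivative_Pair derivative_eq_intros)
    qed (intro continuous_intros)
    then have "G'_proj lam z \<phi> ((t, 0), 0) \<in> ?E"
      by (intro image_eqI[of _ _ "t *\<^sub>R ((1, 0), 0)"]) simp_all
    moreover have "G'_proj lam z \<phi> ((0, v), 0) \<in> ?E"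
      using one_param_nilpotent[of v 0] by (intro image_eqI[of _ _ "((0, v), 0)"]) simp_all
    ultimately have "G'_proj lam z \<phi> ((0, v), 0) \<otimes>\<^bsub>G' lam z \<phi>\<^esub> G'_proj lam z \<phi> ((t, 0), 0) \<in> generate (G' lam z \<phi>) ?E"
      by (intro generate.eng generate.incl)
    moreover have "oscR_mult lam ((0, v), 0) ((t, 0), 0) = ((t, v), 0)"
      by (simp add: oscR_mult_def osc_mult_def heis_mult_def linear_0[OF linear_rot] heis_form_simps
          flip: zero_prod_def)
    ultimately show "a \<in> generate (G' lam z \<phi>) ?E" by (simp add: a proj_H_def Q.mult_proj)
  qed
qed

lemma connected_lie_subgroup_H:
  "connected_lie_subgroup (G' lam z \<phi>) (G'_proj lam z \<phi>) (UNIV \<times> {0}) H"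
  unfolding connected_lie_subgroup_def
proof (intro conjI H.lie_group_G generate_H subgroup_H)
  have "connectedin (topo H) (proj_H ` UNIV)"
    by (rule connectedin_continuous_map_image[OF H.continuous_map_proj]) (simp add: connected_UNIV)
  then show "connected_space (topo H)"
    using connectedin_topspace[of "topo H"] H.topspace_topo carrier_H by simp
  show "\<forall>x\<in>carrier H. \<forall>y\<in>carrier H. x \<otimes>\<^bsub>H\<^esub> y = x \<otimes>\<^bsub>G' lam z \<phi>\<^esub> y"
    by (simp add: H_def image_lie_def)
  have lin: "bounded_linear (\<lambda>x::'d osc. (x, 0::real))"
    by (intro bounded_linear_Pair bounded_linear_ident bounded_linear_zero)
  show "smooth_map H (G' lam z \<phi>) (\<lambda>x. x)"
    by (rule smooth_map_if_lift[OF H.translation_cover_axioms Q.translation_cover_axioms, of "\<lambda>x. (x, 0)"])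
       (auto simp: smooth_on_def proj_H_def intro!: Ck_linear[OF lin] Ck_id)
  have "frechet_derivative (f \<circ> inv_into W g) (at (g \<one>\<^bsub>H\<^esub>)) = (\<lambda>x. (x, 0))"
    if c: "(U, f) \<in> atlas (G' lam z \<phi>)" "(W, g) \<in> atlas H" "\<one>\<^bsub>G' lam z \<phi>\<^esub> \<in> U" "\<one>\<^bsub>H\<^esub> \<in> W" for U f W g
  proof -
    have one: "\<one>\<^bsub>H\<^esub> = \<one>\<^bsub>G' lam z \<phi>\<^esub>" by (simp add: H_def image_lie_def)
    have cont: "continuous_on UNIV (\<lambda>x::'d osc. (x, 0::real))" by (intro continuous_intros)
    have "proj_H (g \<one>\<^bsub>H\<^esub>) \<in> U" using H.chart_section[OF c(2,4)] c(3) one by simp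
    then obtain T where T: "open T" "g \<one>\<^bsub>H\<^esub> \<in> T" "\<And>x. x \<in> T \<Longrightarrow> G'_proj lam z \<phi> (x, 0) \<in> U \<and>
        f (G'_proj lam z \<phi> (x, 0)) = f (G'_proj lam z \<phi> (g \<one>\<^bsub>H\<^esub>, 0)) - (g \<one>\<^bsub>H\<^esub>, 0) + (x, 0)"
      unfolding proj_H_def by (rule Q.chart_translation[OF c(1) cont]) (rule that)
    have "((\<lambda>x. f (G'_proj lam z \<phi> (g \<one>\<^bsub>H\<^esub>, 0)) - (g \<one>\<^bsub>H\<^esub>, 0) + (x, 0)) has_derivative (\<lambda>x. (x, 0)))
        (at (g \<one>\<^bsub>H\<^esub>))"
      using has_derivative_add[OF has_derivative_const bounded_linear_imp_has_derivative[OF lin]] by simp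
    then have "((f \<circ> inv_into W g) has_derivative (\<lambda>x. (x, 0))) (at (g \<one>\<^bsub>H\<^esub>))"
    proof (rule has_derivative_transform_within_open)
      show "open (T \<inter> g ` W)" using T(1) H.chart_open[OF c(2)] by (rule open_Int)
      show "g \<one>\<^bsub>H\<^esub> \<in> T \<inter> g ` W" using T(2) c(4) by simp
      fix x assume x: "x \<in> T \<inter> g ` W"
      then show "f (G'_proj lam z \<phi> (g \<one>\<^bsub>H\<^esub>, 0)) - (g \<one>\<^bsub>H\<^esub>, 0) + (x, 0) = (f \<circ> inv_into W g) x"
        using T(3)[of x] H.chart_proj(3)[OF c(2), of x] by (simp add: proj_H_def)
    qed
    then show ?thesis by (rule frechet_derivative_at[symmetric])
  qed
  moreover have "range (\<lambda>x::'d osc. (x, 0::real)) = UNIV \<times> {0}" by auto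
  moreover have "inj (\<lambda>x::'d osc. (x, 0::real))" by (rule injI) simp
  ultimately show "\<forall>(U, f)\<in>atlas (G' lam z \<phi>). \<forall>(W, g)\<in>atlas H. \<one>\<^bsub>G' lam z \<phi>\<^esub> \<in> U \<and> \<one>\<^bsub>H\<^esub> \<in> W \<longrightarrow>
      (let D = frechet_derivative (f \<circ> inv_into W g) (at (g \<one>\<^bsub>H\<^esub>))
       in inj D \<and> range D = tangent_coords (G'_proj lam z \<phi>) f ` (UNIV \<times> {0}))"
    by (auto simp: Q.tangent_coords_proj Let_def)
qed

text \<open>An element \<open>(0, s)\<close> of the last factor maps into the subgroup iff \<open>s\<close> is an integral combination of
  \<open>\<phi>\<close> and \<open>2 \<pi>\<close>. The set of these numbers is dense by Kronecker's theorem, and countable; so it is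
  not closed.\<close>

lemma H_not_closed: "\<not> closedin (topo (G' lam z \<phi>)) (carrier H)"
proof
  assume closed: "closedin (topo (G' lam z \<phi>)) (carrier H)"
  define D where "D = {s. G'_proj lam z \<phi> (0, s) \<in> carrier H}"
  have "continuous_map euclideanreal (topo (G' lam z \<phi>)) (G'_proj lam z \<phi> \<circ> (\<lambda>s. (0, s)))"
    by (rule continuous_map_compose[OF _ Q.continuous_map_proj]) (simp add: continuous_on_Pair)
  from closedin_continuous_map_preimage[OF this closed] have "closed D"
    by (simp add: D_def)
  have D: "s \<in> D \<longleftrightarrow> (\<exists>(n::int) (k::int). s = n * \<phi> + 2 * pi * k)" for s
  proof
    assume "s \<in> D"
    then obtain x where "G'_proj lam z \<phi> (0, s) = G'_proj lam z \<phi> (x, 0)"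
      unfolding D_def carrier_H proj_H_def by blast
    then have "(0, s) - (x, 0) \<in> irr_lattice lam c \<phi>" using Q.proj_eq_iff by metis
    then have "(- x, s) \<in> irr_lattice lam c \<phi>" by simp
    then show "\<exists>(n::int) (k::int). s = n * \<phi> + 2 * pi * k" unfolding irr_lattice_def by blast
  next
    assume "\<exists>(n::int) (k::int). s = n * \<phi> + 2 * pi * k"
    then obtain n k :: int where s: "s = n * \<phi> + 2 * pi * k" by blast
    have "((0, n * c, 0, 0), s) \<in> irr_lattice lam c \<phi>"
      unfolding irr_lattice_def s using rot_periods_group(1) by blast
    moreover have "(0, s) - ((0, - (n * c), 0, 0), 0) = (((0, n * c, 0, 0), s) :: 'd osc \<times> real)"
      by (simp add: zero_prod_def)
    ultimately have "G'_proj lam z \<phi> ((0, - (n * c), 0, 0), 0) = G'_proj lam z \<phi> (0, s)"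
      unfolding Q.proj_eq_iff by simp
    then have "G'_proj lam z \<phi> (0, s) \<in> range (\<lambda>x. G'_proj lam z \<phi> (x, 0))" by (metis rangeI)
    then show "s \<in> D" unfolding D_def carrier_H proj_H_def[abs_def] by simp
  qed
  have "s \<in> closure D" for s
    unfolding closure_approachable
  proof (intro allI impI)
    fix e :: real assume e: "e > 0"
    have "\<phi> / (2 * pi) \<notin> \<rat>"
    proof
      assume "\<phi> / (2 * pi) \<in> \<rat>"
      then have "2 * (\<phi> / (2 * pi)) \<in> \<rat>" by (intro Rats_mult) simp_all
      then show False using irrational by simp
    qed
    then obtain h k :: int where hk: "\<bar>of_int k * (\<phi> / (2 * pi)) - of_int h - s / (2 * pi)\<bar> < e / (2 * pi)"
      using sequence_of_fractional_parts_is_dense[of "\<phi> / (2 * pi)" "e / (2 * pi)" "s / (2 * pi)"] e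
      by (metis divide_pos_pos mult_pos_pos pi_gt_zero zero_less_numeral)
    have "k * \<phi> + 2 * pi * (- h) - s = 2 * pi * (k * (\<phi> / (2 * pi)) - h - s / (2 * pi))"
      by (simp add: field_simps)
    also have "\<bar>\<dots>\<bar> < e"
    proof -
      have "2 * pi * \<bar>k * (\<phi> / (2 * pi)) - h - s / (2 * pi)\<bar> < 2 * pi * (e / (2 * pi))"
        using hk by (intro mult_strict_left_mono) simp_all
      then show ?thesis by (simp add: abs_mult)
    qed
    finally have "dist (k * \<phi> + 2 * pi * of_int (- h)) s < e" by (simp add: dist_real_def)
    moreover have "k * \<phi> + 2 * pi * of_int (- h) \<in> D" unfolding D by (intro exI) (rule refl)
    ultimately show "\<exists>y\<in>D. dist y s < e" by (rule bexI)
  qed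
  then have "D = UNIV" using \<open>closed D\<close> by auto
  have "D \<subseteq> (\<lambda>(n::int, k::int). n * \<phi> + 2 * pi * k) ` UNIV"
  proof
    fix s assume "s \<in> D"
    then obtain n k :: int where "s = n * \<phi> + 2 * pi * k" using D by blast
    then show "s \<in> (\<lambda>(n::int, k::int). n * \<phi> + 2 * pi * k) ` UNIV" by (intro image_eqI[of _ _ "(n, k)"]) simp_all
  qed
  then have "countable D" by (rule countable_subset) simp
  then show False using \<open>D = UNIV\<close> uncountable_UNIV_real by simp
qed

end

section \<open>Central involutions\<close>

lemma iso_central_involution:
  assumes F: "F \<in> iso G K" and "group G" "group K"
    and a: "a \<in> group_center K" "a \<otimes>\<^bsub>K\<^esub> a = \<one>\<^bsub>K\<^esub>" "a \<noteq> \<one>\<^bsub>K\<^esub>"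
  obtains h where "h \<in> group_center G" "h \<otimes>\<^bsub>G\<^esub> h = \<one>\<^bsub>G\<^esub>" "h \<noteq> \<one>\<^bsub>G\<^esub>"
proof -
  interpret G: group G by fact
  interpret K: group K by fact
  have hom: "F \<in> hom G K" and bij: "bij_betw F (carrier G) (carrier K)"
    using F unfolding iso_def by auto
  have inj: "x = y" if "x \<in> carrier G" "y \<in> carrier G" "F x = F y" for x y
    using bij that unfolding bij_betw_def inj_on_def by blast
  have a_carrier: "a \<in> carrier K" using a(1) unfolding group_center_def by blast
  then have "a \<in> F ` carrier G" using bij unfolding bij_betw_def by simp
  then obtain h where h: "h \<in> carrier G" "a = F h" by blast
  have one: "F \<one>\<^bsub>G\<^esub> = \<one>\<^bsub>K\<^esub>" by (rule hom_one[OF hom G.is_group K.is_group])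
  show ?thesis
  proof
    show "h \<in> group_center G"
      unfolding group_center_def
    proof (intro CollectI conjI ballI h(1))
      fix x assume x: "x \<in> carrier G"
      have Fx: "F x \<in> carrier K" by (rule hom_in_carrier[OF hom x])
      have "F (h \<otimes>\<^bsub>G\<^esub> x) = a \<otimes>\<^bsub>K\<^esub> F x" using hom_mult[OF hom h(1) x] h(2) by simp
      also have "\<dots> = F x \<otimes>\<^bsub>K\<^esub> a" using a(1) Fx unfolding group_center_def by blast
      also have "\<dots> = F (x \<otimes>\<^bsub>G\<^esub> h)" using hom_mult[OF hom x h(1)] h(2) by simp
      finally show "h \<otimes>\<^bsub>G\<^esub> x = x \<otimes>\<^bsub>G\<^esub> h" using h(1) x by (intro inj) auto
    qed
    show "h \<otimes>\<^bsub>G\<^esub> h = \<one>\<^bsub>G\<^esub>"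
      using hom_mult[OF hom h(1) h(1)] h a(2) one by (intro inj) auto
    show "h \<noteq> \<one>\<^bsub>G\<^esub>" using a(3) h(2) one by auto
  qed
qed

text \<open>The centre is a line, hence torsion-free.\<close>

lemma Lambda'_no_central_involution:
  assumes pos: "\<And>k. 0 < lam $ k"
    and "covered_lie_group G \<pi> (Lambda' lam) (osc_mult lam) (osc_inv lam)"
    and h: "h \<in> group_center G" "h \<otimes>\<^bsub>G\<^esub> h = \<one>\<^bsub>G\<^esub>"
  shows "h = \<one>\<^bsub>G\<^esub>"
proof -
  interpret covered_lie_group G \<pi> "Lambda' lam" "osc_mult lam" "osc_inv lam" by fact
  obtain c where c: "h = \<pi> (0, c, 0, 0)"
    by (rule center_covered_by_Lambda'[OF pos covered_lie_group_axioms h(1)]) (rule that)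
  have "\<pi> (osc_mult lam (0, c, 0, 0) (0, c, 0, 0)) = \<pi> 0"
    using h(2) by (simp only: c mult_proj one_proj)
  then have "0 - osc_mult lam (0, c, 0, 0) (0, c, 0, 0) \<in> Lambda' lam" using proj_eq_iff by blast
  then have "c = 0" unfolding osc_mult_center_right by (auto simp: Lambda'_eq zero_prod_def)
  then show ?thesis by (simp add: c one_proj zero_prod_def)
qed

lemma group_Heis_tilde: "group (Heis_tilde lam)"
proof (rule groupI)
  fix x assume "x \<in> carrier (Heis_tilde lam)"
  show "\<exists>y\<in>carrier (Heis_tilde lam). y \<otimes>\<^bsub>Heis_tilde lam\<^esub> x = \<one>\<^bsub>Heis_tilde lam\<^esub>"
    by (intro bexI[of _ "- x"]) (simp_all add: Heis_tilde_def heis_mult_def heis_form_simps flip: zero_prod_def)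
qed (auto simp: Heis_tilde_def heis_mult_assoc, auto simp: heis_mult_def heis_form_center_left[of lam 0] zero_prod_def)

lemma center_Heis_tilde:
  assumes pos: "\<And>k. 0 < lam $ k"
  shows "group_center (Heis_tilde lam) = {(c, 0, 0) | c. True}"
proof
  show "{(c, 0, 0) | c. True} \<subseteq> group_center (Heis_tilde lam)"
    by (auto simp: group_center_def Heis_tilde_def heis_mult_def heis_form_simps add.commute)
  show "group_center (Heis_tilde lam) \<subseteq> {(c, 0, 0) | c. True}"
  proof
    fix v assume "v \<in> group_center (Heis_tilde lam)"
    then have "\<forall>w. heis_mult lam v w = heis_mult lam w v"
      by (simp add: group_center_def Heis_tilde_def)
    then have "heis_mult lam v w = heis_mult lam w v" for w by (rule spec)
    then have "heis_form lam v w = heis_form lam w v" for w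
      by (simp add: heis_mult_def add.commute)
    then have "heis_form lam v w = 0" for w
      using heis_form_antisym[of lam v w] by (metis equal_neg_zero)
    then have "ad_T lam v = 0" by (metis heis_form_inner inner_eq_zero_iff)
    moreover have "lam $ k \<noteq> 0" for k using pos[of k] by simp
    ultimately have "snd v = 0"
      by (simp add: ad_T_def split_beta zero_prod_def vec_eq_iff prod_eq_iff)
    then show "v \<in> {(c, 0, 0) | c. True}" by (cases v) (simp add: zero_prod_def)
  qed
qed

text \<open>A lattice in the centre is a discrete subgroup \<open>C\<close> of the real line; it is not trivial, since
  otherwise the quotient of the line by it would be the line itself, which is not compact.\<close>

lemma Heis_lattice:
  assumes pos: "\<And>k. 0 < lam $ k"
    and L: "is_lattice_in (Heis_tilde lam) (group_center (Heis_tilde lam)) L"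
  obtains C where "L = {(c, 0, 0) | c. c \<in> C}" "0 \<in> C" "\<And>a b. a \<in> C \<Longrightarrow> b \<in> C \<Longrightarrow> a + b \<in> C"
    "\<And>a. a \<in> C \<Longrightarrow> - a \<in> C" "\<exists>e>0. \<forall>c\<in>C. \<bar>c\<bar> < e \<longrightarrow> c = 0" "C \<noteq> {0}"
proof
  let ?K = "group_center (Heis_tilde lam)"
  define C where "C = {c. (c, 0, 0) \<in> L}"
  have sub: "subgroup L (Heis_tilde lam)" and LK: "L \<subseteq> ?K"
    and disc: "subtopology (topo (Heis_tilde lam)) L = discrete_topology L"
    and compact: "compact_space (coset_topology (Heis_tilde lam) (subtopology (topo (Heis_tilde lam)) ?K) L)"
    using L unfolding is_lattice_in_def by auto
  have K: "?K = {(c, 0, 0) | c. True}" by (rule center_Heis_tilde[OF pos])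
  show LC: "L = {(c, 0, 0) | c. c \<in> C}" using LK unfolding K C_def by blast
  have mult: "(a, 0, 0) \<otimes>\<^bsub>Heis_tilde lam\<^esub> (b, 0, 0) = (a + b, 0, 0)" for a b
    by (simp add: Heis_tilde_def heis_mult_def heis_form_simps)
  have one: "\<one>\<^bsub>Heis_tilde lam\<^esub> = (0, 0, 0)" by (simp add: Heis_tilde_def zero_prod_def)
  show "0 \<in> C" using subgroup.one_closed[OF sub] by (simp add: C_def one)
  show "a + b \<in> C" if "a \<in> C" "b \<in> C" for a b
    using subgroup.m_closed[OF sub, of "(a, 0, 0)" "(b, 0, 0)"] that by (simp add: C_def mult)
  show "- a \<in> C" if "a \<in> C" for a
  proof -
    have "inv\<^bsub>Heis_tilde lam\<^esub> (a, 0, 0) = (- a, 0, 0)"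
      by (rule group.inv_equality[OF group_Heis_tilde]) (simp_all add: mult one, simp_all add: Heis_tilde_def)
    then show ?thesis using subgroup.m_inv_closed[OF sub, of "(a, 0, 0)"] that by (simp add: C_def)
  qed
  show "\<exists>e>0. \<forall>c\<in>C. \<bar>c\<bar> < e \<longrightarrow> c = 0"
  proof -
    have "(0, 0, 0) \<in> L" using \<open>0 \<in> C\<close> by (simp add: C_def)
    then have "openin (discrete_topology L) {(0, 0, 0)}" by simp
    then have "openin (top_of_set L) {(0, 0, 0)}" using disc by (simp add: Heis_tilde_def)
    then obtain T where T: "open T" "{(0, 0, 0)} = L \<inter> T" unfolding openin_open by blast
    then obtain e where e: "e > 0" "ball (0, 0, 0) e \<subseteq> T" using open_contains_ball by blast
    have "c = 0" if "c \<in> C" "\<bar>c\<bar> < e" for c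
    proof -
      have "dist (0, 0, 0) (c, 0::real^'a, 0::real^'a) < e" using that(2) by (simp add: dist_Pair_Pair)
      then have "(c, 0, 0) \<in> L \<inter> T" using e(2) that(1) by (auto simp: C_def)
      then show ?thesis using T(2) by auto
    qed
    then show ?thesis using e(1) by blast
  qed
  show "C \<noteq> {0}"
  proof
    assume "C = {0}"
    then have L0: "L = {(0, 0, 0)}" using LC by auto
    \<comment> \<open>Cosets of the trivial group are singletons, and \<open>the_elem\<close> recovers the point.\<close>
    have coset: "L #>\<^bsub>Heis_tilde lam\<^esub> v = {v}" for v
      by (simp add: L0 r_coset_def Heis_tilde_def heis_mult_def heis_form_simps zero_prod_def[symmetric])
    let ?X = "subtopology (topo (Heis_tilde lam)) ?K"
    let ?Y = "coset_topology (Heis_tilde lam) ?X L"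
    have X: "topspace ?X = ?K" by (simp add: Heis_tilde_def)
    have "continuous_map ?X euclideanreal (\<lambda>v. fst v)"
      by (simp add: Heis_tilde_def continuous_on_fst)
    then have "continuous_map ?X euclideanreal ((\<lambda>A. fst (the_elem A)) \<circ> (\<lambda>v. L #>\<^bsub>Heis_tilde lam\<^esub> v))"
      by (simp add: coset comp_def)
    then have cont: "continuous_map ?Y euclideanreal (\<lambda>A. fst (the_elem A))"
      using continuous_compose_quotient_map[OF quotient_map_coset_topology] by blast
    have "compactin ?Y (topspace ?Y)" using compact by (simp add: compact_space_def)
    then have "compactin euclideanreal ((\<lambda>A. fst (the_elem A)) ` topspace ?Y)"
      by (rule image_compactin[OF _ cont])
    moreover have "(\<lambda>A. fst (the_elem A)) ` topspace ?Y = UNIV"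
      unfolding topspace_coset_topology X by (force simp: coset K image_iff)
    ultimately have "compact (UNIV :: real set)" by simp
    then show False using compact_imp_bounded not_bounded_UNIV by blast
  qed
qed

text \<open>Otherwise all \<open>l / 2\<^sup>n\<close> would be in \<open>C\<close>, and they tend to \<open>0\<close>.\<close>

lemma discrete_not_divisible:
  fixes C :: "real set"
  assumes discrete: "\<exists>e>0. \<forall>c\<in>C. \<bar>c\<bar> < e \<longrightarrow> c = 0" and "l \<in> C" "l \<noteq> 0"
  shows "\<exists>b. b \<notin> C \<and> 2 * b \<in> C"
proof (rule ccontr)
  assume "\<not> ?thesis"
  then have half: "b \<in> C" if "2 * b \<in> C" for b using that by blast
  have "l / 2 ^ n \<in> C" for n
  proof (induction n)
    case (Suc n)
    show ?case by (rule half) (use Suc in simp)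
  qed (use assms in simp)
  moreover obtain e where e: "e > 0" "\<forall>c\<in>C. \<bar>c\<bar> < e \<longrightarrow> c = 0" using discrete by blast
  moreover obtain n :: nat where "\<bar>l\<bar> / e < 2 ^ n" using real_arch_pow[of 2] by auto
  then have "\<bar>l / 2 ^ n\<bar> < e" using e(1) by (simp add: field_simps)
  ultimately have "l / 2 ^ n = 0" by blast
  then show False using \<open>l \<noteq> 0\<close> by simp
qed

text \<open>The centre of the compactified group contains the circle that is the quotient of the centre of the
  Heisenberg group by the lattice.\<close>

lemma Osc_central_involution:
  assumes pos: "\<And>k. 0 < lam $ k"
    and L: "is_lattice_in (Heis_tilde lam) (group_center (Heis_tilde lam)) L"
  obtains a where "group (Osc lam L)" "a \<in> group_center (Osc lam L)"
    "a \<otimes>\<^bsub>Osc lam L\<^esub> a = \<one>\<^bsub>Osc lam L\<^esub>" "a \<noteq> \<one>\<^bsub>Osc lam L\<^esub>"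
proof -
  obtain C where C: "L = {(c, 0, 0) | c. c \<in> C}" "0 \<in> C" "\<And>a b. a \<in> C \<Longrightarrow> b \<in> C \<Longrightarrow> a + b \<in> C"
    "\<And>a. a \<in> C \<Longrightarrow> - a \<in> C" "\<exists>e>0. \<forall>c\<in>C. \<bar>c\<bar> < e \<longrightarrow> c = 0" "C \<noteq> {0}"
    by (rule Heis_lattice[OF pos L]) (rule that)
  obtain l where "l \<in> C" "l \<noteq> 0" using C(2,6) by blast
  then obtain b where b: "b \<notin> C" "2 * b \<in> C" using discrete_not_divisible[OF C(5)] by blast
  define M where "M = {(t, v). (t, 0) \<in> Lambda' lam \<and> v \<in> L}"
  have M: "M = {(t, c, 0, 0) | t c. t \<in> rot_periods lam \<and> c \<in> C}"
    unfolding M_def Lambda'_eq C(1) by auto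
  interpret covered_lie_group "Osc lam L" "\<lambda>x. M #>\<^bsub>Osc_tilde lam\<^esub> x" M "osc_mult lam" "osc_inv lam"
    unfolding Osc_def M_def[symmetric] by (rule covered_Osc_quot[OF pos C(2-5) M])
  show ?thesis
  proof (rule that[OF group_G])
    let ?a = "M #>\<^bsub>Osc_tilde lam\<^esub> (0, b, 0, 0)"
    have central: "osc_mult lam (0, b, 0, 0) x = osc_mult lam x (0, b, 0, 0)" for x
      by (simp add: osc_mult_period_left[OF rot_periods_group(1)] osc_mult_center_right)
    show "?a \<in> group_center (Osc lam L)"
      unfolding group_center_def
    proof (intro CollectI conjI ballI proj_in_carrier)
      fix x assume "x \<in> carrier (Osc lam L)"
      then have "x \<in> range (\<lambda>x. M #>\<^bsub>Osc_tilde lam\<^esub> x)" by (simp only: range_proj)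
      then obtain y where "x = M #>\<^bsub>Osc_tilde lam\<^esub> y" by (rule rangeE)
      then show "?a \<otimes>\<^bsub>Osc lam L\<^esub> x = x \<otimes>\<^bsub>Osc lam L\<^esub> ?a" by (simp only: mult_proj central)
    qed
    have "(0, 2 * b, 0, 0) - 0 \<in> M" using b(2) rot_periods_group(1) by (simp add: M)
    then have "M #>\<^bsub>Osc_tilde lam\<^esub> 0 = M #>\<^bsub>Osc_tilde lam\<^esub> (0, 2 * b, 0, 0)" by (simp only: proj_eq_iff)
    then show "?a \<otimes>\<^bsub>Osc lam L\<^esub> ?a = \<one>\<^bsub>Osc lam L\<^esub>"
      by (simp add: mult_proj one_proj osc_mult_center_right)
    have "(0, b, 0, 0) - 0 \<notin> M" using b(1) by (simp add: M)
    then have "M #>\<^bsub>Osc_tilde lam\<^esub> 0 \<noteq> ?a" by (simp only: proj_eq_iff not_False_eq_True)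
    then show "?a \<noteq> \<one>\<^bsub>Osc lam L\<^esub>" unfolding one_proj by simp
  qed
qed

text \<open>The two groups are not isomorphic even as abstract groups: only one of them has a central element
  of order two.\<close>

lemma (in irrational_quotient) H_not_isomorphic:
  assumes L: "is_lattice_in (Heis_tilde lam) (group_center (Heis_tilde lam)) L"
  shows "\<not> lie_isomorphic H (Osc lam L)"
proof
  assume "lie_isomorphic H (Osc lam L)"
  then obtain F where F: "F \<in> iso H (Osc lam L)" unfolding lie_isomorphic_def by blast
  obtain a where a: "group (Osc lam L)" "a \<in> group_center (Osc lam L)"
    "a \<otimes>\<^bsub>Osc lam L\<^esub> a = \<one>\<^bsub>Osc lam L\<^esub>" "a \<noteq> \<one>\<^bsub>Osc lam L\<^esub>"
    by (rule Osc_central_involution[OF pos L]) (rule that)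
  obtain h where h: "h \<in> group_center H" "h \<otimes>\<^bsub>H\<^esub> h = \<one>\<^bsub>H\<^esub>" "h \<noteq> \<one>\<^bsub>H\<^esub>"
    by (rule iso_central_involution[OF F H.group_G a]) (rule that)
  then show False using Lambda'_no_central_involution[OF pos H.covered_lie_group_axioms] by blast
qed

theorem proposition3p24:
  fixes lam :: "real^'d" and L :: "'d heis set" and z :: "'d osc set" and \<phi> :: real
  assumes "\<forall>k. lam $ k \<in> \<rat> \<and> 0 < lam $ k"
    and "is_lattice_in (Heis_tilde lam) (group_center (Heis_tilde lam)) L"
    and "z \<in> group_center (Osc_bar lam)" and "z \<noteq> \<one>\<^bsub>Osc_bar lam\<^esub>"
    and "\<phi> / pi \<notin> \<rat>"
  shows "Gamma_sub lam z \<phi> \<subseteq> group_center (lie_prod (Osc_bar lam) circle) \<and>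
    subtopology (topo (lie_prod (Osc_bar lam) circle)) (Gamma_sub lam z \<phi>)
      = discrete_topology (Gamma_sub lam z \<phi>) \<and>
    lie_group (G' lam z \<phi>) \<and>
    \<not> compact_space (topo (G' lam z \<phi>)) \<and>
    has_lie_algebra (G' lam z \<phi>) (g'_bracket lam) (G'_proj lam z \<phi>) \<and>
    (\<exists>\<kappa> :: 'd osc \<times> real \<Rightarrow> 'd osc \<times> real \<Rightarrow> real.
       bilinear \<kappa> \<and> (\<forall>X Y. \<kappa> X Y = \<kappa> Y X) \<and> ad_invariant (g'_bracket lam) \<kappa> \<and>
       (\<forall>V. subspace V \<and>
            V \<subseteq> closure {X \<in> V. generates_non_precompact (G' lam z \<phi>) (G'_proj lam z \<phi>) X} \<longrightarrow>
            (\<forall>X\<in>V. 0 \<le> \<kappa> X X) \<and> dim (form_kernel \<kappa> V) \<le> 1)) \<and>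
    (\<exists>H :: (('d osc set \<times> complex) set, 'd osc) lie.
       connected_lie_subgroup (G' lam z \<phi>) (G'_proj lam z \<phi>) (UNIV \<times> {0}) H \<and>
       \<not> closedin (topo (G' lam z \<phi>)) (carrier H) \<and>
       \<not> lie_isomorphic H (Osc lam L))"
proof -
  have rational: "lam $ k \<in> \<rat>" and pos: "0 < lam $ k" for k using assms(1) by auto
  interpret O: covered_lie_group "Osc_bar lam" "\<lambda>x. Lambda' lam #>\<^bsub>Osc_tilde lam\<^esub> x" "Lambda' lam"
    "osc_mult lam" "osc_inv lam" by (rule covered_Osc_bar[OF pos])
  obtain c where c: "z = Lambda' lam #>\<^bsub>Osc_tilde lam\<^esub> (0, c, 0, 0)"
    by (rule center_covered_by_Lambda'[OF pos O.covered_lie_group_axioms assms(3)]) (rule that)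
  have "c \<noteq> 0" using assms(4) unfolding O.one_proj c by (auto simp: zero_prod_def)
  then interpret irrational_quotient lam c \<phi> z
    using rational pos assms(5) c by unfold_locales
  show ?thesis
  proof (intro conjI)
    show "\<exists>\<kappa> :: 'd osc \<times> real \<Rightarrow> 'd osc \<times> real \<Rightarrow> real.
       bilinear \<kappa> \<and> (\<forall>X Y. \<kappa> X Y = \<kappa> Y X) \<and> ad_invariant (g'_bracket lam) \<kappa> \<and>
       (\<forall>V. subspace V \<and>
            V \<subseteq> closure {X \<in> V. generates_non_precompact (G' lam z \<phi>) (G'_proj lam z \<phi>) X} \<longrightarrow>
            (\<forall>X\<in>V. 0 \<le> \<kappa> X X) \<and> dim (form_kernel \<kappa> V) \<le> 1)"
      using bilinear_osc_form osc_form_sym ad_invariant_osc_form osc_form_condition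
      by (intro exI[of _ osc_form] conjI allI impI; blast)
    show "\<exists>H :: (('d osc set \<times> complex) set, 'd osc) lie.
       connected_lie_subgroup (G' lam z \<phi>) (G'_proj lam z \<phi>) (UNIV \<times> {0}) H \<and>
       \<not> closedin (topo (G' lam z \<phi>)) (carrier H) \<and>
       \<not> lie_isomorphic H (Osc lam L)"
      using connected_lie_subgroup_H H_not_closed H_not_isomorphic[OF assms(2)] by blast
  qed (rule Gamma_central Gamma_discrete Q.lie_group_G G'_not_compact has_lie_algebra_G')+
qed

end
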